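(* For all symmetric monoidal categories $\mathcal A$ and $\mathcal C$, the following equality of 1-cells $\mathcal A\otimes\mathcal C\to\mathcal A\otimes(\mathcal I\otimes\mathcal C)$ holds in $\mathrm{SMC}$: $$A'_{\mathcal A,\mathcal I,\mathcal C}\circ(R'_{\mathcal A}\otimes1_{\mathcal C})=1_{\mathcal A}\otimes L'_{\mathcal C}.$$
   Context: **Basics.** All symmetric monoidal categories are small, with tensor $\otimes$, unit $I$ and natural isomorphisms $ass_{a,b,c}:a\otimes(b\otimes c)\to(a\otimes b)\otimes c$, $r_a:a\otimes I\to a$, $l_a:I\otimes a\to a$, $s_{a,b}:a\otimes b\to b\otimes a$ satisfying the usual coherence axioms. A symmetric monoidal functor $F:\mathcal A\to\mathcal B$ is a lax one: a functor with an arrow $F^0:I\to F(I)$ and a natural family $F^2_{x,y}:Fx\otimes Fy\to F(x\otimes y)$ satisfying the usual associativity, unit and symmetry axioms; it is strict if $F^0$ and all $F^2_{x,y}$ are identities. $\mathrm{SMC}$ is the 2-category of symmetric monoidal categories, symmetric monoidal functors and monoidal natural transformations. **Internal hom.** $[\mathcal A,\mathcal B]$ is the category $\mathrm{SMC}(\mathcal A,\mathcal B)$ with the pointwise symmetric monoidal structure: $(F\Box G)(a)=Fa\otimes Ga$, $(F\Box G)^0$ is $I\cong I\otimes I\xrightarrow{F^0\otimes G^0}F(I)\otimes G(I)$, $(F\Box G)^2_{a,b}$ is the canonical interchange $(Fa\otimes Ga)\otimes(Fb\otimes Gb)\cong(Fa\otimes Fb)\otimes(Ga\otimes Gb)$ followed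 by $F^2_{a,b}\otimes G^2_{a,b}$; $(\sigma\Box\tau)_a=\sigma_a\otimes\tau_a$; the unit is the constant functor at $I_{\mathcal B}$ (with $I\to I$ the identity and $I\otimes I\to I$ the canonical arrow); $ass,r,l,s$ are pointwise. For $F:\mathcal B\to\mathcal C$, $[\mathcal A,F]:[\mathcal A,\mathcal B]\to[\mathcal A,\mathcal C]$ is $H\mapsto F\circ H$, $\theta\mapsto F*\theta$, with $[\mathcal A,F]^0$ having all components $F^0$ and $[\mathcal A,F]^2_{H,K}$ having component $F^2_{Ha,Ka}$ at $a$; for a 2-cell $\sigma$, $[\mathcal A,\sigma]_H=\sigma*H$. For $F:\mathcal C\to\mathcal A$, $[F,1]:[\mathcal A,\mathcal B]\to[\mathcal C,\mathcal B]$ is precomposition with $F$, which is strict. For an object $a$ of $\mathcal A$, $ev_a:[\mathcal A,\mathcal B]\to\mathcal B$ is the strict symmetric monoidal functor $F\mapsto Fa$, $\sigma\mapsto\sigma_a$. **Duality.** For $F:\mathcal A\to[\mathcal B,\mathcal C]$ in $\mathrm{SMC}$, its dual $F^*:\mathcal B\to[\mathcal A,\mathcal C]$ is given by $F^*(b)(a)=F(a)(b)$, $F^*(b)(f)=F(f)_b$, $(F^*b)^0=(F^0)_b$, $(F^*b)^2_{a,a'}=(F^2_{a,a'})_b$, $F^*(g)_a=F(a)(g)$, $((F^* )^0)_a=(Fa)^0$, $((F^* )^2_{b,b'})_a=(Fa)^2_{b,b'}$. **Tensor.** $\mathcal A\otimes\mathcal B$ is the following symmetric monoidal category. Its objects are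 the formal words freely generated from a constant $I$ and symbols $a\otimes b$ ($a$ in $\mathcal A$, $b$ in $\mathcal B$) under a formal binary operation $X\otimes Y$. Its arrows are freely generated, under composition and the operations $p\mapsto X\otimes p$, $p\mapsto p\otimes X$ for objects $X$, by formal arrows $ass,r,l$ (with formal inverses) and $s$ for all objects, and by arrows $\alpha_b:I\to I_{\mathcal A}\otimes b$; $\beta_a:I\to a\otimes I_{\mathcal B}$; $\gamma_{a,a',b}:(a\otimes b)\otimes(a'\otimes b)\to(a\otimes a')\otimes b$; $\delta_{a,b,b'}:(a\otimes b)\otimes(a\otimes b')\to a\otimes(b\otimes b')$; $a\otimes g:a\otimes b\to a\otimes b'$ for $g:b\to b'$ in $\mathcal B$; $f\otimes b:a\otimes b\to a'\otimes b$ for $f:a\to a'$ in $\mathcal A$; modulo the smallest congruence, compatible with all $X\otimes-$ and $-\otimes X$, such that: (i) $\otimes$ is a bifunctor and $\otimes,I,ass,r,l,s$ form a symmetric monoidal structure; (ii) for each $a$, $b\mapsto a\otimes b$, $g\mapsto a\otimes g$ with structure $\beta_a$, $\delta_{a,-,-}$ is a symmetric monoidal functor $\eta(a):\mathcal B\to\mathcal A\otimes\mathcal B$; (iii) for each $b$, $a\mapsto a\otimes b$, $f\mapsto f\otimes b$ with structure $\alpha_b$, $\gamma_{-,-,b}$ is a symmetric monoidal functor $\mathcal A\to\mathcal A\otimes\mathcal B$; (iv) for each $f:a\to a'$ the family $(f\otimes b)_b$, and for each $g:b\to b'$ the family $(a\otimes g)_a$, is a monoidal natural transformation between the corresponding functors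 of (ii), resp. (iii); (v) with $c:I\otimes I\to I$ canonical, $\alpha_{b\otimes b'}\circ c=\delta_{I_{\mathcal A},b,b'}\circ(\alpha_b\otimes\alpha_{b'})$, $\beta_{a\otimes a'}\circ c=\gamma_{a,a',I_{\mathcal B}}\circ(\beta_a\otimes\beta_{a'})$, and $\beta_{I_{\mathcal A}}=\alpha_{I_{\mathcal B}}$; (vi) $\gamma_{a,a',b\otimes b'}\circ(\delta_{a,b,b'}\otimes\delta_{a',b,b'})=\delta_{a\otimes a',b,b'}\circ(\gamma_{a,a',b}\otimes\gamma_{a,a',b'})\circ m$, where $m$ is the canonical isomorphism exchanging the two middle factors $a\otimes b'$ and $a'\otimes b$. The symmetric monoidal functor $\eta:\mathcal A\to[\mathcal B,\mathcal A\otimes\mathcal B]$ is $a\mapsto\eta(a)$, $\eta(f)_b=f\otimes b$, $(\eta^0)_b=\alpha_b$, $(\eta^2_{a,a'})_b=\gamma_{a,a',b}$. **$En$ and $Rn$.** For $F:\mathcal A\to[\mathcal B,\mathcal C]$, $En(F):\mathcal A\otimes\mathcal B\to\mathcal C$ is the strict symmetric monoidal functor with $a\otimes b\mapsto F(a)(b)$, $\alpha_b\mapsto(F^0)_b$, $\beta_a\mapsto(Fa)^0$, $\gamma_{a,a',b}\mapsto(F^2_{a,a'})_b$, $\delta_{a,b,b'}\mapsto(Fa)^2_{b,b'}$, $f\otimes b\mapsto F(f)_b$, $a\otimes g\mapsto F(a)(g)$. $Rn:[\mathcal A\otimes\mathcal B,\mathcal C]\to[\mathcal A,[\mathcal B,\mathcal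 C]]$ is the strict symmetric monoidal functor $F\mapsto[\mathcal B,F]\circ\eta$, $\sigma\mapsto[\mathcal B,\sigma]*\eta$. **Tensor on 1-cells.** For $F:\mathcal A\to\mathcal C$, $F\otimes1_{\mathcal B}=En(\eta\circ F):\mathcal A\otimes\mathcal B\to\mathcal C\otimes\mathcal B$ with $\eta:\mathcal C\to[\mathcal B,\mathcal C\otimes\mathcal B]$; for $G:\mathcal B\to\mathcal D$, $1_{\mathcal A}\otimes G=En([G,1]\circ\eta):\mathcal A\otimes\mathcal B\to\mathcal A\otimes\mathcal D$ with $\eta:\mathcal A\to[\mathcal D,\mathcal A\otimes\mathcal D]$. **Canonical arrows.** $\mathcal I$ is the free symmetric monoidal category on one generating object $\star$ (for each symmetric monoidal category $\mathcal X$ and object $x$ there is a unique strict symmetric monoidal functor $\mathcal I\to\mathcal X$ sending $\star$ to $x$; its objects are formal words in $I,\star,\otimes$). $A'_{\mathcal A,\mathcal B,\mathcal C}:(\mathcal A\otimes\mathcal B)\otimes\mathcal C\to\mathcal A\otimes(\mathcal B\otimes\mathcal C)$ is $En(En(K))$ where $K$ is the composite $\mathcal A\xrightarrow{\eta}[\mathcal B\otimes\mathcal C,\mathcal A\otimes(\mathcal B\otimes\mathcal C)]\xrightarrow{Rn}[\mathcal B,[\mathcal C,\mathcal A\otimes(\mathcal B\otimes\mathcal C)]]$. $R'_{\mathcal A}$ is $\mathcal A\xrightarrow{\eta}[\mathcal I,\mathcal A\otimes\mathcal I]\xrightarrow{ev_\star}\mathcal A\otimes\mathcal I$, and $L'_{\mathcal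 A}$ is $\mathcal A\xrightarrow{\eta^*}[\mathcal I,\mathcal I\otimes\mathcal A]\xrightarrow{ev_\star}\mathcal I\otimes\mathcal A$, with $\eta^*$ the dual of $\eta:\mathcal I\to[\mathcal A,\mathcal I\otimes\mathcal A]$. *)

theory Defs
  imports "HOL-Library.FuncSet"
begin

section \<open>Symmetric monoidal categories\<close>

text \<open>
  Composition is written in applicative order. The inverses of the structural isomorphisms are part
  of the data; they are determined by the axioms below.
\<close>

record ('o, 'm) smcat =
  Obj :: "'o set"
  Arr :: "'m set"
  Dom :: "'m \<Rightarrow> 'o"
  Cod :: "'m \<Rightarrow> 'o"
  Ident :: "'o \<Rightarrow> 'm"  ("\<one>\<index>")
  Comp :: "'m \<Rightarrow> 'm \<Rightarrow> 'm"  (infixr "\<cdot>\<index>" 55)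
  Unit :: "'o"
  TenO :: "'o \<Rightarrow> 'o \<Rightarrow> 'o"  (infixr "\<odot>\<index>" 65)
  TenA :: "'m \<Rightarrow> 'm \<Rightarrow> 'm"  (infixr "\<boxtimes>\<index>" 65)
  Ass :: "'o \<Rightarrow> 'o \<Rightarrow> 'o \<Rightarrow> 'm"
  AssInv :: "'o \<Rightarrow> 'o \<Rightarrow> 'o \<Rightarrow> 'm"
  Run :: "'o \<Rightarrow> 'm"
  RunInv :: "'o \<Rightarrow> 'm"
  Lun :: "'o \<Rightarrow> 'm"
  LunInv :: "'o \<Rightarrow> 'm"
  Swap :: "'o \<Rightarrow> 'o \<Rightarrow> 'm"

definition Hom :: "('o, 'm) smcat \<Rightarrow> 'o \<Rightarrow> 'o \<Rightarrow> 'm set" where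
  "Hom M x y = {f \<in> Arr M. Dom M f = x \<and> Cod M f = y}"

text \<open>
  The typing of the data is separated from the equations: the algebra of formal arrows used for the
  tensor satisfies the former but not the latter. Likewise the equational axioms are given as a
  relation between arrows (the instances of the axioms), which is interpreted both in symmetric
  monoidal categories and, to generate congruences, in algebras of formal arrows.
\<close>

locale sm_data =
  fixes M :: "('o, 'm) smcat" (structure)
  assumes Dom_in: "f \<in> Arr M \<Longrightarrow> Dom M f \<in> Obj M"
    and Cod_in: "f \<in> Arr M \<Longrightarrow> Cod M f \<in> Obj M"
    and Ident_in: "x \<in> Obj M \<Longrightarrow> \<one> x \<in> Hom M x x"
    and Comp_in: "f \<in> Hom M x y \<Longrightarrow> g \<in> Hom M y z \<Longrightarrow> g \<cdot> f \<in> Hom M x z"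
    and Unit_in: "Unit M \<in> Obj M"
    and TenO_in: "x \<in> Obj M \<Longrightarrow> y \<in> Obj M \<Longrightarrow> x \<odot> y \<in> Obj M"
    and TenA_in: "f \<in> Hom M x x' \<Longrightarrow> g \<in> Hom M y y' \<Longrightarrow> f \<boxtimes> g \<in> Hom M (x \<odot> y) (x' \<odot> y')"
    and Ass_in: "x \<in> Obj M \<Longrightarrow> y \<in> Obj M \<Longrightarrow> z \<in> Obj M \<Longrightarrow>
      Ass M x y z \<in> Hom M (x \<odot> (y \<odot> z)) ((x \<odot> y) \<odot> z)"
    and AssInv_in: "x \<in> Obj M \<Longrightarrow> y \<in> Obj M \<Longrightarrow> z \<in> Obj M \<Longrightarrow>
      AssInv M x y z \<in> Hom M ((x \<odot> y) \<odot> z) (x \<odot> (y \<odot> z))"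
    and Run_in: "x \<in> Obj M \<Longrightarrow> Run M x \<in> Hom M (x \<odot> Unit M) x"
    and RunInv_in: "x \<in> Obj M \<Longrightarrow> RunInv M x \<in> Hom M x (x \<odot> Unit M)"
    and Lun_in: "x \<in> Obj M \<Longrightarrow> Lun M x \<in> Hom M (Unit M \<odot> x) x"
    and LunInv_in: "x \<in> Obj M \<Longrightarrow> LunInv M x \<in> Hom M x (Unit M \<odot> x)"
    and Swap_in: "x \<in> Obj M \<Longrightarrow> y \<in> Obj M \<Longrightarrow> Swap M x y \<in> Hom M (x \<odot> y) (y \<odot> x)"

inductive smc_eq :: "('o, 'm) smcat \<Rightarrow> 'm \<Rightarrow> 'm \<Rightarrow> bool" for M where
  comp_id: "f \<in> Hom M x y \<Longrightarrow> smc_eq M (f \<cdot>\<^bsub>M\<^esub> \<one>\<^bsub>M\<^esub> x) f"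
| id_comp: "f \<in> Hom M x y \<Longrightarrow> smc_eq M (\<one>\<^bsub>M\<^esub> y \<cdot>\<^bsub>M\<^esub> f) f"
| comp_assoc: "f \<in> Hom M x y \<Longrightarrow> g \<in> Hom M y z \<Longrightarrow> h \<in> Hom M z w \<Longrightarrow>
    smc_eq M ((h \<cdot>\<^bsub>M\<^esub> g) \<cdot>\<^bsub>M\<^esub> f) (h \<cdot>\<^bsub>M\<^esub> (g \<cdot>\<^bsub>M\<^esub> f))"
| ten_id: "x \<in> Obj M \<Longrightarrow> y \<in> Obj M \<Longrightarrow>
    smc_eq M (\<one>\<^bsub>M\<^esub> x \<boxtimes>\<^bsub>M\<^esub> \<one>\<^bsub>M\<^esub> y) (\<one>\<^bsub>M\<^esub> (x \<odot>\<^bsub>M\<^esub> y))"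
| ten_comp: "f \<in> Hom M x y \<Longrightarrow> f' \<in> Hom M y z \<Longrightarrow> g \<in> Hom M u v \<Longrightarrow> g' \<in> Hom M v w \<Longrightarrow>
    smc_eq M ((f' \<cdot>\<^bsub>M\<^esub> f) \<boxtimes>\<^bsub>M\<^esub> (g' \<cdot>\<^bsub>M\<^esub> g)) ((f' \<boxtimes>\<^bsub>M\<^esub> g') \<cdot>\<^bsub>M\<^esub> (f \<boxtimes>\<^bsub>M\<^esub> g))"
| ass_iso1: "x \<in> Obj M \<Longrightarrow> y \<in> Obj M \<Longrightarrow> z \<in> Obj M \<Longrightarrow>
    smc_eq M (AssInv M x y z \<cdot>\<^bsub>M\<^esub> Ass M x y z) (\<one>\<^bsub>M\<^esub> (x \<odot>\<^bsub>M\<^esub> (y \<odot>\<^bsub>M\<^esub> z)))"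
| ass_iso2: "x \<in> Obj M \<Longrightarrow> y \<in> Obj M \<Longrightarrow> z \<in> Obj M \<Longrightarrow>
    smc_eq M (Ass M x y z \<cdot>\<^bsub>M\<^esub> AssInv M x y z) (\<one>\<^bsub>M\<^esub> ((x \<odot>\<^bsub>M\<^esub> y) \<odot>\<^bsub>M\<^esub> z))"
| run_iso1: "x \<in> Obj M \<Longrightarrow> smc_eq M (RunInv M x \<cdot>\<^bsub>M\<^esub> Run M x) (\<one>\<^bsub>M\<^esub> (x \<odot>\<^bsub>M\<^esub> Unit M))"
| run_iso2: "x \<in> Obj M \<Longrightarrow> smc_eq M (Run M x \<cdot>\<^bsub>M\<^esub> RunInv M x) (\<one>\<^bsub>M\<^esub> x)"
| lun_iso1: "x \<in> Obj M \<Longrightarrow> smc_eq M (LunInv M x \<cdot>\<^bsub>M\<^esub> Lun M x) (\<one>\<^bsub>M\<^esub> (Unit M \<odot>\<^bsub>M\<^esub> x))"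
| lun_iso2: "x \<in> Obj M \<Longrightarrow> smc_eq M (Lun M x \<cdot>\<^bsub>M\<^esub> LunInv M x) (\<one>\<^bsub>M\<^esub> x)"
| ass_nat: "f \<in> Hom M x x' \<Longrightarrow> g \<in> Hom M y y' \<Longrightarrow> h \<in> Hom M z z' \<Longrightarrow>
    smc_eq M (((f \<boxtimes>\<^bsub>M\<^esub> g) \<boxtimes>\<^bsub>M\<^esub> h) \<cdot>\<^bsub>M\<^esub> Ass M x y z) (Ass M x' y' z' \<cdot>\<^bsub>M\<^esub> (f \<boxtimes>\<^bsub>M\<^esub> (g \<boxtimes>\<^bsub>M\<^esub> h)))"
| run_nat: "f \<in> Hom M x x' \<Longrightarrow> smc_eq M (f \<cdot>\<^bsub>M\<^esub> Run M x) (Run M x' \<cdot>\<^bsub>M\<^esub> (f \<boxtimes>\<^bsub>M\<^esub> \<one>\<^bsub>M\<^esub> (Unit M)))"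
| lun_nat: "f \<in> Hom M x x' \<Longrightarrow> smc_eq M (f \<cdot>\<^bsub>M\<^esub> Lun M x) (Lun M x' \<cdot>\<^bsub>M\<^esub> (\<one>\<^bsub>M\<^esub> (Unit M) \<boxtimes>\<^bsub>M\<^esub> f))"
| swap_nat: "f \<in> Hom M x x' \<Longrightarrow> g \<in> Hom M y y' \<Longrightarrow>
    smc_eq M ((g \<boxtimes>\<^bsub>M\<^esub> f) \<cdot>\<^bsub>M\<^esub> Swap M x y) (Swap M x' y' \<cdot>\<^bsub>M\<^esub> (f \<boxtimes>\<^bsub>M\<^esub> g))"
| pentagon: "x \<in> Obj M \<Longrightarrow> y \<in> Obj M \<Longrightarrow> z \<in> Obj M \<Longrightarrow> w \<in> Obj M \<Longrightarrow>
    smc_eq M (Ass M (x \<odot>\<^bsub>M\<^esub> y) z w \<cdot>\<^bsub>M\<^esub> Ass M x y (z \<odot>\<^bsub>M\<^esub> w))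
      ((Ass M x y z \<boxtimes>\<^bsub>M\<^esub> \<one>\<^bsub>M\<^esub> w) \<cdot>\<^bsub>M\<^esub> Ass M x (y \<odot>\<^bsub>M\<^esub> z) w \<cdot>\<^bsub>M\<^esub> (\<one>\<^bsub>M\<^esub> x \<boxtimes>\<^bsub>M\<^esub> Ass M y z w))"
| triangle: "x \<in> Obj M \<Longrightarrow> y \<in> Obj M \<Longrightarrow>
    smc_eq M ((Run M x \<boxtimes>\<^bsub>M\<^esub> \<one>\<^bsub>M\<^esub> y) \<cdot>\<^bsub>M\<^esub> Ass M x (Unit M) y) (\<one>\<^bsub>M\<^esub> x \<boxtimes>\<^bsub>M\<^esub> Lun M y)"
| swap_swap: "x \<in> Obj M \<Longrightarrow> y \<in> Obj M \<Longrightarrow> smc_eq M (Swap M y x \<cdot>\<^bsub>M\<^esub> Swap M x y) (\<one>\<^bsub>M\<^esub> (x \<odot>\<^bsub>M\<^esub> y))"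
| swap_unit: "x \<in> Obj M \<Longrightarrow> smc_eq M (Lun M x \<cdot>\<^bsub>M\<^esub> Swap M x (Unit M)) (Run M x)"
| hexagon: "x \<in> Obj M \<Longrightarrow> y \<in> Obj M \<Longrightarrow> z \<in> Obj M \<Longrightarrow>
    smc_eq M (Ass M z x y \<cdot>\<^bsub>M\<^esub> Swap M (x \<odot>\<^bsub>M\<^esub> y) z \<cdot>\<^bsub>M\<^esub> Ass M x y z)
      ((Swap M x z \<boxtimes>\<^bsub>M\<^esub> \<one>\<^bsub>M\<^esub> y) \<cdot>\<^bsub>M\<^esub> Ass M x z y \<cdot>\<^bsub>M\<^esub> (\<one>\<^bsub>M\<^esub> x \<boxtimes>\<^bsub>M\<^esub> Swap M y z))"

locale sm_category = sm_data +
  assumes axioms_hold: "smc_eq M p q \<Longrightarrow> p = q"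

text \<open>
  The canonical arrow from \<open>(x \<odot> y) \<odot> (z \<odot> w)\<close> to \<open>(x \<odot> z) \<odot> (y \<odot> w)\<close>, with one choice of
  bracketing path (by coherence the choice does not matter).
\<close>

definition interchange :: "('o, 'm) smcat \<Rightarrow> 'o \<Rightarrow> 'o \<Rightarrow> 'o \<Rightarrow> 'o \<Rightarrow> 'm" where
  "interchange M x y z w =
     Ass M x z (y \<odot>\<^bsub>M\<^esub> w)
     \<cdot>\<^bsub>M\<^esub> (\<one>\<^bsub>M\<^esub> x \<boxtimes>\<^bsub>M\<^esub> AssInv M z y w)
     \<cdot>\<^bsub>M\<^esub> (\<one>\<^bsub>M\<^esub> x \<boxtimes>\<^bsub>M\<^esub> (Swap M y z \<boxtimes>\<^bsub>M\<^esub> \<one>\<^bsub>M\<^esub> w))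
     \<cdot>\<^bsub>M\<^esub> (\<one>\<^bsub>M\<^esub> x \<boxtimes>\<^bsub>M\<^esub> Ass M y z w)
     \<cdot>\<^bsub>M\<^esub> AssInv M x y (z \<odot>\<^bsub>M\<^esub> w)"


section \<open>Symmetric monoidal functors and monoidal natural transformations\<close>

record ('o1, 'm1, 'o2, 'm2) smfun =
  FO :: "'o1 \<Rightarrow> 'o2"
  FA :: "'m1 \<Rightarrow> 'm2"
  F0 :: "'m2"
  F2 :: "'o1 \<times> 'o1 \<Rightarrow> 'm2"

inductive functor_eq ::
  "('o1, 'm1) smcat \<Rightarrow> ('o2, 'm2) smcat \<Rightarrow> ('o1, 'm1, 'o2, 'm2) smfun \<Rightarrow> 'm2 \<Rightarrow> 'm2 \<Rightarrow> bool"
  for M N F where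
  fun_id: "x \<in> Obj M \<Longrightarrow> functor_eq M N F (FA F (\<one>\<^bsub>M\<^esub> x)) (\<one>\<^bsub>N\<^esub> (FO F x))"
| fun_comp: "f \<in> Hom M x y \<Longrightarrow> g \<in> Hom M y z \<Longrightarrow>
    functor_eq M N F (FA F (g \<cdot>\<^bsub>M\<^esub> f)) (FA F g \<cdot>\<^bsub>N\<^esub> FA F f)"
| F2_nat: "f \<in> Hom M x x' \<Longrightarrow> g \<in> Hom M y y' \<Longrightarrow>
    functor_eq M N F (FA F (f \<boxtimes>\<^bsub>M\<^esub> g) \<cdot>\<^bsub>N\<^esub> F2 F (x, y)) (F2 F (x', y') \<cdot>\<^bsub>N\<^esub> (FA F f \<boxtimes>\<^bsub>N\<^esub> FA F g))"
| F2_ass: "x \<in> Obj M \<Longrightarrow> y \<in> Obj M \<Longrightarrow> z \<in> Obj M \<Longrightarrow>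
    functor_eq M N F
      (FA F (Ass M x y z) \<cdot>\<^bsub>N\<^esub> F2 F (x, y \<odot>\<^bsub>M\<^esub> z) \<cdot>\<^bsub>N\<^esub> (\<one>\<^bsub>N\<^esub> (FO F x) \<boxtimes>\<^bsub>N\<^esub> F2 F (y, z)))
      (F2 F (x \<odot>\<^bsub>M\<^esub> y, z) \<cdot>\<^bsub>N\<^esub> (F2 F (x, y) \<boxtimes>\<^bsub>N\<^esub> \<one>\<^bsub>N\<^esub> (FO F z)) \<cdot>\<^bsub>N\<^esub> Ass N (FO F x) (FO F y) (FO F z))"
| F2_run: "x \<in> Obj M \<Longrightarrow>
    functor_eq M N F (FA F (Run M x) \<cdot>\<^bsub>N\<^esub> F2 F (x, Unit M) \<cdot>\<^bsub>N\<^esub> (\<one>\<^bsub>N\<^esub> (FO F x) \<boxtimes>\<^bsub>N\<^esub> F0 F)) (Run N (FO F x))"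
| F2_lun: "x \<in> Obj M \<Longrightarrow>
    functor_eq M N F (FA F (Lun M x) \<cdot>\<^bsub>N\<^esub> F2 F (Unit M, x) \<cdot>\<^bsub>N\<^esub> (F0 F \<boxtimes>\<^bsub>N\<^esub> \<one>\<^bsub>N\<^esub> (FO F x))) (Lun N (FO F x))"
| F2_swap: "x \<in> Obj M \<Longrightarrow> y \<in> Obj M \<Longrightarrow>
    functor_eq M N F (FA F (Swap M x y) \<cdot>\<^bsub>N\<^esub> F2 F (x, y)) (F2 F (y, x) \<cdot>\<^bsub>N\<^esub> Swap N (FO F x) (FO F y))"

text \<open>
  Functors are required to be \<open>undefined\<close> outside the carriers, so that equality of 1-cells with given
  source and target is equality of the records.
\<close>

locale sm_functor = M: sm_category M + N: sm_category N
  for M :: "('o1, 'm1) smcat" and N :: "('o2, 'm2) smcat" and F :: "('o1, 'm1, 'o2, 'm2) smfun" +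
  assumes FO_ext: "FO F \<in> extensional (Obj M)"
    and FA_ext: "FA F \<in> extensional (Arr M)"
    and F2_ext: "F2 F \<in> extensional (Obj M \<times> Obj M)"
    and FO_in: "x \<in> Obj M \<Longrightarrow> FO F x \<in> Obj N"
    and FA_in: "f \<in> Hom M x y \<Longrightarrow> FA F f \<in> Hom N (FO F x) (FO F y)"
    and F0_in: "F0 F \<in> Hom N (Unit N) (FO F (Unit M))"
    and F2_in: "x \<in> Obj M \<Longrightarrow> y \<in> Obj M \<Longrightarrow> F2 F (x, y) \<in> Hom N (FO F x \<odot>\<^bsub>N\<^esub> FO F y) (FO F (x \<odot>\<^bsub>M\<^esub> y))"
    and functor_axioms_hold: "functor_eq M N F p q \<Longrightarrow> p = q"

definition comp_fun ::
  "('o1, 'm1) smcat \<Rightarrow> ('o3, 'm3) smcat \<Rightarrow>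
   ('o2, 'm2, 'o3, 'm3) smfun \<Rightarrow> ('o1, 'm1, 'o2, 'm2) smfun \<Rightarrow> ('o1, 'm1, 'o3, 'm3) smfun" where
  "comp_fun A C G F =
     \<lparr> FO = (\<lambda>x\<in>Obj A. FO G (FO F x)),
       FA = (\<lambda>f\<in>Arr A. FA G (FA F f)),
       F0 = FA G (F0 F) \<cdot>\<^bsub>C\<^esub> F0 G,
       F2 = (\<lambda>(x, y)\<in>Obj A \<times> Obj A. FA G (F2 F (x, y)) \<cdot>\<^bsub>C\<^esub> F2 G (FO F x, FO F y)) \<rparr>"

definition strict_fun ::
  "('o1, 'm1) smcat \<Rightarrow> ('o2, 'm2) smcat \<Rightarrow> ('o1 \<Rightarrow> 'o2) \<Rightarrow> ('m1 \<Rightarrow> 'm2) \<Rightarrow> ('o1, 'm1, 'o2, 'm2) smfun" where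
  "strict_fun A B fo fa =
     \<lparr> FO = restrict fo (Obj A),
       FA = restrict fa (Arr A),
       F0 = \<one>\<^bsub>B\<^esub> (Unit B),
       F2 = (\<lambda>(x, y)\<in>Obj A \<times> Obj A. \<one>\<^bsub>B\<^esub> (fo x \<odot>\<^bsub>B\<^esub> fo y)) \<rparr>"

inductive mnat_eq ::
  "('o1, 'm1) smcat \<Rightarrow> ('o2, 'm2) smcat \<Rightarrow> ('o1, 'm1, 'o2, 'm2) smfun \<Rightarrow> ('o1, 'm1, 'o2, 'm2) smfun \<Rightarrow>
   ('o1 \<Rightarrow> 'm2) \<Rightarrow> 'm2 \<Rightarrow> 'm2 \<Rightarrow> bool"
  for M N F G \<theta> where
  naturality: "f \<in> Hom M x y \<Longrightarrow> mnat_eq M N F G \<theta> (FA G f \<cdot>\<^bsub>N\<^esub> \<theta> x) (\<theta> y \<cdot>\<^bsub>N\<^esub> FA F f)"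
| mon_unit: "mnat_eq M N F G \<theta> (\<theta> (Unit M) \<cdot>\<^bsub>N\<^esub> F0 F) (F0 G)"
| mon_ten: "x \<in> Obj M \<Longrightarrow> y \<in> Obj M \<Longrightarrow>
    mnat_eq M N F G \<theta> (\<theta> (x \<odot>\<^bsub>M\<^esub> y) \<cdot>\<^bsub>N\<^esub> F2 F (x, y)) (F2 G (x, y) \<cdot>\<^bsub>N\<^esub> (\<theta> x \<boxtimes>\<^bsub>N\<^esub> \<theta> y))"

record ('o1, 'm1, 'o2, 'm2) mnt =
  ntDom :: "('o1, 'm1, 'o2, 'm2) smfun"
  ntCod :: "('o1, 'm1, 'o2, 'm2) smfun"
  ntMap :: "'o1 \<Rightarrow> 'm2"

locale mon_nat = F: sm_functor M N "ntDom \<sigma>" + G: sm_functor M N "ntCod \<sigma>"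
  for M :: "('o1, 'm1) smcat" and N :: "('o2, 'm2) smcat" and \<sigma> :: "('o1, 'm1, 'o2, 'm2) mnt" +
  assumes ntMap_ext: "ntMap \<sigma> \<in> extensional (Obj M)"
    and ntMap_in: "x \<in> Obj M \<Longrightarrow> ntMap \<sigma> x \<in> Hom N (FO (ntDom \<sigma>) x) (FO (ntCod \<sigma>) x)"
    and mnat_axioms_hold: "mnat_eq M N (ntDom \<sigma>) (ntCod \<sigma>) (ntMap \<sigma>) p q \<Longrightarrow> p = q"


section \<open>Internal hom\<close>

text \<open>The canonical arrow \<open>I \<otimes> I \<rightarrow> I\<close> is taken to be \<open>Run\<close> at the unit (it equals \<open>Lun\<close> there).\<close>

definition const_fun :: "('o1, 'm1) smcat \<Rightarrow> ('o2, 'm2) smcat \<Rightarrow> ('o1, 'm1, 'o2, 'm2) smfun" where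
  "const_fun A B =
     \<lparr> FO = (\<lambda>a\<in>Obj A. Unit B),
       FA = (\<lambda>f\<in>Arr A. \<one>\<^bsub>B\<^esub> (Unit B)),
       F0 = \<one>\<^bsub>B\<^esub> (Unit B),
       F2 = (\<lambda>(a, a')\<in>Obj A \<times> Obj A. Run B (Unit B)) \<rparr>"

definition box_fun ::
  "('o1, 'm1) smcat \<Rightarrow> ('o2, 'm2) smcat \<Rightarrow>
   ('o1, 'm1, 'o2, 'm2) smfun \<Rightarrow> ('o1, 'm1, 'o2, 'm2) smfun \<Rightarrow> ('o1, 'm1, 'o2, 'm2) smfun" where
  "box_fun A B F G =
     \<lparr> FO = (\<lambda>a\<in>Obj A. FO F a \<odot>\<^bsub>B\<^esub> FO G a),
       FA = (\<lambda>f\<in>Arr A. FA F f \<boxtimes>\<^bsub>B\<^esub> FA G f),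
       F0 = (F0 F \<boxtimes>\<^bsub>B\<^esub> F0 G) \<cdot>\<^bsub>B\<^esub> RunInv B (Unit B),
       F2 = (\<lambda>(a, b)\<in>Obj A \<times> Obj A.
               (F2 F (a, b) \<boxtimes>\<^bsub>B\<^esub> F2 G (a, b)) \<cdot>\<^bsub>B\<^esub> interchange B (FO F a) (FO G a) (FO F b) (FO G b)) \<rparr>"

definition hom ::
  "('o1, 'm1) smcat \<Rightarrow> ('o2, 'm2) smcat \<Rightarrow> (('o1, 'm1, 'o2, 'm2) smfun, ('o1, 'm1, 'o2, 'm2) mnt) smcat"
  where
  "hom A B =
     \<lparr> Obj = {F. sm_functor A B F},
       Arr = {\<sigma>. mon_nat A B \<sigma>},
       Dom = ntDom,
       Cod = ntCod,
       Ident = (\<lambda>F. \<lparr> ntDom = F, ntCod = F, ntMap = (\<lambda>a\<in>Obj A. \<one>\<^bsub>B\<^esub> (FO F a)) \<rparr>),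
       Comp = (\<lambda>\<tau> \<sigma>. \<lparr> ntDom = ntDom \<sigma>, ntCod = ntCod \<tau>,
                        ntMap = (\<lambda>a\<in>Obj A. ntMap \<tau> a \<cdot>\<^bsub>B\<^esub> ntMap \<sigma> a) \<rparr>),
       Unit = const_fun A B,
       TenO = box_fun A B,
       TenA = (\<lambda>\<sigma> \<tau>. \<lparr> ntDom = box_fun A B (ntDom \<sigma>) (ntDom \<tau>), ntCod = box_fun A B (ntCod \<sigma>) (ntCod \<tau>),
                        ntMap = (\<lambda>a\<in>Obj A. ntMap \<sigma> a \<boxtimes>\<^bsub>B\<^esub> ntMap \<tau> a) \<rparr>),
       Ass = (\<lambda>F G H. \<lparr> ntDom = box_fun A B F (box_fun A B G H), ntCod = box_fun A B (box_fun A B F G) H,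
                         ntMap = (\<lambda>a\<in>Obj A. Ass B (FO F a) (FO G a) (FO H a)) \<rparr>),
       AssInv = (\<lambda>F G H. \<lparr> ntDom = box_fun A B (box_fun A B F G) H, ntCod = box_fun A B F (box_fun A B G H),
                            ntMap = (\<lambda>a\<in>Obj A. AssInv B (FO F a) (FO G a) (FO H a)) \<rparr>),
       Run = (\<lambda>F. \<lparr> ntDom = box_fun A B F (const_fun A B), ntCod = F, ntMap = (\<lambda>a\<in>Obj A. Run B (FO F a)) \<rparr>),
       RunInv = (\<lambda>F. \<lparr> ntDom = F, ntCod = box_fun A B F (const_fun A B), ntMap = (\<lambda>a\<in>Obj A. RunInv B (FO F a)) \<rparr>),
       Lun = (\<lambda>F. \<lparr> ntDom = box_fun A B (const_fun A B) F, ntCod = F, ntMap = (\<lambda>a\<in>Obj A. Lun B (FO F a)) \<rparr>),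
       LunInv = (\<lambda>F. \<lparr> ntDom = F, ntCod = box_fun A B (const_fun A B) F, ntMap = (\<lambda>a\<in>Obj A. LunInv B (FO F a)) \<rparr>),
       Swap = (\<lambda>F G. \<lparr> ntDom = box_fun A B F G, ntCod = box_fun A B G F,
                        ntMap = (\<lambda>a\<in>Obj A. Swap B (FO F a) (FO G a)) \<rparr>) \<rparr>"

text \<open>Whiskering: \<open>whisker_left A F \<theta>\<close> is $F * \theta$ and \<open>whisker_right A \<sigma> H\<close> is $\sigma * H$, where
  \<open>A\<close> is the source of the composites and \<open>C\<close> their target.\<close>

definition whisker_left ::
  "('o1, 'm1) smcat \<Rightarrow> ('o3, 'm3) smcat \<Rightarrow> ('o2, 'm2, 'o3, 'm3) smfun \<Rightarrow> ('o1, 'm1, 'o2, 'm2) mnt \<Rightarrow>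
   ('o1, 'm1, 'o3, 'm3) mnt" where
  "whisker_left A C F \<theta> =
     \<lparr> ntDom = comp_fun A C F (ntDom \<theta>), ntCod = comp_fun A C F (ntCod \<theta>),
       ntMap = (\<lambda>a\<in>Obj A. FA F (ntMap \<theta> a)) \<rparr>"

definition whisker_right ::
  "('o1, 'm1) smcat \<Rightarrow> ('o3, 'm3) smcat \<Rightarrow> ('o2, 'm2, 'o3, 'm3) mnt \<Rightarrow> ('o1, 'm1, 'o2, 'm2) smfun \<Rightarrow>
   ('o1, 'm1, 'o3, 'm3) mnt" where
  "whisker_right A C \<sigma> H =
     \<lparr> ntDom = comp_fun A C (ntDom \<sigma>) H, ntCod = comp_fun A C (ntCod \<sigma>) H,
       ntMap = (\<lambda>a\<in>Obj A. ntMap \<sigma> (FO H a)) \<rparr>"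

text \<open>\<open>postcomp A B C F\<close> is $[A,F] : [A,B] \to [A,C]$, for $F : B \to C$.\<close>

definition postcomp ::
  "('o1, 'm1) smcat \<Rightarrow> ('o2, 'm2) smcat \<Rightarrow> ('o3, 'm3) smcat \<Rightarrow> ('o2, 'm2, 'o3, 'm3) smfun \<Rightarrow>
   (('o1, 'm1, 'o2, 'm2) smfun, ('o1, 'm1, 'o2, 'm2) mnt,
    ('o1, 'm1, 'o3, 'm3) smfun, ('o1, 'm1, 'o3, 'm3) mnt) smfun" where
  "postcomp A B C F =
     \<lparr> FO = (\<lambda>H\<in>Obj (hom A B). comp_fun A C F H),
       FA = (\<lambda>\<theta>\<in>Arr (hom A B). whisker_left A C F \<theta>),
       F0 = \<lparr> ntDom = Unit (hom A C), ntCod = comp_fun A C F (Unit (hom A B)),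
              ntMap = (\<lambda>a\<in>Obj A. F0 F) \<rparr>,
       F2 = (\<lambda>(H, K)\<in>Obj (hom A B) \<times> Obj (hom A B).
              \<lparr> ntDom = comp_fun A C F H \<odot>\<^bsub>hom A C\<^esub> comp_fun A C F K,
                ntCod = comp_fun A C F (H \<odot>\<^bsub>hom A B\<^esub> K),
                ntMap = (\<lambda>a\<in>Obj A. F2 F (FO H a, FO K a)) \<rparr>) \<rparr>"

text \<open>\<open>postcomp_nt A B C \<sigma>\<close> is the 2-cell $[A,\sigma]$.\<close>

definition postcomp_nt ::
  "('o1, 'm1) smcat \<Rightarrow> ('o2, 'm2) smcat \<Rightarrow> ('o3, 'm3) smcat \<Rightarrow> ('o2, 'm2, 'o3, 'm3) mnt \<Rightarrow>
   (('o1, 'm1, 'o2, 'm2) smfun, ('o1, 'm1, 'o2, 'm2) mnt,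
    ('o1, 'm1, 'o3, 'm3) smfun, ('o1, 'm1, 'o3, 'm3) mnt) mnt" where
  "postcomp_nt A B C \<sigma> =
     \<lparr> ntDom = postcomp A B C (ntDom \<sigma>), ntCod = postcomp A B C (ntCod \<sigma>),
       ntMap = (\<lambda>H\<in>Obj (hom A B). whisker_right A C \<sigma> H) \<rparr>"

text \<open>\<open>precomp C A B F\<close> is $[F,1] : [A,B] \to [C,B]$, for $F : C \to A$.\<close>

definition precomp ::
  "('o1, 'm1) smcat \<Rightarrow> ('o2, 'm2) smcat \<Rightarrow> ('o3, 'm3) smcat \<Rightarrow> ('o1, 'm1, 'o2, 'm2) smfun \<Rightarrow>
   (('o2, 'm2, 'o3, 'm3) smfun, ('o2, 'm2, 'o3, 'm3) mnt,
    ('o1, 'm1, 'o3, 'm3) smfun, ('o1, 'm1, 'o3, 'm3) mnt) smfun" where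
  "precomp C A B F =
     strict_fun (hom A B) (hom C B) (\<lambda>H. comp_fun C B H F) (\<lambda>\<theta>. whisker_right C B \<theta> F)"

definition eval_at ::
  "('o1, 'm1) smcat \<Rightarrow> ('o2, 'm2) smcat \<Rightarrow> 'o1 \<Rightarrow>
   (('o1, 'm1, 'o2, 'm2) smfun, ('o1, 'm1, 'o2, 'm2) mnt, 'o2, 'm2) smfun" where
  "eval_at A B a = strict_fun (hom A B) B (\<lambda>F. FO F a) (\<lambda>\<sigma>. ntMap \<sigma> a)"

text \<open>\<open>dual_obj\<close> is $F^*(b)$ and \<open>dual\<close> is $F^* : B \to [A,C]$, for $F : A \to [B,C]$.\<close>

definition dual_obj ::
  "('o1, 'm1) smcat \<Rightarrow>
   ('o1, 'm1, ('o2, 'm2, 'o3, 'm3) smfun, ('o2, 'm2, 'o3, 'm3) mnt) smfun \<Rightarrow> 'o2 \<Rightarrow>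
   ('o1, 'm1, 'o3, 'm3) smfun" where
  "dual_obj A F b =
     \<lparr> FO = (\<lambda>a\<in>Obj A. FO (FO F a) b),
       FA = (\<lambda>f\<in>Arr A. ntMap (FA F f) b),
       F0 = ntMap (F0 F) b,
       F2 = (\<lambda>(a, a')\<in>Obj A \<times> Obj A. ntMap (F2 F (a, a')) b) \<rparr>"

definition dual ::
  "('o1, 'm1) smcat \<Rightarrow> ('o2, 'm2) smcat \<Rightarrow> ('o3, 'm3) smcat \<Rightarrow>
   ('o1, 'm1, ('o2, 'm2, 'o3, 'm3) smfun, ('o2, 'm2, 'o3, 'm3) mnt) smfun \<Rightarrow>
   ('o2, 'm2, ('o1, 'm1, 'o3, 'm3) smfun, ('o1, 'm1, 'o3, 'm3) mnt) smfun" where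
  "dual A B C F =
     \<lparr> FO = (\<lambda>b\<in>Obj B. dual_obj A F b),
       FA = (\<lambda>g\<in>Arr B. \<lparr> ntDom = dual_obj A F (Dom B g), ntCod = dual_obj A F (Cod B g),
                         ntMap = (\<lambda>a\<in>Obj A. FA (FO F a) g) \<rparr>),
       F0 = \<lparr> ntDom = Unit (hom A C), ntCod = dual_obj A F (Unit B),
              ntMap = (\<lambda>a\<in>Obj A. F0 (FO F a)) \<rparr>,
       F2 = (\<lambda>(b, b')\<in>Obj B \<times> Obj B.
              \<lparr> ntDom = dual_obj A F b \<odot>\<^bsub>hom A C\<^esub> dual_obj A F b', ntCod = dual_obj A F (b \<odot>\<^bsub>B\<^esub> b'),
                ntMap = (\<lambda>a\<in>Obj A. F2 (FO F a) (b, b')) \<rparr>) \<rparr>"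


section \<open>Presented symmetric monoidal categories\<close>

datatype 'x word = WUnit | WGen 'x | WTen "'x word" "'x word"

datatype ('x, 'e) fterm =
    TGen 'e
  | TId "'x word"
  | TComp "('x, 'e) fterm" "('x, 'e) fterm"
  | TLeft "'x word" "('x, 'e) fterm"  \<comment> \<open>$p \mapsto X \otimes p$\<close>
  | TRight "('x, 'e) fterm" "'x word"  \<comment> \<open>$p \mapsto p \otimes X$\<close>
  | TAss "'x word" "'x word" "'x word"
  | TAssInv "'x word" "'x word" "'x word"
  | TRun "'x word"
  | TRunInv "'x word"
  | TLun "'x word"
  | TLunInv "'x word"
  | TSwap "'x word" "'x word"

record ('x, 'e) fsig =
  sObj :: "'x set"
  sArr :: "'e set"
  sDom :: "'e \<Rightarrow> 'x word"
  sCod :: "'e \<Rightarrow> 'x word"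

primrec tdom :: "('x, 'e) fsig \<Rightarrow> ('x, 'e) fterm \<Rightarrow> 'x word" where
  "tdom S (TGen e) = sDom S e"
| "tdom S (TId X) = X"
| "tdom S (TComp u t) = tdom S t"
| "tdom S (TLeft X t) = WTen X (tdom S t)"
| "tdom S (TRight t X) = WTen (tdom S t) X"
| "tdom S (TAss X Y Z) = WTen X (WTen Y Z)"
| "tdom S (TAssInv X Y Z) = WTen (WTen X Y) Z"
| "tdom S (TRun X) = WTen X WUnit"
| "tdom S (TRunInv X) = X"
| "tdom S (TLun X) = WTen WUnit X"
| "tdom S (TLunInv X) = X"
| "tdom S (TSwap X Y) = WTen X Y"

primrec tcod :: "('x, 'e) fsig \<Rightarrow> ('x, 'e) fterm \<Rightarrow> 'x word" where
  "tcod S (TGen e) = sCod S e"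
| "tcod S (TId X) = X"
| "tcod S (TComp u t) = tcod S u"
| "tcod S (TLeft X t) = WTen X (tcod S t)"
| "tcod S (TRight t X) = WTen (tcod S t) X"
| "tcod S (TAss X Y Z) = WTen (WTen X Y) Z"
| "tcod S (TAssInv X Y Z) = WTen X (WTen Y Z)"
| "tcod S (TRun X) = X"
| "tcod S (TRunInv X) = WTen X WUnit"
| "tcod S (TLun X) = X"
| "tcod S (TLunInv X) = WTen WUnit X"
| "tcod S (TSwap X Y) = WTen Y X"

definition fwords :: "('x, 'e) fsig \<Rightarrow> 'x word set" where
  "fwords S = {X. set_word X \<subseteq> sObj S}"

primrec farrow :: "('x, 'e) fsig \<Rightarrow> ('x, 'e) fterm \<Rightarrow> bool" where
  "farrow S (TGen e) \<longleftrightarrow> e \<in> sArr S"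
| "farrow S (TId X) \<longleftrightarrow> X \<in> fwords S"
| "farrow S (TComp u t) \<longleftrightarrow> farrow S u \<and> farrow S t \<and> tdom S u = tcod S t"
| "farrow S (TLeft X t) \<longleftrightarrow> X \<in> fwords S \<and> farrow S t"
| "farrow S (TRight t X) \<longleftrightarrow> farrow S t \<and> X \<in> fwords S"
| "farrow S (TAss X Y Z) \<longleftrightarrow> X \<in> fwords S \<and> Y \<in> fwords S \<and> Z \<in> fwords S"
| "farrow S (TAssInv X Y Z) \<longleftrightarrow> X \<in> fwords S \<and> Y \<in> fwords S \<and> Z \<in> fwords S"
| "farrow S (TRun X) \<longleftrightarrow> X \<in> fwords S"
| "farrow S (TRunInv X) \<longleftrightarrow> X \<in> fwords S"
| "farrow S (TLun X) \<longleftrightarrow> X \<in> fwords S"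
| "farrow S (TLunInv X) \<longleftrightarrow> X \<in> fwords S"
| "farrow S (TSwap X Y) \<longleftrightarrow> X \<in> fwords S \<and> Y \<in> fwords S"

text \<open>
  The algebra of formal arrows (no equations imposed). The tensor of two formal arrows is expressed
  by the two one-sided operations; the other order gives a congruent formal arrow.
\<close>

definition term_alg :: "('x, 'e) fsig \<Rightarrow> ('x word, ('x, 'e) fterm) smcat" where
  "term_alg S =
     \<lparr> Obj = fwords S,
       Arr = {t. farrow S t},
       Dom = tdom S,
       Cod = tcod S,
       Ident = TId,
       Comp = TComp,
       Unit = WUnit,
       TenO = WTen,
       TenA = (\<lambda>t u. TComp (TRight t (tcod S u)) (TLeft (tdom S t) u)),
       Ass = TAss,
       AssInv = TAssInv,
       Run = TRun,
       RunInv = TRunInv,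
       Lun = TLun,
       LunInv = TLunInv,
       Swap = TSwap \<rparr>"

text \<open>
  The smallest congruence containing the relations \<open>E\<close> and making the formal arrows a symmetric
  monoidal category. The rules \<open>left\<close> and \<open>right\<close> say that the one-sided operations are
  those of the bifunctor.
\<close>

inductive fcong :: "('x, 'e) fsig \<Rightarrow> (('x, 'e) fterm \<Rightarrow> ('x, 'e) fterm \<Rightarrow> bool) \<Rightarrow>
    ('x, 'e) fterm \<Rightarrow> ('x, 'e) fterm \<Rightarrow> bool"
  for S E where
  relation: "E t u \<Longrightarrow> fcong S E t u"
| smc: "smc_eq (term_alg S) t u \<Longrightarrow> fcong S E t u"
| left: "X \<in> fwords S \<Longrightarrow> farrow S t \<Longrightarrow> fcong S E (TLeft X t) (TId X \<boxtimes>\<^bsub>term_alg S\<^esub> t)"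
| right: "X \<in> fwords S \<Longrightarrow> farrow S t \<Longrightarrow> fcong S E (TRight t X) (t \<boxtimes>\<^bsub>term_alg S\<^esub> TId X)"
| refl: "farrow S t \<Longrightarrow> fcong S E t t"
| sym: "fcong S E t u \<Longrightarrow> fcong S E u t"
| trans: "fcong S E t u \<Longrightarrow> fcong S E u v \<Longrightarrow> fcong S E t v"
| cong_comp: "fcong S E t t' \<Longrightarrow> fcong S E u u' \<Longrightarrow> tdom S u = tcod S t \<Longrightarrow>
    fcong S E (TComp u t) (TComp u' t')"
| cong_left: "X \<in> fwords S \<Longrightarrow> fcong S E t u \<Longrightarrow> fcong S E (TLeft X t) (TLeft X u)"
| cong_right: "X \<in> fwords S \<Longrightarrow> fcong S E t u \<Longrightarrow> fcong S E (TRight t X) (TRight u X)"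

definition fclass :: "('x, 'e) fsig \<Rightarrow> (('x, 'e) fterm \<Rightarrow> ('x, 'e) fterm \<Rightarrow> bool) \<Rightarrow>
    ('x, 'e) fterm \<Rightarrow> ('x, 'e) fterm set" where
  "fclass S E t = {u. fcong S E t u}"

definition rep :: "('x, 'e) fterm set \<Rightarrow> ('x, 'e) fterm" where
  "rep p = (SOME t. t \<in> p)"

definition presented :: "('x, 'e) fsig \<Rightarrow> (('x, 'e) fterm \<Rightarrow> ('x, 'e) fterm \<Rightarrow> bool) \<Rightarrow>
    ('x word, ('x, 'e) fterm set) smcat" where
  "presented S E = (let T = term_alg S; cl = fclass S E in
     \<lparr> Obj = Obj T,
       Arr = cl ` Arr T,
       Dom = (\<lambda>p. Dom T (rep p)),
       Cod = (\<lambda>p. Cod T (rep p)),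
       Ident = (\<lambda>X. cl (\<one>\<^bsub>T\<^esub> X)),
       Comp = (\<lambda>q p. cl (rep q \<cdot>\<^bsub>T\<^esub> rep p)),
       Unit = Unit T,
       TenO = TenO T,
       TenA = (\<lambda>p q. cl (rep p \<boxtimes>\<^bsub>T\<^esub> rep q)),
       Ass = (\<lambda>X Y Z. cl (Ass T X Y Z)),
       AssInv = (\<lambda>X Y Z. cl (AssInv T X Y Z)),
       Run = (\<lambda>X. cl (Run T X)),
       RunInv = (\<lambda>X. cl (RunInv T X)),
       Lun = (\<lambda>X. cl (Lun T X)),
       LunInv = (\<lambda>X. cl (LunInv T X)),
       Swap = (\<lambda>X Y. cl (Swap T X Y)) \<rparr>)"

primrec eval_word :: "('o, 'm) smcat \<Rightarrow> ('x \<Rightarrow> 'o) \<Rightarrow> 'x word \<Rightarrow> 'o" where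
  "eval_word C go WUnit = Unit C"
| "eval_word C go (WGen x) = go x"
| "eval_word C go (WTen X Y) = eval_word C go X \<odot>\<^bsub>C\<^esub> eval_word C go Y"

primrec eval_term :: "('o, 'm) smcat \<Rightarrow> ('x \<Rightarrow> 'o) \<Rightarrow> ('e \<Rightarrow> 'm) \<Rightarrow> ('x, 'e) fterm \<Rightarrow> 'm" where
  "eval_term C go ga (TGen e) = ga e"
| "eval_term C go ga (TId X) = \<one>\<^bsub>C\<^esub> (eval_word C go X)"
| "eval_term C go ga (TComp u t) = eval_term C go ga u \<cdot>\<^bsub>C\<^esub> eval_term C go ga t"
| "eval_term C go ga (TLeft X t) = \<one>\<^bsub>C\<^esub> (eval_word C go X) \<boxtimes>\<^bsub>C\<^esub> eval_term C go ga t"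
| "eval_term C go ga (TRight t X) = eval_term C go ga t \<boxtimes>\<^bsub>C\<^esub> \<one>\<^bsub>C\<^esub> (eval_word C go X)"
| "eval_term C go ga (TAss X Y Z) = Ass C (eval_word C go X) (eval_word C go Y) (eval_word C go Z)"
| "eval_term C go ga (TAssInv X Y Z) = AssInv C (eval_word C go X) (eval_word C go Y) (eval_word C go Z)"
| "eval_term C go ga (TRun X) = Run C (eval_word C go X)"
| "eval_term C go ga (TRunInv X) = RunInv C (eval_word C go X)"
| "eval_term C go ga (TLun X) = Lun C (eval_word C go X)"
| "eval_term C go ga (TLunInv X) = LunInv C (eval_word C go X)"
| "eval_term C go ga (TSwap X Y) = Swap C (eval_word C go X) (eval_word C go Y)"


section \<open>Tensor\<close>

datatype ('oa, 'ma, 'ob, 'mb) tgen =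
    Alpha 'ob
  | Beta 'oa
  | Gamma 'oa 'oa 'ob
  | Delta 'oa 'ob 'ob
  | ObjArr 'oa 'mb  \<comment> \<open>$a \otimes g$\<close>
  | ArrObj 'ma 'ob  \<comment> \<open>$f \otimes b$\<close>

primrec tgen_dom :: "('oa, 'ma) smcat \<Rightarrow> ('ob, 'mb) smcat \<Rightarrow> ('oa, 'ma, 'ob, 'mb) tgen \<Rightarrow> ('oa \<times> 'ob) word" where
  "tgen_dom A B (Alpha b) = WUnit"
| "tgen_dom A B (Beta a) = WUnit"
| "tgen_dom A B (Gamma a a' b) = WTen (WGen (a, b)) (WGen (a', b))"
| "tgen_dom A B (Delta a b b') = WTen (WGen (a, b)) (WGen (a, b'))"
| "tgen_dom A B (ObjArr a g) = WGen (a, Dom B g)"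
| "tgen_dom A B (ArrObj f b) = WGen (Dom A f, b)"

primrec tgen_cod :: "('oa, 'ma) smcat \<Rightarrow> ('ob, 'mb) smcat \<Rightarrow> ('oa, 'ma, 'ob, 'mb) tgen \<Rightarrow> ('oa \<times> 'ob) word" where
  "tgen_cod A B (Alpha b) = WGen (Unit A, b)"
| "tgen_cod A B (Beta a) = WGen (a, Unit B)"
| "tgen_cod A B (Gamma a a' b) = WGen (a \<odot>\<^bsub>A\<^esub> a', b)"
| "tgen_cod A B (Delta a b b') = WGen (a, b \<odot>\<^bsub>B\<^esub> b')"
| "tgen_cod A B (ObjArr a g) = WGen (a, Cod B g)"
| "tgen_cod A B (ArrObj f b) = WGen (Cod A f, b)"

definition tensor_sig :: "('oa, 'ma) smcat \<Rightarrow> ('ob, 'mb) smcat \<Rightarrow> ('oa \<times> 'ob, ('oa, 'ma, 'ob, 'mb) tgen) fsig" where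
  "tensor_sig A B =
     \<lparr> sObj = Obj A \<times> Obj B,
       sArr = {Alpha b | b. b \<in> Obj B}
            \<union> {Beta a | a. a \<in> Obj A}
            \<union> {Gamma a a' b | a a' b. a \<in> Obj A \<and> a' \<in> Obj A \<and> b \<in> Obj B}
            \<union> {Delta a b b' | a b b'. a \<in> Obj A \<and> b \<in> Obj B \<and> b' \<in> Obj B}
            \<union> {ObjArr a g | a g. a \<in> Obj A \<and> g \<in> Arr B}
            \<union> {ArrObj f b | f b. f \<in> Arr A \<and> b \<in> Obj B},
       sDom = tgen_dom A B,
       sCod = tgen_cod A B \<rparr>"

text \<open>The formal functors $a \otimes -$ and $- \otimes b$, before any equation is imposed.\<close>

definition formal_left :: "'oa \<Rightarrow> ('ob, 'mb, ('oa \<times> 'ob) word, ('oa \<times> 'ob, ('oa, 'ma, 'ob, 'mb) tgen) fterm) smfun" where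
  "formal_left a =
     \<lparr> FO = (\<lambda>b. WGen (a, b)),
       FA = (\<lambda>g. TGen (ObjArr a g)),
       F0 = TGen (Beta a),
       F2 = (\<lambda>(b, b'). TGen (Delta a b b')) \<rparr>"

definition formal_right :: "'ob \<Rightarrow> ('oa, 'ma, ('oa \<times> 'ob) word, ('oa \<times> 'ob, ('oa, 'ma, 'ob, 'mb) tgen) fterm) smfun" where
  "formal_right b =
     \<lparr> FO = (\<lambda>a. WGen (a, b)),
       FA = (\<lambda>f. TGen (ArrObj f b)),
       F0 = TGen (Alpha b),
       F2 = (\<lambda>(a, a'). TGen (Gamma a a' b)) \<rparr>"

inductive tensor_eq ::
  "('oa, 'ma) smcat \<Rightarrow> ('ob, 'mb) smcat \<Rightarrow>
   ('oa \<times> 'ob, ('oa, 'ma, 'ob, 'mb) tgen) fterm \<Rightarrow> ('oa \<times> 'ob, ('oa, 'ma, 'ob, 'mb) tgen) fterm \<Rightarrow> bool"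
  for A B where
  left_functor: "a \<in> Obj A \<Longrightarrow> functor_eq B (term_alg (tensor_sig A B)) (formal_left a) p q \<Longrightarrow>
    tensor_eq A B p q"
| right_functor: "b \<in> Obj B \<Longrightarrow> functor_eq A (term_alg (tensor_sig A B)) (formal_right b) p q \<Longrightarrow>
    tensor_eq A B p q"
| left_mnat: "f \<in> Hom A a a' \<Longrightarrow>
    mnat_eq B (term_alg (tensor_sig A B)) (formal_left a) (formal_left a') (\<lambda>b. TGen (ArrObj f b)) p q \<Longrightarrow>
    tensor_eq A B p q"
| right_mnat: "g \<in> Hom B b b' \<Longrightarrow>
    mnat_eq A (term_alg (tensor_sig A B)) (formal_right b) (formal_right b') (\<lambda>a. TGen (ObjArr a g)) p q \<Longrightarrow>
    tensor_eq A B p q"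
| alpha_delta: "b \<in> Obj B \<Longrightarrow> b' \<in> Obj B \<Longrightarrow>
    tensor_eq A B
      (TComp (TGen (Alpha (b \<odot>\<^bsub>B\<^esub> b'))) (TRun WUnit))
      (TComp (TGen (Delta (Unit A) b b')) (TGen (Alpha b) \<boxtimes>\<^bsub>term_alg (tensor_sig A B)\<^esub> TGen (Alpha b')))"
| beta_gamma: "a \<in> Obj A \<Longrightarrow> a' \<in> Obj A \<Longrightarrow>
    tensor_eq A B
      (TComp (TGen (Beta (a \<odot>\<^bsub>A\<^esub> a'))) (TRun WUnit))
      (TComp (TGen (Gamma a a' (Unit B))) (TGen (Beta a) \<boxtimes>\<^bsub>term_alg (tensor_sig A B)\<^esub> TGen (Beta a')))"
| beta_alpha: "tensor_eq A B (TGen (Beta (Unit A))) (TGen (Alpha (Unit B)))"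
| gamma_delta: "a \<in> Obj A \<Longrightarrow> a' \<in> Obj A \<Longrightarrow> b \<in> Obj B \<Longrightarrow> b' \<in> Obj B \<Longrightarrow>
    tensor_eq A B
      (TComp (TGen (Gamma a a' (b \<odot>\<^bsub>B\<^esub> b')))
        (TGen (Delta a b b') \<boxtimes>\<^bsub>term_alg (tensor_sig A B)\<^esub> TGen (Delta a' b b')))
      (TComp (TGen (Delta (a \<odot>\<^bsub>A\<^esub> a') b b'))
        (TComp (TGen (Gamma a a' b) \<boxtimes>\<^bsub>term_alg (tensor_sig A B)\<^esub> TGen (Gamma a a' b'))
          (interchange (term_alg (tensor_sig A B))
            (WGen (a, b)) (WGen (a, b')) (WGen (a', b)) (WGen (a', b')))))"

definition tensor :: "('oa, 'ma) smcat \<Rightarrow> ('ob, 'mb) smcat \<Rightarrow>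
    (('oa \<times> 'ob) word, ('oa \<times> 'ob, ('oa, 'ma, 'ob, 'mb) tgen) fterm set) smcat"  (infixr "\<otimes>" 70) where
  "A \<otimes> B = presented (tensor_sig A B) (tensor_eq A B)"

abbreviation tgen_class :: "('oa, 'ma) smcat \<Rightarrow> ('ob, 'mb) smcat \<Rightarrow> ('oa, 'ma, 'ob, 'mb) tgen \<Rightarrow>
    ('oa \<times> 'ob, ('oa, 'ma, 'ob, 'mb) tgen) fterm set" where
  "tgen_class A B e \<equiv> fclass (tensor_sig A B) (tensor_eq A B) (TGen e)"

definition eta_obj :: "('oa, 'ma) smcat \<Rightarrow> ('ob, 'mb) smcat \<Rightarrow> 'oa \<Rightarrow>
    ('ob, 'mb, ('oa \<times> 'ob) word, ('oa \<times> 'ob, ('oa, 'ma, 'ob, 'mb) tgen) fterm set) smfun" where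
  "eta_obj A B a =
     \<lparr> FO = (\<lambda>b\<in>Obj B. WGen (a, b)),
       FA = (\<lambda>g\<in>Arr B. tgen_class A B (ObjArr a g)),
       F0 = tgen_class A B (Beta a),
       F2 = (\<lambda>(b, b')\<in>Obj B \<times> Obj B. tgen_class A B (Delta a b b')) \<rparr>"

definition eta :: "('oa, 'ma) smcat \<Rightarrow> ('ob, 'mb) smcat \<Rightarrow>
    ('oa, 'ma,
     ('ob, 'mb, ('oa \<times> 'ob) word, ('oa \<times> 'ob, ('oa, 'ma, 'ob, 'mb) tgen) fterm set) smfun,
     ('ob, 'mb, ('oa \<times> 'ob) word, ('oa \<times> 'ob, ('oa, 'ma, 'ob, 'mb) tgen) fterm set) mnt) smfun" where
  "eta A B =
     \<lparr> FO = (\<lambda>a\<in>Obj A. eta_obj A B a),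
       FA = (\<lambda>f\<in>Arr A. \<lparr> ntDom = eta_obj A B (Dom A f), ntCod = eta_obj A B (Cod A f),
                         ntMap = (\<lambda>b\<in>Obj B. tgen_class A B (ArrObj f b)) \<rparr>),
       F0 = \<lparr> ntDom = Unit (hom B (A \<otimes> B)), ntCod = eta_obj A B (Unit A),
              ntMap = (\<lambda>b\<in>Obj B. tgen_class A B (Alpha b)) \<rparr>,
       F2 = (\<lambda>(a, a')\<in>Obj A \<times> Obj A.
              \<lparr> ntDom = eta_obj A B a \<odot>\<^bsub>hom B (A \<otimes> B)\<^esub> eta_obj A B a', ntCod = eta_obj A B (a \<odot>\<^bsub>A\<^esub> a'),
                ntMap = (\<lambda>b\<in>Obj B. tgen_class A B (Gamma a a' b)) \<rparr>) \<rparr>"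

primrec En_gen :: "('oa, 'ma, ('ob, 'mb, 'oc, 'mc) smfun, ('ob, 'mb, 'oc, 'mc) mnt) smfun \<Rightarrow>
    ('oa, 'ma, 'ob, 'mb) tgen \<Rightarrow> 'mc" where
  "En_gen F (Alpha b) = ntMap (F0 F) b"
| "En_gen F (Beta a) = F0 (FO F a)"
| "En_gen F (Gamma a a' b) = ntMap (F2 F (a, a')) b"
| "En_gen F (Delta a b b') = F2 (FO F a) (b, b')"
| "En_gen F (ObjArr a g) = FA (FO F a) g"
| "En_gen F (ArrObj f b) = ntMap (FA F f) b"

text \<open>
  An arrow of \<open>A \<otimes> B\<close> is a congruence class; when \<open>F\<close> is a symmetric monoidal functor into \<open>hom B C\<close>
  the value below does not depend on the representative.
\<close>

definition En :: "('oa, 'ma) smcat \<Rightarrow> ('ob, 'mb) smcat \<Rightarrow> ('oc, 'mc) smcat \<Rightarrow>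
    ('oa, 'ma, ('ob, 'mb, 'oc, 'mc) smfun, ('ob, 'mb, 'oc, 'mc) mnt) smfun \<Rightarrow>
    (('oa \<times> 'ob) word, ('oa \<times> 'ob, ('oa, 'ma, 'ob, 'mb) tgen) fterm set, 'oc, 'mc) smfun" where
  "En A B C F =
     strict_fun (A \<otimes> B) C
       (eval_word C (\<lambda>(a, b). FO (FO F a) b))
       (\<lambda>p. eval_term C (\<lambda>(a, b). FO (FO F a) b) (En_gen F) (rep p))"

definition Rn :: "('oa, 'ma) smcat \<Rightarrow> ('ob, 'mb) smcat \<Rightarrow> ('oc, 'mc) smcat \<Rightarrow>
    ((('oa \<times> 'ob) word, ('oa \<times> 'ob, ('oa, 'ma, 'ob, 'mb) tgen) fterm set, 'oc, 'mc) smfun,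
     (('oa \<times> 'ob) word, ('oa \<times> 'ob, ('oa, 'ma, 'ob, 'mb) tgen) fterm set, 'oc, 'mc) mnt,
     ('oa, 'ma, ('ob, 'mb, 'oc, 'mc) smfun, ('ob, 'mb, 'oc, 'mc) mnt) smfun,
     ('oa, 'ma, ('ob, 'mb, 'oc, 'mc) smfun, ('ob, 'mb, 'oc, 'mc) mnt) mnt) smfun" where
  "Rn A B C =
     strict_fun (hom (A \<otimes> B) C) (hom A (hom B C))
       (\<lambda>F. comp_fun A (hom B C) (postcomp B (A \<otimes> B) C F) (eta A B))
       (\<lambda>\<sigma>. whisker_right A (hom B C) (postcomp_nt B (A \<otimes> B) C \<sigma>) (eta A B))"

text \<open>\<open>tensor_left A C B F\<close> is $F \otimes 1_B$ for $F : A \to C$, and \<open>tensor_right A B D G\<close> is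
  $1_A \otimes G$ for $G : B \to D$.\<close>

definition tensor_left where
  "tensor_left A C B F = En A B (C \<otimes> B) (comp_fun A (hom B (C \<otimes> B)) (eta C B) F)"

definition tensor_right where
  "tensor_right A B D G =
     En A B (A \<otimes> D) (comp_fun A (hom B (A \<otimes> D)) (precomp B D (A \<otimes> D) G) (eta A D))"


section \<open>The canonical arrows\<close>

text \<open>The free symmetric monoidal category on one object: one object generator, no arrow generators
  and no relations beyond the symmetric monoidal axioms.\<close>

definition free_smc :: "(unit word, (unit, unit) fterm set) smcat"  ("\<I>") where
  "\<I> = presented \<lparr> sObj = {()}, sArr = {}, sDom = (\<lambda>_. WUnit), sCod = (\<lambda>_. WUnit) \<rparr> (\<lambda>_ _. False)"

definition star :: "unit word"  ("\<star>") where
  "\<star> = WGen ()"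

definition A' where
  "A' A B C =
     (let T = A \<otimes> (B \<otimes> C);
          K = comp_fun A (hom B (hom C T)) (Rn B C T) (eta A (B \<otimes> C))
      in En (A \<otimes> B) C T (En A B (hom C T) K))"

definition R' where
  "R' A = comp_fun A (A \<otimes> \<I>) (eval_at \<I> (A \<otimes> \<I>) \<star>) (eta A \<I>)"

definition L' where
  "L' A = comp_fun A (\<I> \<otimes> A) (eval_at \<I> (\<I> \<otimes> A) \<star>) (dual \<I> A (\<I> \<otimes> A) (eta \<I> A))"

end

theory Submission
  imports Defs
begin

text \<open>
  Write \<open>T = A \<otimes> (\<I> \<otimes> C)\<close> and let \<open>K : A \<rightarrow> [\<I>, [C, T]]\<close> be the functor \<open>Rn \<circ> \<eta>\<close>, which sends \<open>a\<close>, \<open>i\<close>, \<open>c\<close> to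
  \<open>a \<otimes> (i \<otimes> c)\<close>; then \<open>A' = En (En K)\<close>. Both composites are equal to \<open>En\<close> of the functor \<open>K - \<star> : A \<rightarrow> [C, T]\<close>:

  \<^item> \<open>En\<close> is natural, \<open>En F \<circ> (R \<otimes> 1) = En (F \<circ> R)\<close> (\<open>En_tensor_left\<close>), which turns the left-hand side into
    \<open>En (En K \<circ> R')\<close>. As \<open>R'\<close> is \<open>- \<otimes> \<star>\<close>, the functor \<open>En K \<circ> R'\<close> is \<open>K - \<star>\<close> (\<open>En_after_eta\<close>).

  \<^item> \<open>L'\<close> is \<open>\<eta> \<star>\<close>, because the dual of the dual is the original functor (\<open>dual_obj_dual\<close>). Since
    precomposition with \<open>\<eta> \<star>\<close> is \<open>Rn\<close> followed by evaluation at \<open>\<star>\<close> (\<open>eval_Rn\<close>), the functor \<open>[L', 1] \<circ> \<eta>\<close> whose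
    image under \<open>En\<close> is the right-hand side is \<open>K - \<star>\<close> again.

  The bulk of the work is to show that these constructions yield symmetric monoidal functors. The value of \<open>En F\<close> on a
  congruence class does not depend on the representative because \<open>F\<close> is a functor into an internal hom, so the
  internal hom has to be a symmetric monoidal category (\<open>hom_category\<close>). Its axioms hold pointwise; but that the
  tensor of two functors is a functor, and that the structural arrows are monoidal transformations, amounts
  to equations between composites of canonical isomorphisms involving the interchange. They
  follow from a coherence theorem for symmetric monoidal categories (\<open>coherence\<close>): two parallel formal
  structural arrows between words without repeated letters have the same value.

  Equations are moved between the formal arrows, their quotient \<open>A \<otimes> B\<close> and the categories in which
  they are evaluated along strict maps (\<open>strict_hom\<close>). Lifting along the quotient map shows that
  \<open>\<eta>\<close> is a functor (\<open>eta_functor\<close>), and evaluation shows that \<open>En F\<close> is one (\<open>En_functor\<close>).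
\<close>

section \<open>Calculating in symmetric monoidal categories\<close>

lemma Hom_iff: "f \<in> Hom M x y \<longleftrightarrow> f \<in> Arr M \<and> Dom M f = x \<and> Cod M f = y"
  by (auto simp: Hom_def)

context sm_data
begin

lemma Dom_Obj [simp]: "f \<in> Arr M \<Longrightarrow> Dom M f \<in> Obj M"
  and Cod_Obj [simp]: "f \<in> Arr M \<Longrightarrow> Cod M f \<in> Obj M"
  by (simp_all add: Dom_in Cod_in)

lemma Unit_TenO_Obj [simp]:
  "Unit M \<in> Obj M"
  "x \<in> Obj M \<Longrightarrow> y \<in> Obj M \<Longrightarrow> x \<odot> y \<in> Obj M"
  by (simp_all add: Unit_in TenO_in)

lemma Ident_typing [simp]:
  assumes "x \<in> Obj M"
  shows "\<one> x \<in> Arr M" "Dom M (\<one> x) = x" "Cod M (\<one> x) = x"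
  using Ident_in[OF assms] by (auto simp: Hom_iff)

lemma Comp_typing [simp]:
  assumes "f \<in> Arr M" "g \<in> Arr M" "Dom M g = Cod M f"
  shows "g \<cdot> f \<in> Arr M" "Dom M (g \<cdot> f) = Dom M f" "Cod M (g \<cdot> f) = Cod M g"
  using Comp_in[of f "Dom M f" "Cod M f" g "Cod M g"] assms by (auto simp: Hom_iff)

lemma TenA_typing [simp]:
  assumes "f \<in> Arr M" "g \<in> Arr M"
  shows "f \<boxtimes> g \<in> Arr M" "Dom M (f \<boxtimes> g) = Dom M f \<odot> Dom M g" "Cod M (f \<boxtimes> g) = Cod M f \<odot> Cod M g"
  using TenA_in[of f "Dom M f" "Cod M f" g "Dom M g" "Cod M g"] assms by (auto simp: Hom_iff)

lemma Ass_typing [simp]: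
  assumes "x \<in> Obj M" "y \<in> Obj M" "z \<in> Obj M"
  shows "Ass M x y z \<in> Arr M" "Dom M (Ass M x y z) = x \<odot> (y \<odot> z)" "Cod M (Ass M x y z) = (x \<odot> y) \<odot> z"
    "AssInv M x y z \<in> Arr M" "Dom M (AssInv M x y z) = (x \<odot> y) \<odot> z" "Cod M (AssInv M x y z) = x \<odot> (y \<odot> z)"
  using Ass_in[OF assms] AssInv_in[OF assms] by (auto simp: Hom_iff)

lemma Run_typing [simp]:
  assumes "x \<in> Obj M"
  shows "Run M x \<in> Arr M" "Dom M (Run M x) = x \<odot> Unit M" "Cod M (Run M x) = x"
    "RunInv M x \<in> Arr M" "Dom M (RunInv M x) = x" "Cod M (RunInv M x) = x \<odot> Unit M"
    "Lun M x \<in> Arr M" "Dom M (Lun M x) = Unit M \<odot> x" "Cod M (Lun M x) = x"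
    "LunInv M x \<in> Arr M" "Dom M (LunInv M x) = x" "Cod M (LunInv M x) = Unit M \<odot> x"
  using Run_in[OF assms] RunInv_in[OF assms] Lun_in[OF assms] LunInv_in[OF assms] by (auto simp: Hom_iff)

lemma Swap_typing [simp]:
  assumes "x \<in> Obj M" "y \<in> Obj M"
  shows "Swap M x y \<in> Arr M" "Dom M (Swap M x y) = x \<odot> y" "Cod M (Swap M x y) = y \<odot> x"
  using Swap_in[OF assms] by (auto simp: Hom_iff)

lemma Hom_Obj:
  assumes "f \<in> Hom M x y" shows "x \<in> Obj M" "y \<in> Obj M"
  using assms by (auto simp: Hom_iff)

lemma interchange_typing [simp]:
  assumes "x \<in> Obj M" "y \<in> Obj M" "z \<in> Obj M" "w \<in> Obj M"
  shows "interchange M x y z w \<in> Arr M"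
    "Dom M (interchange M x y z w) = (x \<odot> y) \<odot> (z \<odot> w)"
    "Cod M (interchange M x y z w) = (x \<odot> z) \<odot> (y \<odot> w)"
  using assms by (simp_all add: interchange_def)

end

context sm_category
begin

text \<open>
  The axioms are given by \<open>smc_eq\<close> for arrows with named source and target. As rewrite rules they are
  conditional on \<open>Dom\<close> and \<open>Cod\<close>, which simplification computes. The simplifier brackets composites to
  the right and merges adjacent tensors of arrows.
\<close>

lemma comp_id' [simp]: "f \<in> Arr M \<Longrightarrow> x = Dom M f \<Longrightarrow> f \<cdot> \<one> x = f"
  by (rule axioms_hold, rule comp_id[of _ _ _ "Cod M f"]) (simp add: Hom_iff)

lemma id_comp' [simp]: "f \<in> Arr M \<Longrightarrow> y = Cod M f \<Longrightarrow> \<one> y \<cdot> f = f"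
  by (rule axioms_hold, rule id_comp[of _ _ "Dom M f"]) (simp add: Hom_iff)

lemma comp_assoc' [simp]:
  assumes "f \<in> Arr M" "g \<in> Arr M" "h \<in> Arr M" "Dom M g = Cod M f" "Dom M h = Cod M g"
  shows "(h \<cdot> g) \<cdot> f = h \<cdot> (g \<cdot> f)"
  by (rule axioms_hold, rule comp_assoc) (use assms in \<open>auto simp: Hom_iff\<close>)

text \<open>
  As composites are bracketed to the right, an equation between composites of two arrows must also be
  available with a further arrow \<open>k\<close> behind them.
\<close>

lemma comp_ext:
  assumes "g \<cdot> f = g' \<cdot> f'" "k \<in> Arr M" "f \<in> Arr M" "g \<in> Arr M" "f' \<in> Arr M" "g' \<in> Arr M"
    "Dom M f = Cod M k" "Dom M g = Cod M f" "Dom M f' = Cod M k" "Dom M g' = Cod M f'"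
  shows "g \<cdot> f \<cdot> k = g' \<cdot> f' \<cdot> k"
  using assms by (metis comp_assoc')

lemma comp_ext1:
  assumes "g \<cdot> f = h" "k \<in> Arr M" "f \<in> Arr M" "g \<in> Arr M"
    "Dom M f = Cod M k" "Dom M g = Cod M f"
  shows "g \<cdot> f \<cdot> k = h \<cdot> k"
  using assms by (metis comp_assoc')

lemma comp_ext_id:
  assumes "g \<cdot> f = \<one> x" "k \<in> Arr M" "f \<in> Arr M" "g \<in> Arr M"
    "Dom M f = Cod M k" "Dom M g = Cod M f" "x = Cod M k"
  shows "g \<cdot> f \<cdot> k = k"
  using assms by (metis comp_assoc' id_comp')

lemma ten_id' [simp]: "x \<in> Obj M \<Longrightarrow> y \<in> Obj M \<Longrightarrow> \<one> x \<boxtimes> \<one> y = \<one> (x \<odot> y)"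
  by (rule axioms_hold, rule ten_id)

lemma ten_comp' [simp]:
  assumes "f \<in> Arr M" "f' \<in> Arr M" "Dom M f' = Cod M f" "g \<in> Arr M" "g' \<in> Arr M" "Dom M g' = Cod M g"
  shows "(f' \<boxtimes> g') \<cdot> (f \<boxtimes> g) = (f' \<cdot> f) \<boxtimes> (g' \<cdot> g)"
  by (rule axioms_hold[symmetric], rule ten_comp) (use assms in \<open>auto simp: Hom_iff\<close>)

lemma ten_comp_ext [simp]:
  assumes "f \<in> Arr M" "f' \<in> Arr M" "Dom M f' = Cod M f" "g \<in> Arr M" "g' \<in> Arr M" "Dom M g' = Cod M g"
    "k \<in> Arr M" "Cod M k = Dom M f \<odot> Dom M g"
  shows "(f' \<boxtimes> g') \<cdot> (f \<boxtimes> g) \<cdot> k = ((f' \<cdot> f) \<boxtimes> (g' \<cdot> g)) \<cdot> k"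
  by (rule comp_ext1[OF ten_comp']) (use assms in auto)

lemma isos [simp]:
  "x \<in> Obj M \<Longrightarrow> y \<in> Obj M \<Longrightarrow> z \<in> Obj M \<Longrightarrow> AssInv M x y z \<cdot> Ass M x y z = \<one> (x \<odot> (y \<odot> z))"
  "x \<in> Obj M \<Longrightarrow> y \<in> Obj M \<Longrightarrow> z \<in> Obj M \<Longrightarrow> Ass M x y z \<cdot> AssInv M x y z = \<one> ((x \<odot> y) \<odot> z)"
  "x \<in> Obj M \<Longrightarrow> RunInv M x \<cdot> Run M x = \<one> (x \<odot> Unit M)"
  "x \<in> Obj M \<Longrightarrow> Run M x \<cdot> RunInv M x = \<one> x"
  "x \<in> Obj M \<Longrightarrow> LunInv M x \<cdot> Lun M x = \<one> (Unit M \<odot> x)"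
  "x \<in> Obj M \<Longrightarrow> Lun M x \<cdot> LunInv M x = \<one> x"
  "x \<in> Obj M \<Longrightarrow> y \<in> Obj M \<Longrightarrow> Swap M y x \<cdot> Swap M x y = \<one> (x \<odot> y)"
  by (rule axioms_hold, rule smc_eq.intros, assumption+)+

lemma isos_ext [simp]:
  "k \<in> Arr M \<Longrightarrow> x \<in> Obj M \<Longrightarrow> y \<in> Obj M \<Longrightarrow> z \<in> Obj M \<Longrightarrow> Cod M k = x \<odot> (y \<odot> z) \<Longrightarrow>
     AssInv M x y z \<cdot> Ass M x y z \<cdot> k = k"
  "k \<in> Arr M \<Longrightarrow> x \<in> Obj M \<Longrightarrow> y \<in> Obj M \<Longrightarrow> z \<in> Obj M \<Longrightarrow> Cod M k = (x \<odot> y) \<odot> z \<Longrightarrow>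
     Ass M x y z \<cdot> AssInv M x y z \<cdot> k = k"
  "k \<in> Arr M \<Longrightarrow> x \<in> Obj M \<Longrightarrow> Cod M k = x \<odot> Unit M \<Longrightarrow> RunInv M x \<cdot> Run M x \<cdot> k = k"
  "k \<in> Arr M \<Longrightarrow> x \<in> Obj M \<Longrightarrow> Cod M k = x \<Longrightarrow> Run M x \<cdot> RunInv M x \<cdot> k = k"
  "k \<in> Arr M \<Longrightarrow> x \<in> Obj M \<Longrightarrow> Cod M k = Unit M \<odot> x \<Longrightarrow> LunInv M x \<cdot> Lun M x \<cdot> k = k"
  "k \<in> Arr M \<Longrightarrow> x \<in> Obj M \<Longrightarrow> Cod M k = x \<Longrightarrow> Lun M x \<cdot> LunInv M x \<cdot> k = k"
  "k \<in> Arr M \<Longrightarrow> x \<in> Obj M \<Longrightarrow> y \<in> Obj M \<Longrightarrow> Cod M k = x \<odot> y \<Longrightarrow> Swap M y x \<cdot> Swap M x y \<cdot> k = k"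
  by (rule comp_ext_id, (simp; fail)+)+

lemma ass_nat':
  assumes "f \<in> Arr M" "g \<in> Arr M" "h \<in> Arr M" "x = Dom M f" "y = Dom M g" "z = Dom M h"
  shows "((f \<boxtimes> g) \<boxtimes> h) \<cdot> Ass M x y z = Ass M (Cod M f) (Cod M g) (Cod M h) \<cdot> (f \<boxtimes> (g \<boxtimes> h))"
  by (rule axioms_hold, rule ass_nat) (use assms in \<open>auto simp: Hom_iff\<close>)

lemma run_nat':
  assumes "f \<in> Arr M" "x = Dom M f"
  shows "f \<cdot> Run M x = Run M (Cod M f) \<cdot> (f \<boxtimes> \<one> (Unit M))"
  by (rule axioms_hold, rule run_nat) (use assms in \<open>auto simp: Hom_iff\<close>)

lemma lun_nat':
  assumes "f \<in> Arr M" "x = Dom M f"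
  shows "f \<cdot> Lun M x = Lun M (Cod M f) \<cdot> (\<one> (Unit M) \<boxtimes> f)"
  by (rule axioms_hold, rule lun_nat) (use assms in \<open>auto simp: Hom_iff\<close>)

lemma swap_nat':
  assumes "f \<in> Arr M" "g \<in> Arr M" "x = Dom M f" "y = Dom M g"
  shows "(g \<boxtimes> f) \<cdot> Swap M x y = Swap M (Cod M f) (Cod M g) \<cdot> (f \<boxtimes> g)"
  by (rule axioms_hold, rule swap_nat) (use assms in \<open>auto simp: Hom_iff\<close>)

lemma assinv_nat':
  assumes [simp]: "f \<in> Arr M" "g \<in> Arr M" "h \<in> Arr M" "x = Dom M f" "y = Dom M g" "z = Dom M h"
  shows "(f \<boxtimes> (g \<boxtimes> h)) \<cdot> AssInv M x y z = AssInv M (Cod M f) (Cod M g) (Cod M h) \<cdot> ((f \<boxtimes> g) \<boxtimes> h)"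
proof -
  let ?A = "Ass M (Cod M f) (Cod M g) (Cod M h)" and ?A' = "AssInv M (Cod M f) (Cod M g) (Cod M h)"
  have "?A' \<cdot> (((f \<boxtimes> g) \<boxtimes> h) \<cdot> Ass M x y z) \<cdot> AssInv M x y z
      = ?A' \<cdot> (?A \<cdot> (f \<boxtimes> (g \<boxtimes> h))) \<cdot> AssInv M x y z"
    by (simp only: ass_nat'[OF assms])
  then show ?thesis by simp
qed

lemma assinv_nat_rev:
  assumes "f \<in> Arr M" "g \<in> Arr M" "h \<in> Arr M" "x = Cod M f" "y = Cod M g" "z = Cod M h"
  shows "AssInv M x y z \<cdot> ((f \<boxtimes> g) \<boxtimes> h) = (f \<boxtimes> (g \<boxtimes> h)) \<cdot> AssInv M (Dom M f) (Dom M g) (Dom M h)"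
  using assms by (simp add: assinv_nat')

lemmas nat_exts = ass_nat'[THEN comp_ext] run_nat'[THEN comp_ext] lun_nat'[THEN comp_ext]
  swap_nat'[THEN comp_ext] assinv_nat'[THEN comp_ext]

lemma pentagon':
  assumes "x \<in> Obj M" "y \<in> Obj M" "z \<in> Obj M" "w \<in> Obj M"
  shows "Ass M (x \<odot> y) z w \<cdot> Ass M x y (z \<odot> w) =
    (Ass M x y z \<boxtimes> \<one> w) \<cdot> Ass M x (y \<odot> z) w \<cdot> (\<one> x \<boxtimes> Ass M y z w)"
  by (rule axioms_hold, rule pentagon) (use assms in auto)

lemma triangle': "x \<in> Obj M \<Longrightarrow> y \<in> Obj M \<Longrightarrow> (Run M x \<boxtimes> \<one> y) \<cdot> Ass M x (Unit M) y = \<one> x \<boxtimes> Lun M y"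
  by (rule axioms_hold, rule triangle)

lemma swap_unit': "x \<in> Obj M \<Longrightarrow> Lun M x \<cdot> Swap M x (Unit M) = Run M x"
  by (rule axioms_hold, rule swap_unit)

lemma hexagon':
  assumes "x \<in> Obj M" "y \<in> Obj M" "z \<in> Obj M"
  shows "Ass M z x y \<cdot> Swap M (x \<odot> y) z \<cdot> Ass M x y z =
     (Swap M x z \<boxtimes> \<one> y) \<cdot> Ass M x z y \<cdot> (\<one> x \<boxtimes> Swap M y z)"
  by (rule axioms_hold, rule hexagon) (use assms in auto)

text \<open>
  An arrow with a retraction can be cancelled on the left, one with a section on the right.
\<close>

lemma cancel_left:
  assumes "s \<cdot> m = \<one> (Cod M f)" "m \<cdot> f = m \<cdot> g" "f \<in> Arr M" "g \<in> Arr M" "m \<in> Arr M" "s \<in> Arr M"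
    "Dom M m = Cod M f" "Dom M m = Cod M g" "Dom M s = Cod M m"
  shows "f = g"
  using assms by (metis comp_ext_id)

lemma cancel_right:
  assumes "f \<cdot> m = g \<cdot> m" "m \<cdot> s = \<one> (Dom M f)" "f \<in> Arr M" "g \<in> Arr M" "m \<in> Arr M" "s \<in> Arr M"
    "Dom M f = Cod M m" "Dom M g = Cod M m" "Dom M m = Cod M s"
  shows "f = g"
proof -
  have "(f \<cdot> m) \<cdot> s = (g \<cdot> m) \<cdot> s" by (simp add: assms(1))
  then show ?thesis using assms(2-) by simp
qed

text \<open>
  Tensoring with the unit is naturally isomorphic to the identity, hence faithful.
\<close>

lemma unit_ten_cancel:
  assumes "\<one> (Unit M) \<boxtimes> f = \<one> (Unit M) \<boxtimes> g" "f \<in> Arr M" "g \<in> Arr M"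
    "Dom M f = Dom M g" "Cod M f = Cod M g"
  shows "f = g"
  by (rule cancel_right[of _ "Lun M (Dom M f)" _ "LunInv M (Dom M f)"])
    (use assms lun_nat'[of f] lun_nat'[of g] in auto)

lemma ten_unit_cancel:
  assumes "f \<boxtimes> \<one> (Unit M) = g \<boxtimes> \<one> (Unit M)" "f \<in> Arr M" "g \<in> Arr M"
    "Dom M f = Dom M g" "Cod M f = Cod M g"
  shows "f = g"
  by (rule cancel_right[of _ "Run M (Dom M f)" _ "RunInv M (Dom M f)"])
    (use assms run_nat'[of f] run_nat'[of g] in auto)

text \<open>
  Kelly's observation that this unit law follows from the pentagon and the triangle: after tensoring with the
  unit on the left, both sides are composites around the pentagon for \<open>I, I, x, y\<close>.
\<close>

lemma lun_ten:
  assumes [simp]: "x \<in> Obj M" "y \<in> Obj M"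
  shows "(Lun M x \<boxtimes> \<one> y) \<cdot> Ass M (Unit M) x y = Lun M (x \<odot> y)"
proof -
  let ?I = "Unit M"
  have "Ass M ?I x y \<cdot> (\<one> ?I \<boxtimes> ((Lun M x \<boxtimes> \<one> y) \<cdot> Ass M ?I x y))
      = Ass M ?I x y \<cdot> (\<one> ?I \<boxtimes> (Lun M x \<boxtimes> \<one> y)) \<cdot> (\<one> ?I \<boxtimes> Ass M ?I x y)"
    by simp
  also have "\<dots> = ((\<one> ?I \<boxtimes> Lun M x) \<boxtimes> \<one> y) \<cdot> Ass M ?I (?I \<odot> x) y \<cdot> (\<one> ?I \<boxtimes> Ass M ?I x y)"
    by (simp add: nat_exts)
  also have "\<dots> = ((Run M ?I \<boxtimes> \<one> x) \<boxtimes> \<one> y) \<cdot> (Ass M ?I ?I x \<boxtimes> \<one> y) \<cdot> Ass M ?I (?I \<odot> x) y \<cdot> (\<one> ?I \<boxtimes> Ass M ?I x y)"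
    by (simp add: triangle')
  also have "\<dots> = ((Run M ?I \<boxtimes> \<one> x) \<boxtimes> \<one> y) \<cdot> Ass M (?I \<odot> ?I) x y \<cdot> Ass M ?I ?I (x \<odot> y)"
    by (simp add: pentagon')
  also have "\<dots> = Ass M ?I x y \<cdot> (Run M ?I \<boxtimes> \<one> (x \<odot> y)) \<cdot> Ass M ?I ?I (x \<odot> y)"
    by (simp add: nat_exts)
  also have "\<dots> = Ass M ?I x y \<cdot> (\<one> ?I \<boxtimes> Lun M (x \<odot> y))"
    by (simp add: triangle')
  finally have "\<one> ?I \<boxtimes> ((Lun M x \<boxtimes> \<one> y) \<cdot> Ass M ?I x y) = \<one> ?I \<boxtimes> Lun M (x \<odot> y)"
    by (rule cancel_left[of "AssInv M ?I x y", rotated]) simp_all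
  then show ?thesis by (rule unit_ten_cancel) simp_all
qed

lemma pentagon_inv1:
  assumes [simp]: "x \<in> Obj M" "y \<in> Obj M" "z \<in> Obj M" "w \<in> Obj M"
  shows "(Ass M x y z \<boxtimes> \<one> w) \<cdot> Ass M x (y \<odot> z) w =
    Ass M (x \<odot> y) z w \<cdot> Ass M x y (z \<odot> w) \<cdot> (\<one> x \<boxtimes> AssInv M y z w)"
proof -
  have "(Ass M (x \<odot> y) z w \<cdot> Ass M x y (z \<odot> w)) \<cdot> (\<one> x \<boxtimes> AssInv M y z w)
     = ((Ass M x y z \<boxtimes> \<one> w) \<cdot> Ass M x (y \<odot> z) w \<cdot> (\<one> x \<boxtimes> Ass M y z w)) \<cdot> (\<one> x \<boxtimes> AssInv M y z w)"
    by (simp only: pentagon' assms)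
  then show ?thesis by simp
qed

lemma pentagon_inv2:
  assumes [simp]: "x \<in> Obj M" "y \<in> Obj M" "z \<in> Obj M" "w \<in> Obj M"
  shows "AssInv M x (y \<odot> z) w \<cdot> (AssInv M x y z \<boxtimes> \<one> w) \<cdot> Ass M (x \<odot> y) z w =
    (\<one> x \<boxtimes> Ass M y z w) \<cdot> AssInv M x y (z \<odot> w)"
proof -
  have "AssInv M x (y \<odot> z) w \<cdot> (AssInv M x y z \<boxtimes> \<one> w) \<cdot>
      (Ass M (x \<odot> y) z w \<cdot> Ass M x y (z \<odot> w)) \<cdot> AssInv M x y (z \<odot> w)
     = AssInv M x (y \<odot> z) w \<cdot> (AssInv M x y z \<boxtimes> \<one> w) \<cdot>
      ((Ass M x y z \<boxtimes> \<one> w) \<cdot> Ass M x (y \<odot> z) w \<cdot> (\<one> x \<boxtimes> Ass M y z w)) \<cdot> AssInv M x y (z \<odot> w)"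
    by (simp only: pentagon' assms)
  then show ?thesis by simp
qed

section \<open>Exchanging the first two factors\<close>

text \<open>
  Exchanging the first two of three factors, \<open>x \<otimes> (y \<otimes> z) \<rightarrow> y \<otimes> (x \<otimes> z)\<close>. On right-nested tensors these
  arrows play the part of adjacent transpositions: they are natural and involutive, and satisfy the braid
  relation.
\<close>

definition exch :: "'a \<Rightarrow> 'a \<Rightarrow> 'a \<Rightarrow> 'b" where
  "exch x y z = AssInv M y x z \<cdot> (Swap M x y \<boxtimes> \<one> z) \<cdot> Ass M x y z"

lemma exch_typing [simp]:
  assumes "x \<in> Obj M" "y \<in> Obj M" "z \<in> Obj M"
  shows "exch x y z \<in> Arr M" "Dom M (exch x y z) = x \<odot> (y \<odot> z)" "Cod M (exch x y z) = y \<odot> (x \<odot> z)"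
  using assms by (simp_all add: exch_def)

lemma exch_nat:
  assumes [simp]: "f \<in> Arr M" "g \<in> Arr M" "h \<in> Arr M" "x = Dom M f" "y = Dom M g" "z = Dom M h"
  shows "(g \<boxtimes> (f \<boxtimes> h)) \<cdot> exch x y z = exch (Cod M f) (Cod M g) (Cod M h) \<cdot> (f \<boxtimes> (g \<boxtimes> h))"
proof -
  have "(g \<boxtimes> (f \<boxtimes> h)) \<cdot> exch x y z
    = AssInv M (Cod M g) (Cod M f) (Cod M h) \<cdot> (((g \<boxtimes> f) \<cdot> Swap M x y) \<boxtimes> h) \<cdot> Ass M x y z"
    by (simp add: exch_def nat_exts)
  also have "\<dots> = AssInv M (Cod M g) (Cod M f) (Cod M h) \<cdot>
      (Swap M (Cod M f) (Cod M g) \<boxtimes> \<one> (Cod M h)) \<cdot> ((f \<boxtimes> g) \<boxtimes> h) \<cdot> Ass M x y z"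
    by (simp add: swap_nat')
  also have "\<dots> = exch (Cod M f) (Cod M g) (Cod M h) \<cdot> (f \<boxtimes> (g \<boxtimes> h))"
    by (simp add: exch_def ass_nat' del: ten_comp_ext)
  finally show ?thesis .
qed

lemma exch_exch [simp]:
  assumes [simp]: "x \<in> Obj M" "y \<in> Obj M" "z \<in> Obj M"
  shows "exch y x z \<cdot> exch x y z = \<one> (x \<odot> (y \<odot> z))"
  by (simp add: exch_def)

lemma exch_unit_right:
  assumes [simp]: "x \<in> Obj M" "z \<in> Obj M"
  shows "Lun M (x \<odot> z) \<cdot> exch x (Unit M) z = \<one> x \<boxtimes> Lun M z"
proof -
  have "Lun M (x \<odot> z) \<cdot> exch x (Unit M) z = (Lun M x \<boxtimes> \<one> z) \<cdot> (Swap M x (Unit M) \<boxtimes> \<one> z) \<cdot> Ass M x (Unit M) z"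
    unfolding exch_def by (simp add: lun_ten[symmetric] del: ten_comp_ext)
  also have "\<dots> = \<one> x \<boxtimes> Lun M z"
    by (simp add: swap_unit' triangle')
  finally show ?thesis .
qed

lemma exch_unit_left:
  assumes [simp]: "x \<in> Obj M" "z \<in> Obj M"
  shows "(\<one> x \<boxtimes> Lun M z) \<cdot> exch (Unit M) x z = Lun M (x \<odot> z)"
  by (simp add: exch_unit_right[symmetric])

text \<open>
  Exchanging a tensor \<open>x \<otimes> y\<close> with \<open>z\<close> is exchanging \<open>y\<close> and then \<open>x\<close> with \<open>z\<close>: this is the hexagon, framed by
  three pentagons that move the bracket around the remaining factor \<open>w\<close>.
\<close>

lemma exch_ten:
  assumes [simp]: "x \<in> Obj M" "y \<in> Obj M" "z \<in> Obj M" "w \<in> Obj M"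
  shows "exch (x \<odot> y) z w \<cdot> Ass M x y (z \<odot> w) =
    (\<one> z \<boxtimes> Ass M x y w) \<cdot> exch x z (y \<odot> w) \<cdot> (\<one> x \<boxtimes> exch y z w)"
proof -
  have hex: "Swap M (x \<odot> y) z \<cdot> Ass M x y z =
     AssInv M z x y \<cdot> (Swap M x z \<boxtimes> \<one> y) \<cdot> Ass M x z y \<cdot> (\<one> x \<boxtimes> Swap M y z)"
    by (simp add: hexagon'[symmetric])
  have "exch (x \<odot> y) z w \<cdot> Ass M x y (z \<odot> w) =
      AssInv M z (x \<odot> y) w \<cdot> (Swap M (x \<odot> y) z \<boxtimes> \<one> w) \<cdot> (Ass M x y z \<boxtimes> \<one> w) \<cdot> Ass M x (y \<odot> z) w
      \<cdot> (\<one> x \<boxtimes> Ass M y z w)"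
    by (simp add: exch_def pentagon' del: ten_comp_ext)
  also have "\<dots> = AssInv M z (x \<odot> y) w \<cdot> (AssInv M z x y \<boxtimes> \<one> w) \<cdot> ((Swap M x z \<boxtimes> \<one> y) \<boxtimes> \<one> w) \<cdot>
      (Ass M x z y \<boxtimes> \<one> w) \<cdot> ((\<one> x \<boxtimes> Swap M y z) \<boxtimes> \<one> w) \<cdot> Ass M x (y \<odot> z) w \<cdot> (\<one> x \<boxtimes> Ass M y z w)"
    by (simp add: hex)
  also have "\<dots> = AssInv M z (x \<odot> y) w \<cdot> (AssInv M z x y \<boxtimes> \<one> w) \<cdot> ((Swap M x z \<boxtimes> \<one> y) \<boxtimes> \<one> w) \<cdot>
      (Ass M x z y \<boxtimes> \<one> w) \<cdot> Ass M x (z \<odot> y) w \<cdot> (\<one> x \<boxtimes> (Swap M y z \<boxtimes> \<one> w)) \<cdot> (\<one> x \<boxtimes> Ass M y z w)"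
    by (simp add: nat_exts del: ten_comp_ext ten_comp')
  also have "\<dots> = AssInv M z (x \<odot> y) w \<cdot> (AssInv M z x y \<boxtimes> \<one> w) \<cdot> ((Swap M x z \<boxtimes> \<one> y) \<boxtimes> \<one> w) \<cdot>
      Ass M (x \<odot> z) y w \<cdot> Ass M x z (y \<odot> w) \<cdot> (\<one> x \<boxtimes> exch y z w)"
    by (simp add: comp_ext[OF pentagon_inv1] exch_def del: ten_comp_ext) 
  also have "\<dots> = AssInv M z (x \<odot> y) w \<cdot> (AssInv M z x y \<boxtimes> \<one> w) \<cdot> Ass M (z \<odot> x) y w \<cdot>
      (Swap M x z \<boxtimes> \<one> (y \<odot> w)) \<cdot> Ass M x z (y \<odot> w) \<cdot> (\<one> x \<boxtimes> exch y z w)"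
    by (simp add: nat_exts del: ten_comp_ext)
  also have "\<dots> = (AssInv M z (x \<odot> y) w \<cdot> (AssInv M z x y \<boxtimes> \<one> w) \<cdot> Ass M (z \<odot> x) y w) \<cdot>
      (Swap M x z \<boxtimes> \<one> (y \<odot> w)) \<cdot> Ass M x z (y \<odot> w) \<cdot> (\<one> x \<boxtimes> exch y z w)"
    by (simp del: ten_comp_ext)
  also have "\<dots> = (\<one> z \<boxtimes> Ass M x y w) \<cdot> exch x z (y \<odot> w) \<cdot> (\<one> x \<boxtimes> exch y z w)"
    by (simp add: pentagon_inv2 del: ten_comp_ext) (simp add: exch_def)
  finally show ?thesis .
qed

lemma exch_ten_inv:
  assumes [simp]: "x \<in> Obj M" "y \<in> Obj M" "z \<in> Obj M" "w \<in> Obj M"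
  shows "exch x z (y \<odot> w) \<cdot> (\<one> x \<boxtimes> exch y z w) \<cdot> AssInv M x y (z \<odot> w) =
    (\<one> z \<boxtimes> AssInv M x y w) \<cdot> exch (x \<odot> y) z w"
proof -
  have "(\<one> z \<boxtimes> AssInv M x y w) \<cdot> (exch (x \<odot> y) z w \<cdot> Ass M x y (z \<odot> w)) \<cdot> AssInv M x y (z \<odot> w) =
    (\<one> z \<boxtimes> AssInv M x y w) \<cdot> ((\<one> z \<boxtimes> Ass M x y w) \<cdot> exch x z (y \<odot> w) \<cdot> (\<one> x \<boxtimes> exch y z w)) \<cdot> AssInv M x y (z \<odot> w)"
    by (simp only: exch_ten assms)
  then show ?thesis by simp
qed

text \<open>
  Exchanging \<open>x \<otimes> y\<close> with \<open>z\<close> is natural in \<open>x \<otimes> y\<close>, so that it commutes with the symmetry of \<open>x\<close> and \<open>y\<close>;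
  decomposing both of its occurrences gives the braid relation.
\<close>

lemma yang_baxter:
  assumes [simp]: "x \<in> Obj M" "y \<in> Obj M" "z \<in> Obj M" "w \<in> Obj M"
  shows "(\<one> z \<boxtimes> exch x y w) \<cdot> exch x z (y \<odot> w) \<cdot> (\<one> x \<boxtimes> exch y z w) =
    exch y z (x \<odot> w) \<cdot> (\<one> y \<boxtimes> exch x z w) \<cdot> exch x y (z \<odot> w)"
proof -
  \<comment> \<open>Inserting \<open>AssInv \<cdot> Ass\<close> at the end makes a factor of the shape of \<open>exch_ten_inv\<close>.\<close>
  have "(\<one> z \<boxtimes> exch x y w) \<cdot> exch x z (y \<odot> w) \<cdot> (\<one> x \<boxtimes> exch y z w)
    = (\<one> z \<boxtimes> exch x y w) \<cdot> (exch x z (y \<odot> w) \<cdot> (\<one> x \<boxtimes> exch y z w) \<cdot> AssInv M x y (z \<odot> w)) \<cdot> Ass M x y (z \<odot> w)"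
    by simp
  also have "\<dots> = (\<one> z \<boxtimes> AssInv M y x w) \<cdot> (\<one> z \<boxtimes> (Swap M x y \<boxtimes> \<one> w)) \<cdot> exch (x \<odot> y) z w \<cdot> Ass M x y (z \<odot> w)"
    by (simp add: exch_ten_inv) (simp add: exch_def)
  also have "\<dots> = (\<one> z \<boxtimes> AssInv M y x w) \<cdot> exch (y \<odot> x) z w \<cdot> (Swap M x y \<boxtimes> \<one> (z \<odot> w)) \<cdot> Ass M x y (z \<odot> w)"
    by (simp add: exch_nat[THEN comp_ext] del: ten_comp_ext ten_comp')
  also have "\<dots> = ((\<one> z \<boxtimes> AssInv M y x w) \<cdot> exch (y \<odot> x) z w) \<cdot> (Swap M x y \<boxtimes> \<one> (z \<odot> w)) \<cdot> Ass M x y (z \<odot> w)"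
    by simp
  also have "\<dots> = exch y z (x \<odot> w) \<cdot> (\<one> y \<boxtimes> exch x z w) \<cdot> exch x y (z \<odot> w)"
    by (simp add: exch_ten_inv[symmetric] del: ten_comp_ext) (simp add: exch_def)
  finally show ?thesis .
qed

end

section \<open>Strict maps and functors\<close>

definition parallel :: "('o, 'm) smcat \<Rightarrow> 'm \<Rightarrow> 'm \<Rightarrow> bool" where
  "parallel M p q \<longleftrightarrow> p \<in> Arr M \<and> q \<in> Arr M \<and> Dom M p = Dom M q \<and> Cod M p = Cod M q"

lemma (in sm_data) smc_eq_parallel: "smc_eq M p q \<Longrightarrow> parallel M p q"
  by (induction rule: smc_eq.induct) (auto simp: parallel_def Hom_iff)

text \<open>
  A functor before any equation is imposed. The notion covers symmetric monoidal functors as well as the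
  formal functors \<open>a \<otimes> -\<close> and \<open>- \<otimes> b\<close> into an algebra of formal arrows.
\<close>

locale functor_data = M: sm_data M + N: sm_data N
  for M :: "('o1, 'm1) smcat" and N :: "('o2, 'm2) smcat" and F :: "('o1, 'm1, 'o2, 'm2) smfun" +
  assumes FO_Obj [simp]: "x \<in> Obj M \<Longrightarrow> FO F x \<in> Obj N"
    and FA_Hom: "f \<in> Arr M \<Longrightarrow> FA F f \<in> Hom N (FO F (Dom M f)) (FO F (Cod M f))"
    and F0_Hom: "F0 F \<in> Hom N (Unit N) (FO F (Unit M))"
    and F2_Hom: "x \<in> Obj M \<Longrightarrow> y \<in> Obj M \<Longrightarrow>
      F2 F (x, y) \<in> Hom N (FO F x \<odot>\<^bsub>N\<^esub> FO F y) (FO F (x \<odot>\<^bsub>M\<^esub> y))"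
begin

lemma FA_typing [simp]:
  assumes "f \<in> Arr M"
  shows "FA F f \<in> Arr N" "Dom N (FA F f) = FO F (Dom M f)" "Cod N (FA F f) = FO F (Cod M f)"
  using FA_Hom[OF assms] by (auto simp: Hom_iff)

lemma F0_typing [simp]:
  "F0 F \<in> Arr N" "Dom N (F0 F) = Unit N" "Cod N (F0 F) = FO F (Unit M)"
  using F0_Hom by (auto simp: Hom_iff)

lemma F2_typing [simp]:
  assumes "x \<in> Obj M" "y \<in> Obj M"
  shows "F2 F (x, y) \<in> Arr N" "Dom N (F2 F (x, y)) = FO F x \<odot>\<^bsub>N\<^esub> FO F y"
    "Cod N (F2 F (x, y)) = FO F (x \<odot>\<^bsub>M\<^esub> y)"
  using F2_Hom[OF assms] by (auto simp: Hom_iff)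

lemma functor_eq_parallel: "functor_eq M N F p q \<Longrightarrow> parallel N p q"
  by (induction rule: functor_eq.induct) (auto simp: parallel_def Hom_iff)

lemma mnat_eq_parallel:
  assumes "mnat_eq M N F G \<theta> p q" and "functor_data M N G"
    and "\<And>x. x \<in> Obj M \<Longrightarrow> \<theta> x \<in> Hom N (FO F x) (FO G x)"
  shows "parallel N p q"
proof -
  interpret G: functor_data M N G by fact
  have [simp]: "\<theta> x \<in> Arr N" "Dom N (\<theta> x) = FO F x" "Cod N (\<theta> x) = FO G x" if "x \<in> Obj M" for x
    using assms(3)[OF that] by (auto simp: Hom_iff)
  from assms(1) show ?thesis
    by cases (auto simp: parallel_def Hom_iff)
qed

end

context sm_functor
begin

sublocale functor_data M N F
  by unfold_locales (use FO_in FA_in F0_in F2_in in \<open>auto simp: Hom_iff\<close>)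

lemma fun_id' [simp]: "x \<in> Obj M \<Longrightarrow> FA F (\<one>\<^bsub>M\<^esub> x) = \<one>\<^bsub>N\<^esub> (FO F x)"
  by (rule functor_axioms_hold, rule fun_id)

lemma fun_comp':
  "f \<in> Arr M \<Longrightarrow> g \<in> Arr M \<Longrightarrow> Dom M g = Cod M f \<Longrightarrow> FA F (g \<cdot>\<^bsub>M\<^esub> f) = FA F g \<cdot>\<^bsub>N\<^esub> FA F f"
  by (rule functor_axioms_hold, rule fun_comp) (auto simp: Hom_iff)

lemma F2_nat':
  "f \<in> Arr M \<Longrightarrow> g \<in> Arr M \<Longrightarrow> x = Dom M f \<Longrightarrow> y = Dom M g \<Longrightarrow>
    FA F (f \<boxtimes>\<^bsub>M\<^esub> g) \<cdot>\<^bsub>N\<^esub> F2 F (x, y) = F2 F (Cod M f, Cod M g) \<cdot>\<^bsub>N\<^esub> (FA F f \<boxtimes>\<^bsub>N\<^esub> FA F g)"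
  by (rule functor_axioms_hold, rule F2_nat) (auto simp: Hom_iff)

lemma F2_nat_ext:
  assumes "f \<in> Arr M" "g \<in> Arr M" "x = Dom M f" "y = Dom M g" "k \<in> Arr N" "Cod N k = FO F x \<odot>\<^bsub>N\<^esub> FO F y"
  shows "FA F (f \<boxtimes>\<^bsub>M\<^esub> g) \<cdot>\<^bsub>N\<^esub> F2 F (x, y) \<cdot>\<^bsub>N\<^esub> k = F2 F (Cod M f, Cod M g) \<cdot>\<^bsub>N\<^esub> (FA F f \<boxtimes>\<^bsub>N\<^esub> FA F g) \<cdot>\<^bsub>N\<^esub> k"
  by (rule N.comp_ext[OF F2_nat']) (use assms in auto)

lemma F2_ass':
  "x \<in> Obj M \<Longrightarrow> y \<in> Obj M \<Longrightarrow> z \<in> Obj M \<Longrightarrow>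
      FA F (Ass M x y z) \<cdot>\<^bsub>N\<^esub> F2 F (x, y \<odot>\<^bsub>M\<^esub> z) \<cdot>\<^bsub>N\<^esub> (\<one>\<^bsub>N\<^esub> (FO F x) \<boxtimes>\<^bsub>N\<^esub> F2 F (y, z))
    = F2 F (x \<odot>\<^bsub>M\<^esub> y, z) \<cdot>\<^bsub>N\<^esub> (F2 F (x, y) \<boxtimes>\<^bsub>N\<^esub> \<one>\<^bsub>N\<^esub> (FO F z)) \<cdot>\<^bsub>N\<^esub> Ass N (FO F x) (FO F y) (FO F z)"
  by (rule functor_axioms_hold, rule F2_ass)

lemma F2_run':
  "x \<in> Obj M \<Longrightarrow> FA F (Run M x) \<cdot>\<^bsub>N\<^esub> F2 F (x, Unit M) \<cdot>\<^bsub>N\<^esub> (\<one>\<^bsub>N\<^esub> (FO F x) \<boxtimes>\<^bsub>N\<^esub> F0 F) = Run N (FO F x)"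
  by (rule functor_axioms_hold, rule F2_run)

lemma F2_lun':
  "x \<in> Obj M \<Longrightarrow> FA F (Lun M x) \<cdot>\<^bsub>N\<^esub> F2 F (Unit M, x) \<cdot>\<^bsub>N\<^esub> (F0 F \<boxtimes>\<^bsub>N\<^esub> \<one>\<^bsub>N\<^esub> (FO F x)) = Lun N (FO F x)"
  by (rule functor_axioms_hold, rule F2_lun)

lemma F2_swap':
  "x \<in> Obj M \<Longrightarrow> y \<in> Obj M \<Longrightarrow>
    FA F (Swap M x y) \<cdot>\<^bsub>N\<^esub> F2 F (x, y) = F2 F (y, x) \<cdot>\<^bsub>N\<^esub> Swap N (FO F x) (FO F y)"
  by (rule functor_axioms_hold, rule F2_swap)

end

lemma sm_functorI:
  assumes "sm_category M" "sm_category N" "functor_data M N F"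
    and "FO F \<in> extensional (Obj M)" "FA F \<in> extensional (Arr M)" "F2 F \<in> extensional (Obj M \<times> Obj M)"
    and "\<And>p q. functor_eq M N F p q \<Longrightarrow> p = q"
  shows "sm_functor M N F"
proof -
  interpret M: sm_category M by fact
  interpret N: sm_category N by fact
  interpret functor_data M N F by fact
  show ?thesis
    by unfold_locales (use assms in \<open>auto simp: Hom_iff\<close>)
qed

text \<open>
  Maps that preserve all structure on the nose, between structures that need not satisfy any equation.
  Instances are the quotient map from formal arrows to their classes, the evaluation of formal arrows, and the
  evaluation of functors at an object. The axioms of symmetric monoidal functors and of monoidal natural
  transformations have instances indexed by arrows and objects of the source, so that they
  can be transported along a strict map of targets in both directions.
\<close>

locale strict_hom = N: sm_data N + N': sm_data N'
  for N :: "('o1, 'm1) smcat" and N' :: "('o2, 'm2) smcat" +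
  fixes k :: "'o1 \<Rightarrow> 'o2" and h :: "'m1 \<Rightarrow> 'm2"
  assumes k_Obj [simp]: "x \<in> Obj N \<Longrightarrow> k x \<in> Obj N'"
    and h_Arr [simp]: "f \<in> Arr N \<Longrightarrow> h f \<in> Arr N'"
    and h_Dom [simp]: "f \<in> Arr N \<Longrightarrow> Dom N' (h f) = k (Dom N f)"
    and h_Cod [simp]: "f \<in> Arr N \<Longrightarrow> Cod N' (h f) = k (Cod N f)"
    and pres_Ident [simp]: "x \<in> Obj N \<Longrightarrow> h (\<one>\<^bsub>N\<^esub> x) = \<one>\<^bsub>N'\<^esub> (k x)"
    and pres_Comp [simp]: "f \<in> Arr N \<Longrightarrow> g \<in> Arr N \<Longrightarrow> Dom N g = Cod N f \<Longrightarrow> h (g \<cdot>\<^bsub>N\<^esub> f) = h g \<cdot>\<^bsub>N'\<^esub> h f"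
    and pres_Unit [simp]: "k (Unit N) = Unit N'"
    and pres_TenO [simp]: "x \<in> Obj N \<Longrightarrow> y \<in> Obj N \<Longrightarrow> k (x \<odot>\<^bsub>N\<^esub> y) = k x \<odot>\<^bsub>N'\<^esub> k y"
    and pres_TenA [simp]: "f \<in> Arr N \<Longrightarrow> g \<in> Arr N \<Longrightarrow> h (f \<boxtimes>\<^bsub>N\<^esub> g) = h f \<boxtimes>\<^bsub>N'\<^esub> h g"
    and pres_Ass [simp]: "x \<in> Obj N \<Longrightarrow> y \<in> Obj N \<Longrightarrow> z \<in> Obj N \<Longrightarrow> h (Ass N x y z) = Ass N' (k x) (k y) (k z)"
    and pres_AssInv [simp]: "x \<in> Obj N \<Longrightarrow> y \<in> Obj N \<Longrightarrow> z \<in> Obj N \<Longrightarrow>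
      h (AssInv N x y z) = AssInv N' (k x) (k y) (k z)"
    and pres_Run [simp]: "x \<in> Obj N \<Longrightarrow> h (Run N x) = Run N' (k x)"
    and pres_RunInv [simp]: "x \<in> Obj N \<Longrightarrow> h (RunInv N x) = RunInv N' (k x)"
    and pres_Lun [simp]: "x \<in> Obj N \<Longrightarrow> h (Lun N x) = Lun N' (k x)"
    and pres_LunInv [simp]: "x \<in> Obj N \<Longrightarrow> h (LunInv N x) = LunInv N' (k x)"
    and pres_Swap [simp]: "x \<in> Obj N \<Longrightarrow> y \<in> Obj N \<Longrightarrow> h (Swap N x y) = Swap N' (k x) (k y)"
begin

lemma pres_interchange [simp]:
  assumes "x \<in> Obj N" "y \<in> Obj N" "z \<in> Obj N" "w \<in> Obj N"
  shows "h (interchange N x y z w) = interchange N' (k x) (k y) (k z) (k w)"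
  using assms by (simp add: interchange_def)

lemma smc_eq_image:
  assumes "smc_eq N p q" shows "smc_eq N' (h p) (h q)"
  using assms
  by cases (simp_all add: Hom_iff smc_eq.intros
      smc_eq.comp_id[of _ _ "k x" "k y" for x y] smc_eq.id_comp[of _ _ "k x" "k y" for x y]
      smc_eq.comp_assoc[of _ _ "k x" "k y" _ "k z" _ "k w" for x y z w]
      smc_eq.ten_comp[of _ _ "k x" "k y" _ "k z" _ "k u" "k v" _ "k w" for x y z u v w]
      smc_eq.ass_nat[of _ _ "k x" "k x'" _ "k y" "k y'" _ "k z" "k z'" for x x' y y' z z']
      smc_eq.run_nat[of _ _ "k x" "k y" for x y] smc_eq.lun_nat[of _ _ "k x" "k y" for x y]
      smc_eq.swap_nat[of _ _ "k x" "k x'" _ "k y" "k y'" for x x' y y'])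

text \<open>
  \<open>G\<close> is the composite of \<open>F\<close> with the strict map \<open>(k, h)\<close>, up to values outside the carriers.
\<close>

definition is_image :: "('c, 'd) smcat \<Rightarrow> ('c, 'd, 'o1, 'm1) smfun \<Rightarrow> ('c, 'd, 'o2, 'm2) smfun \<Rightarrow> bool" where
  "is_image M F G \<longleftrightarrow> (\<forall>x\<in>Obj M. FO G x = k (FO F x)) \<and> (\<forall>f\<in>Arr M. FA G f = h (FA F f)) \<and>
     F0 G = h (F0 F) \<and> (\<forall>x\<in>Obj M. \<forall>y\<in>Obj M. F2 G (x, y) = h (F2 F (x, y)))"

lemma image_functor_data:
  assumes "is_image M F G" "functor_data M N F"
  shows "functor_data M N' G"
proof -
  interpret functor_data M N F by fact
  show ?thesis
    by unfold_locales (use assms(1) in \<open>auto simp: is_image_def Hom_iff\<close>)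
qed

text \<open>
  Every instance of a functor axiom for the composite is the image of the same instance for \<open>F\<close>. This reduces
  equations in a quotient to relations between formal arrows, and equations in an internal hom to equations
  at an object.
\<close>

lemma functor_eq_lift:
  assumes "is_image M F G" "functor_data M N F" "functor_eq M N' G p' q'"
  obtains p q where "functor_eq M N F p q" "p' = h p" "q' = h q"
proof -
  interpret functor_data M N F by fact
  have G [simp]: "\<And>x. x \<in> Obj M \<Longrightarrow> FO G x = k (FO F x)" "\<And>f. f \<in> Arr M \<Longrightarrow> FA G f = h (FA F f)"
    "F0 G = h (F0 F)" "\<And>x y. x \<in> Obj M \<Longrightarrow> y \<in> Obj M \<Longrightarrow> F2 G (x, y) = h (F2 F (x, y))"
    using assms(1) by (auto simp: is_image_def)
  from assms(3) show ?thesis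
  proof cases
    case (fun_id x)
    then show ?thesis by (intro that[OF functor_eq.fun_id[of x]]) auto
  next
    case (fun_comp f x y g z)
    then show ?thesis by (intro that[OF functor_eq.fun_comp[of f M x y g z]]) (auto simp: Hom_iff)
  next
    case (F2_nat f x x' g y y')
    then show ?thesis by (intro that[OF functor_eq.F2_nat[of f M x x' g y y']]) (auto simp: Hom_iff)
  next
    case (F2_ass x y z)
    then show ?thesis by (intro that[OF functor_eq.F2_ass[of x M y z]]) auto
  next
    case (F2_run x)
    then show ?thesis by (intro that[OF functor_eq.F2_run[of x M]]) auto
  next
    case (F2_lun x)
    then show ?thesis by (intro that[OF functor_eq.F2_lun[of x M]]) auto
  next
    case (F2_swap x y)
    then show ?thesis by (intro that[OF functor_eq.F2_swap[of x M y]]) auto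
  qed
qed

text \<open>
  The converse passage: it shows that evaluation respects the relations of the tensor.
\<close>

lemma functor_eq_image:
  assumes "is_image M F G" "functor_data M N F" "functor_eq M N F p q"
  shows "functor_eq M N' G (h p) (h q)"
proof -
  interpret functor_data M N F by fact
  have G: "\<And>x. x \<in> Obj M \<Longrightarrow> k (FO F x) = FO G x" "\<And>f. f \<in> Arr M \<Longrightarrow> h (FA F f) = FA G f"
    "h (F0 F) = F0 G" "\<And>x y. x \<in> Obj M \<Longrightarrow> y \<in> Obj M \<Longrightarrow> h (F2 F (x, y)) = F2 G (x, y)"
    using assms(1) by (auto simp: is_image_def)
  from assms(3) show ?thesis
    by cases (auto simp: Hom_iff G functor_eq.fun_id functor_eq.F2_ass functor_eq.F2_run functor_eq.F2_lun
      functor_eq.F2_swap intro!: functor_eq.fun_comp functor_eq.F2_nat)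
qed

lemma mnat_eq_lift:
  assumes "is_image M F F'" "functor_data M N F" "is_image M G G'" "functor_data M N G"
    and \<theta>: "\<And>x. x \<in> Obj M \<Longrightarrow> \<theta> x \<in> Hom N (FO F x) (FO G x)"
    and \<theta>' [simp]: "\<And>x. x \<in> Obj M \<Longrightarrow> \<theta>' x = h (\<theta> x)"
    and "mnat_eq M N' F' G' \<theta>' p' q'"
  obtains p q where "mnat_eq M N F G \<theta> p q" "p' = h p" "q' = h q"
proof -
  interpret F: functor_data M N F by fact
  interpret G: functor_data M N G by fact
  have F' [simp]: "\<And>f. f \<in> Arr M \<Longrightarrow> FA F' f = h (FA F f)"
    "F0 F' = h (F0 F)" "\<And>x y. x \<in> Obj M \<Longrightarrow> y \<in> Obj M \<Longrightarrow> F2 F' (x, y) = h (F2 F (x, y))"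
    using assms(1) by (auto simp: is_image_def)
  have G' [simp]: "\<And>f. f \<in> Arr M \<Longrightarrow> FA G' f = h (FA G f)"
    "F0 G' = h (F0 G)" "\<And>x y. x \<in> Obj M \<Longrightarrow> y \<in> Obj M \<Longrightarrow> F2 G' (x, y) = h (F2 G (x, y))"
    using assms(3) by (auto simp: is_image_def)
  have [simp]: "\<theta> x \<in> Arr N" "Dom N (\<theta> x) = FO F x" "Cod N (\<theta> x) = FO G x" if "x \<in> Obj M" for x
    using \<theta>[OF that] by (auto simp: Hom_iff)
  from assms(7) show ?thesis
  proof cases
    case (naturality f x y)
    then show ?thesis by (intro that[OF mnat_eq.naturality[of f M x y]]) (auto simp: Hom_iff)
  next
    case mon_unit
    then show ?thesis by (intro that[OF mnat_eq.mon_unit]) auto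
  next
    case (mon_ten x y)
    then show ?thesis by (intro that[OF mnat_eq.mon_ten[of x M y]]) auto
  qed
qed

lemma mnat_eq_image:
  assumes "is_image M F F'" "functor_data M N F" "is_image M G G'" "functor_data M N G"
    and \<theta>: "\<And>x. x \<in> Obj M \<Longrightarrow> \<theta> x \<in> Hom N (FO F x) (FO G x)"
    and \<theta>': "\<And>x. x \<in> Obj M \<Longrightarrow> h (\<theta> x) = \<theta>' x"
    and "mnat_eq M N F G \<theta> p q"
  shows "mnat_eq M N' F' G' \<theta>' (h p) (h q)"
proof -
  interpret F: functor_data M N F by fact
  interpret G: functor_data M N G by fact
  have F': "\<And>f. f \<in> Arr M \<Longrightarrow> h (FA F f) = FA F' f"
    "h (F0 F) = F0 F'" "\<And>x y. x \<in> Obj M \<Longrightarrow> y \<in> Obj M \<Longrightarrow> h (F2 F (x, y)) = F2 F' (x, y)"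
    using assms(1) by (auto simp: is_image_def)
  have G': "\<And>f. f \<in> Arr M \<Longrightarrow> h (FA G f) = FA G' f"
    "h (F0 G) = F0 G'" "\<And>x y. x \<in> Obj M \<Longrightarrow> y \<in> Obj M \<Longrightarrow> h (F2 G (x, y)) = F2 G' (x, y)"
    using assms(3) by (auto simp: is_image_def)
  have [simp]: "\<theta> x \<in> Arr N" "Dom N (\<theta> x) = FO F x" "Cod N (\<theta> x) = FO G x" if "x \<in> Obj M" for x
    using \<theta>[OF that] by (auto simp: Hom_iff)
  from assms(7) show ?thesis
    by cases (auto simp: Hom_iff F' G' \<theta>' mnat_eq.mon_unit mnat_eq.mon_ten intro!: mnat_eq.naturality)
qed

lemma strict_fun_functor:
  assumes "sm_category N" "sm_category N'"
  shows "sm_functor N N' (strict_fun N N' k h)"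
proof (rule sm_functorI)
  interpret N: sm_category N by fact
  interpret N': sm_category N' by fact
  show "functor_data N N' (strict_fun N N' k h)"
    by unfold_locales (auto simp: strict_fun_def Hom_iff)
  fix p q assume "functor_eq N N' (strict_fun N N' k h) p q"
  then show "p = q"
    by cases (auto simp: strict_fun_def Hom_iff)
qed (use assms in \<open>auto simp: strict_fun_def\<close>)

end

section \<open>Presented symmetric monoidal categories\<close>

lemma term_alg_simps:
  "Obj (term_alg S) = fwords S" "t \<in> Arr (term_alg S) \<longleftrightarrow> farrow S t" "Dom (term_alg S) = tdom S" "Cod (term_alg S) = tcod S"
  "Ident (term_alg S) = TId" "Comp (term_alg S) = TComp" "Unit (term_alg S) = WUnit" "TenO (term_alg S) = WTen"
  "Ass (term_alg S) = TAss" "AssInv (term_alg S) = TAssInv" "Run (term_alg S) = TRun" "RunInv (term_alg S) = TRunInv"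
  "Lun (term_alg S) = TLun" "LunInv (term_alg S) = TLunInv" "Swap (term_alg S) = TSwap"
  by (simp_all add: term_alg_def)

lemma term_alg_TenA: "t \<boxtimes>\<^bsub>term_alg S\<^esub> u = TComp (TRight t (tcod S u)) (TLeft (tdom S t) u)"
  by (simp add: term_alg_def)

lemma fwords_simps [simp]:
  "WUnit \<in> fwords S" "WGen x \<in> fwords S \<longleftrightarrow> x \<in> sObj S"
  "WTen X Y \<in> fwords S \<longleftrightarrow> X \<in> fwords S \<and> Y \<in> fwords S"
  by (auto simp: fwords_def)

locale signature =
  fixes S :: "('x, 'e) fsig"
  assumes sDom_word [simp]: "e \<in> sArr S \<Longrightarrow> sDom S e \<in> fwords S"
    and sCod_word [simp]: "e \<in> sArr S \<Longrightarrow> sCod S e \<in> fwords S"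
begin

lemma farrow_words [simp]: "farrow S t \<Longrightarrow> tdom S t \<in> fwords S" "farrow S t \<Longrightarrow> tcod S t \<in> fwords S"
  by (induction t) auto

sublocale T: sm_data "term_alg S"
  by unfold_locales (auto simp: term_alg_simps term_alg_TenA Hom_iff)

end

text \<open>
  Relations between parallel arrows only: otherwise source and target of a class would be undefined.
\<close>

locale presentation = signature S for S :: "('x, 'e) fsig" +
  fixes E :: "('x, 'e) fterm \<Rightarrow> ('x, 'e) fterm \<Rightarrow> bool"
  assumes E_parallel: "E t u \<Longrightarrow> parallel (term_alg S) t u"
begin

abbreviation cl where "cl \<equiv> fclass S E"

lemma fcong_parallel:
  "fcong S E t u \<Longrightarrow> farrow S t \<and> farrow S u \<and> tdom S t = tdom S u \<and> tcod S t = tcod S u"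
proof (induction rule: fcong.induct)
  case (relation t u)
  then show ?case using E_parallel[of t u] by (simp add: parallel_def term_alg_simps)
next
  case (smc t u)
  then show ?case using T.smc_eq_parallel[of t u] by (simp add: parallel_def term_alg_simps)
qed (auto simp: term_alg_TenA)

lemma cl_eq_iff: "farrow S t \<Longrightarrow> cl t = cl u \<longleftrightarrow> fcong S E t u"
  by (auto simp: fclass_def intro: fcong.intros)

lemma rep_cl: "farrow S t \<Longrightarrow> fcong S E t (rep (cl t))"
  unfolding rep_def fclass_def by (rule someI2[of _ t]) (auto intro: fcong.refl)

lemma rep_cl_simps [simp]:
  assumes "farrow S t"
  shows "farrow S (rep (cl t))" "tdom S (rep (cl t)) = tdom S t" "tcod S (rep (cl t)) = tcod S t"
  using fcong_parallel[OF rep_cl[OF assms]] by auto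

lemma presented_simps:
  "Obj (presented S E) = fwords S" "Arr (presented S E) = cl ` {t. farrow S t}"
  "Dom (presented S E) p = tdom S (rep p)" "Cod (presented S E) p = tcod S (rep p)"
  "Ident (presented S E) X = cl (TId X)" "Comp (presented S E) q p = cl (TComp (rep q) (rep p))"
  "Unit (presented S E) = WUnit" "TenO (presented S E) = WTen"
  "TenA (presented S E) p q = cl (rep p \<boxtimes>\<^bsub>term_alg S\<^esub> rep q)"
  "Ass (presented S E) X Y Z = cl (TAss X Y Z)" "AssInv (presented S E) X Y Z = cl (TAssInv X Y Z)"
  "Run (presented S E) X = cl (TRun X)" "RunInv (presented S E) X = cl (TRunInv X)"
  "Lun (presented S E) X = cl (TLun X)" "LunInv (presented S E) X = cl (TLunInv X)"
  "Swap (presented S E) X Y = cl (TSwap X Y)"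
  by (auto simp: presented_def term_alg_simps Let_def term_alg_def)

lemma cl_comp:
  assumes "farrow S t" "farrow S u" "tdom S u = tcod S t"
  shows "cl (TComp (rep (cl u)) (rep (cl t))) = cl (TComp u t)"
proof -
  have "fcong S E (TComp u t) (TComp (rep (cl u)) (rep (cl t)))"
    by (intro fcong.cong_comp rep_cl assms)
  then show ?thesis by (simp add: cl_eq_iff assms fcong.sym)
qed

lemma fcong_ten:
  assumes "fcong S E t t'" "fcong S E u u'"
  shows "fcong S E (t \<boxtimes>\<^bsub>term_alg S\<^esub> u) (t' \<boxtimes>\<^bsub>term_alg S\<^esub> u')"
  unfolding term_alg_TenA
  using fcong_parallel[OF assms(1)] fcong_parallel[OF assms(2)]
  by (auto intro!: fcong.cong_comp fcong.cong_left fcong.cong_right assms)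

lemma farrow_ten [simp]: "farrow S (t \<boxtimes>\<^bsub>term_alg S\<^esub> u) \<longleftrightarrow> farrow S t \<and> farrow S u"
  by (auto simp: term_alg_TenA)

lemma cl_ten:
  assumes "farrow S t" "farrow S u"
  shows "cl (rep (cl t) \<boxtimes>\<^bsub>term_alg S\<^esub> rep (cl u)) = cl (t \<boxtimes>\<^bsub>term_alg S\<^esub> u)"
  using fcong_ten[OF rep_cl rep_cl, OF assms] by (simp add: cl_eq_iff assms fcong.sym)

lemma presented_data: "sm_data (presented S E)"
  by unfold_locales
    (auto simp: presented_simps Hom_iff cl_comp cl_ten, auto simp: term_alg_TenA)

lemma cl_strict_hom: "strict_hom (term_alg S) (presented S E) (\<lambda>X. X) cl"
proof -
  interpret P: sm_data "presented S E" by (rule presented_data)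
  show ?thesis
    by unfold_locales (auto simp: presented_simps term_alg_simps cl_comp cl_ten)
qed

lemma presented_Arr: "p \<in> Arr (presented S E) \<Longrightarrow> \<exists>t. t \<in> Arr (term_alg S) \<and> p = cl t"
  by (auto simp: presented_simps term_alg_simps)

lemma smc_eq_cl: "smc_eq (term_alg S) t u \<Longrightarrow> cl t = cl u"
  using fcong_parallel[OF fcong.smc] by (subst cl_eq_iff) (auto intro: fcong.smc)

lemma relation_cl: "E t u \<Longrightarrow> cl t = cl u"
  using fcong_parallel[OF fcong.relation] by (subst cl_eq_iff) (auto intro: fcong.relation)

text \<open>
  Every instance of an axiom for classes is the class of an instance for representatives, and the congruence
  contains the latter by definition.
\<close>

lemma presented_category: "sm_category (presented S E)"
proof -
  interpret P: sm_data "presented S E" by (rule presented_data)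
  interpret cl: strict_hom "term_alg S" "presented S E" "\<lambda>X. X" cl by (rule cl_strict_hom)
  have lift: "\<exists>t \<in> Hom (term_alg S) X Y. p = cl t" if "p \<in> Hom (presented S E) X Y" for p X Y
    using that by (auto simp: Hom_iff dest!: presented_Arr)
  have [simp]: "Obj (presented S E) = Obj (term_alg S)"
    by (simp add: presented_simps term_alg_simps)
  have [simp]: "x \<odot>\<^bsub>presented S E\<^esub> y \<in> Obj (term_alg S)" if "x \<in> Obj (term_alg S)" "y \<in> Obj (term_alg S)" for x y
    using that by (simp add: presented_simps term_alg_simps)
  have [simp]: "Unit (presented S E) \<in> Obj (term_alg S)"
    by (simp add: presented_simps term_alg_simps)
  show ?thesis
  proof
    fix p q assume "smc_eq (presented S E) p q"
    then show "p = q"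
    proof cases
      case (comp_id x y)
      from lift[OF comp_id(2)]
      obtain t where t: "t \<in> Hom (term_alg S) x y" "q = cl t" by blast
      from smc_eq_cl[OF smc_eq.comp_id, OF t(1)] comp_id t show ?thesis
        by (clarsimp simp: Hom_iff)
    next
      case (id_comp x y)
      from lift[OF id_comp(2)]
      obtain t where t: "t \<in> Hom (term_alg S) x y" "q = cl t" by blast
      from smc_eq_cl[OF smc_eq.id_comp, OF t(1)] id_comp t show ?thesis
        by (clarsimp simp: Hom_iff)
    next
      case (comp_assoc f x y g z h w)
      from lift[OF comp_assoc(3)] lift[OF comp_assoc(4)] lift[OF comp_assoc(5)]
      obtain t u v where t: "t \<in> Hom (term_alg S) x y" "f = cl t" "u \<in> Hom (term_alg S) y z" "g = cl u"
        "v \<in> Hom (term_alg S) z w" "h = cl v" by blast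
      from smc_eq_cl[OF smc_eq.comp_assoc, OF t(1,3,5)] comp_assoc t show ?thesis
        by (clarsimp simp: Hom_iff)
    next
      case (ten_comp f x y f' z g u v g' w)
      from lift[OF ten_comp(3)] lift[OF ten_comp(4)] lift[OF ten_comp(5)] lift[OF ten_comp(6)]
      obtain a b c d where t: "a \<in> Hom (term_alg S) x y" "f = cl a" "b \<in> Hom (term_alg S) y z" "f' = cl b"
        "c \<in> Hom (term_alg S) u v" "g = cl c" "d \<in> Hom (term_alg S) v w" "g' = cl d" by blast
      from smc_eq_cl[OF smc_eq.ten_comp, OF t(1,3,5,7)] ten_comp t show ?thesis
        by (clarsimp simp: Hom_iff)
    next
      case (ass_nat f x x' g y y' h z z')
      from lift[OF ass_nat(3)] lift[OF ass_nat(4)] lift[OF ass_nat(5)]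
      obtain a b c where t: "a \<in> Hom (term_alg S) x x'" "f = cl a" "b \<in> Hom (term_alg S) y y'" "g = cl b"
        "c \<in> Hom (term_alg S) z z'" "h = cl c" by blast
      from smc_eq_cl[OF smc_eq.ass_nat, OF t(1,3,5)] ass_nat t show ?thesis
        by (clarsimp simp: Hom_iff)
    next
      case (run_nat f x x')
      from lift[OF run_nat(3)]
      obtain t where t: "t \<in> Hom (term_alg S) x x'" "f = cl t" by blast
      from smc_eq_cl[OF smc_eq.run_nat, OF t(1)] run_nat t show ?thesis
        by (clarsimp simp: Hom_iff)
    next
      case (lun_nat f x x')
      from lift[OF lun_nat(3)]
      obtain t where t: "t \<in> Hom (term_alg S) x x'" "f = cl t" by blast
      from smc_eq_cl[OF smc_eq.lun_nat, OF t(1)] lun_nat t show ?thesis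
        by (clarsimp simp: Hom_iff)
    next
      case (swap_nat f x x' g y y')
      from lift[OF swap_nat(3)] lift[OF swap_nat(4)]
      obtain a b where t: "a \<in> Hom (term_alg S) x x'" "f = cl a" "b \<in> Hom (term_alg S) y y'" "g = cl b" by blast
      from smc_eq_cl[OF smc_eq.swap_nat, OF t(1,3)] swap_nat t show ?thesis
        by (clarsimp simp: Hom_iff)
    qed (use smc_eq_cl[OF smc_eq.ten_id] smc_eq_cl[OF smc_eq.ass_iso1] smc_eq_cl[OF smc_eq.ass_iso2]
        smc_eq_cl[OF smc_eq.run_iso1] smc_eq_cl[OF smc_eq.run_iso2] smc_eq_cl[OF smc_eq.lun_iso1]
        smc_eq_cl[OF smc_eq.lun_iso2] smc_eq_cl[OF smc_eq.pentagon] smc_eq_cl[OF smc_eq.triangle]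
        smc_eq_cl[OF smc_eq.swap_swap] smc_eq_cl[OF smc_eq.swap_unit] smc_eq_cl[OF smc_eq.hexagon] in simp_all)
  qed
qed

lemma cl_TLeft: "X \<in> fwords S \<Longrightarrow> farrow S t \<Longrightarrow> cl (TLeft X t) = \<one>\<^bsub>presented S E\<^esub> X \<boxtimes>\<^bsub>presented S E\<^esub> cl t"
  and cl_TRight: "X \<in> fwords S \<Longrightarrow> farrow S t \<Longrightarrow> cl (TRight t X) = cl t \<boxtimes>\<^bsub>presented S E\<^esub> \<one>\<^bsub>presented S E\<^esub> X"
  by (simp_all add: presented_simps cl_ten cl_eq_iff fcong.left fcong.right)

end

text \<open>
  A valuation of the generators extends to a strict map on formal arrows.
\<close>

locale valuation = signature S + C: sm_category C
  for S :: "('x, 'e) fsig" and C :: "('o, 'm) smcat" +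
  fixes go :: "'x \<Rightarrow> 'o" and ga :: "'e \<Rightarrow> 'm"
  assumes go_Obj [simp]: "x \<in> sObj S \<Longrightarrow> go x \<in> Obj C"
    and ga_Hom: "e \<in> sArr S \<Longrightarrow> ga e \<in> Hom C (eval_word C go (sDom S e)) (eval_word C go (sCod S e))"
begin

lemma eval_word_Obj [simp]: "X \<in> fwords S \<Longrightarrow> eval_word C go X \<in> Obj C"
  by (induction X) auto

lemma eval_term_typing [simp]:
  assumes "farrow S t"
  shows "eval_term C go ga t \<in> Arr C" "Dom C (eval_term C go ga t) = eval_word C go (tdom S t)"
    "Cod C (eval_term C go ga t) = eval_word C go (tcod S t)"
  using assms by (induction t) (use ga_Hom in \<open>auto simp: Hom_iff\<close>)

sublocale eval: strict_hom "term_alg S" C "eval_word C go" "eval_term C go ga"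
  by unfold_locales (auto simp: term_alg_simps term_alg_TenA)

end

locale model = valuation S C go ga + presentation S E for S E C go ga +
  assumes eval_relation: "E t u \<Longrightarrow> eval_term C go ga t = eval_term C go ga u"
begin

text \<open>
  Soundness: the rules generating the congruence hold in \<open>C\<close>, the structural ones because \<open>C\<close> is a symmetric
  monoidal category and the given relations by assumption.
\<close>

lemma eval_fcong: "fcong S E t u \<Longrightarrow> eval_term C go ga t = eval_term C go ga u"
proof (induction rule: fcong.induct)
  case (smc t u)
  then show ?case by (intro C.axioms_hold eval.smc_eq_image)
next
  case (left X t)
  then show ?case using eval.pres_TenA[of "TId X" t] by (simp add: term_alg_simps)
next
  case (right X t)
  then show ?case using eval.pres_TenA[of t "TId X"] by (simp add: term_alg_simps)
qed (simp_all add: eval_relation)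

lemma eval_rep: "farrow S t \<Longrightarrow> eval_term C go ga (rep (cl t)) = eval_term C go ga t"
  using eval_fcong[OF rep_cl] by simp

lemma presented_strict_hom:
  "strict_hom (presented S E) C (eval_word C go) (\<lambda>p. eval_term C go ga (rep p))"
proof -
  interpret P: sm_data "presented S E" by (rule presented_data)
  show ?thesis
    by unfold_locales
      (auto simp: presented_simps eval_rep cl_comp cl_ten eval.pres_TenA[unfolded term_alg_simps])
qed

end

text \<open>
  Every class is built from generating and structural arrows by operations that strict maps preserve.
\<close>

lemma (in presentation) strict_hom_unique:
  assumes "strict_hom (presented S E) C k h" "strict_hom (presented S E) C k' h'"
    and obj: "\<And>x. x \<in> sObj S \<Longrightarrow> k (WGen x) = k' (WGen x)"
    and arr: "\<And>e. e \<in> sArr S \<Longrightarrow> h (cl (TGen e)) = h' (cl (TGen e))"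
  shows "X \<in> fwords S \<Longrightarrow> k X = k' X" "p \<in> Arr (presented S E) \<Longrightarrow> h p = h' p"
proof -
  interpret H: strict_hom "presented S E" C k h by fact
  interpret H': strict_hom "presented S E" C k' h' by fact
  interpret cl: strict_hom "term_alg S" "presented S E" "\<lambda>X. X" cl by (rule cl_strict_hom)
  have k: "k X = k' X" if "X \<in> fwords S" for X
    using that
  proof (induction X)
    case WUnit
    then show ?case using H.pres_Unit H'.pres_Unit by (simp add: presented_simps)
  next
    case (WTen X Y)
    then show ?case using H.pres_TenO[of X Y] H'.pres_TenO[of X Y] by (simp add: presented_simps)
  qed (simp add: obj)
  then show "X \<in> fwords S \<Longrightarrow> k X = k' X" .
  have Obj: "Obj (presented S E) = fwords S" by (simp add: presented_simps)
  have "h (cl t) = h' (cl t)" if "farrow S t" for t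
    using that
  proof (induction t)
    case (TComp u t)
    then show ?case using cl.pres_Comp[of t u] by (simp add: term_alg_simps cl.h_Dom[unfolded term_alg_simps] cl.h_Cod[unfolded term_alg_simps] cl.h_Arr[unfolded term_alg_simps])
  next
    case (TLeft X t)
    then show ?case by (simp add: cl_TLeft cl.h_Arr[unfolded term_alg_simps] Obj k)
  next
    case (TRight t X)
    then show ?case by (simp add: cl_TRight cl.h_Arr[unfolded term_alg_simps] Obj k)
  qed (simp_all add: arr k Obj cl.pres_Ident[unfolded term_alg_simps] cl.pres_Ass[unfolded term_alg_simps]
      cl.pres_AssInv[unfolded term_alg_simps] cl.pres_Run[unfolded term_alg_simps] cl.pres_RunInv[unfolded term_alg_simps]
      cl.pres_Lun[unfolded term_alg_simps] cl.pres_LunInv[unfolded term_alg_simps] cl.pres_Swap[unfolded term_alg_simps])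
  then show "p \<in> Arr (presented S E) \<Longrightarrow> h p = h' p"
    by (auto simp: presented_simps)
qed

section \<open>Coherence\<close>

definition free_sig :: "('x, unit) fsig" where
  "free_sig = \<lparr> sObj = UNIV, sArr = {}, sDom = (\<lambda>_. WUnit), sCod = (\<lambda>_. WUnit) \<rparr>"

lemma free_sig_simps [simp]: "sObj free_sig = UNIV" "sArr free_sig = {}"
  by (simp_all add: free_sig_def)

lemma fwords_free [simp]: "X \<in> fwords free_sig"
  by (simp add: fwords_def)

text \<open>
  No letter occurs twice. In a linear word the permutation realised by a formal arrow can be read off from
  source and target, so that coherence can be stated for all parallel arrows.
\<close>

primrec linear_word :: "'x word \<Rightarrow> bool" where
  "linear_word WUnit \<longleftrightarrow> True"
| "linear_word (WGen x) \<longleftrightarrow> True"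
| "linear_word (WTen X Y) \<longleftrightarrow> linear_word X \<and> linear_word Y \<and> set_word X \<inter> set_word Y = {}"

lemma free_arrow_letters:
  "farrow free_sig t \<Longrightarrow> set_word (tcod free_sig t) = set_word (tdom free_sig t) \<and>
     (linear_word (tcod free_sig t) \<longleftrightarrow> linear_word (tdom free_sig t))"
  by (induction t) auto

text \<open>
  Coherence is proved by a normal form. A word \<open>X\<close> acts on lists of letters by inserting its letters, the last one
  first, and there is a canonical arrow \<open>ins_word X l\<close> from \<open>X \<otimes> l\<close> to the resulting list, read as a right-nested tensor. It has a
  retraction, and every formal arrow \<open>t : X \<rightarrow> Y\<close> between linear words satisfies
  \<open>ins_word Y l \<cdot> (t \<otimes> l) = ins_word X l\<close>. So \<open>t \<otimes> l\<close> depends only on \<open>X\<close> and \<open>Y\<close>, and with the empty list for \<open>l\<close> the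
  same follows for \<open>t\<close>. The order of the letters only serves to make insertion
  independent of the order in which the letters arrive.
\<close>

locale letters = sm_category M for M :: "('o, 'm) smcat" (structure) +
  fixes go :: "'x::linorder \<Rightarrow> 'o"
  assumes letter_Obj [simp]: "go x \<in> Obj M"
begin

sublocale valuation free_sig M go "\<lambda>_::unit. undefined"
  by unfold_locales auto

abbreviation ew where "ew \<equiv> eval_word M go"
abbreviation et where "et \<equiv> eval_term M go (\<lambda>_::unit. undefined)"

primrec list_obj :: "'x list \<Rightarrow> 'o" where
  "list_obj [] = Unit M"
| "list_obj (x # l) = go x \<odot> list_obj l"

lemma list_obj_Obj [simp]: "list_obj l \<in> Obj M"
  by (induction l) auto

primrec ins_letter :: "'x \<Rightarrow> 'x list \<Rightarrow> 'm" where
  "ins_letter x [] = \<one> (go x \<odot> Unit M)"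
| "ins_letter x (y # l) = (if x \<le> y then \<one> (go x \<odot> (go y \<odot> list_obj l))
     else (\<one> (go y) \<boxtimes> ins_letter x l) \<cdot> exch (go x) (go y) (list_obj l))"

lemma ins_letter_typing [simp]:
  "ins_letter x l \<in> Arr M" "Dom M (ins_letter x l) = go x \<odot> list_obj l" "Cod M (ins_letter x l) = list_obj (insort x l)"
  by (induction l) auto

primrec insert_letters :: "'x word \<Rightarrow> 'x list \<Rightarrow> 'x list" where
  "insert_letters WUnit l = l"
| "insert_letters (WGen x) l = insort x l"
| "insert_letters (WTen X Y) l = insert_letters X (insert_letters Y l)"

lemma insert_letters_insort: "insert_letters X (insort y l) = insort y (insert_letters X l)"
  by (induction X arbitrary: l) (auto intro: insort_left_comm)

lemma insert_letters_commute: "insert_letters X (insert_letters Y l) = insert_letters Y (insert_letters X l)"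
  by (induction X arbitrary: l) (auto simp: insert_letters_insort)

primrec ins_word :: "'x word \<Rightarrow> 'x list \<Rightarrow> 'm" where
  "ins_word WUnit l = Lun M (list_obj l)"
| "ins_word (WGen x) l = ins_letter x l"
| "ins_word (WTen X Y) l =
     ins_word X (insert_letters Y l) \<cdot> (\<one> (ew X) \<boxtimes> ins_word Y l) \<cdot> AssInv M (ew X) (ew Y) (list_obj l)"

lemma ins_word_typing [simp]:
  "ins_word X l \<in> Arr M" "Dom M (ins_word X l) = ew X \<odot> list_obj l" "Cod M (ins_word X l) = list_obj (insert_letters X l)"
  by (induction X arbitrary: l) auto

definition split_mono :: "'m \<Rightarrow> bool" where
  "split_mono f \<longleftrightarrow> (\<exists>s\<in>Arr M. Dom M s = Cod M f \<and> s \<cdot> f = \<one> (Dom M f))"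

lemma split_mono_comp:
  assumes "split_mono f" "split_mono g" "f \<in> Arr M" "g \<in> Arr M" "Dom M g = Cod M f"
  shows "split_mono (g \<cdot> f)"
proof -
  obtain s t where s: "s \<in> Arr M" "Dom M s = Cod M f" "s \<cdot> f = \<one> (Dom M f)"
    and t: "t \<in> Arr M" "Dom M t = Cod M g" "t \<cdot> g = \<one> (Dom M g)"
    using assms unfolding split_mono_def by blast
  have "Cod M (t \<cdot> g) = Cod M t" by (rule Comp_typing) (use t(1,2) assms in auto)
  then have "Cod M t = Cod M f" unfolding t(3) using assms by simp
  then have "(s \<cdot> t) \<cdot> g \<cdot> f = \<one> (Dom M f)"
    using s t assms by (simp add: comp_ext1[OF t(3)])
  then show ?thesis unfolding split_mono_def
    using s t assms \<open>Cod M t = Cod M f\<close> by (intro bexI[of _ "s \<cdot> t"]) auto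
qed

lemma split_mono_ten:
  assumes "split_mono f" "f \<in> Arr M" "x \<in> Obj M"
  shows "split_mono (\<one> x \<boxtimes> f)"
proof -
  obtain s where s: "s \<in> Arr M" "Dom M s = Cod M f" "s \<cdot> f = \<one> (Dom M f)"
    using assms unfolding split_mono_def by blast
  then show ?thesis unfolding split_mono_def
    using assms by (intro bexI[of _ "\<one> x \<boxtimes> s"]) auto
qed

lemma split_mono_intros:
  "x \<in> Obj M \<Longrightarrow> split_mono (\<one> x)"
  "x \<in> Obj M \<Longrightarrow> split_mono (Lun M x)"
  "x \<in> Obj M \<Longrightarrow> y \<in> Obj M \<Longrightarrow> z \<in> Obj M \<Longrightarrow> split_mono (AssInv M x y z)"
  "x \<in> Obj M \<Longrightarrow> y \<in> Obj M \<Longrightarrow> z \<in> Obj M \<Longrightarrow> split_mono (exch x y z)"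
  unfolding split_mono_def
  by (auto intro: bexI[of _ "\<one> x"] bexI[of _ "LunInv M x"] bexI[of _ "Ass M x y z"] bexI[of _ "exch y x z"])

lemma split_mono_ins_letter: "split_mono (ins_letter x l)"
  by (induction l) (auto intro!: split_mono_comp split_mono_ten split_mono_intros)

lemma split_mono_ins_word: "split_mono (ins_word X l)"
  by (induction X arbitrary: l) (auto intro!: split_mono_comp split_mono_ten split_mono_intros split_mono_ins_letter)

text \<open>
  While both letters pass a smaller letter \<open>z\<close> of the list the equation is the braid relation; once the smaller of the
  two letters stops, its sides differ by an exchange and its inverse.
\<close>

lemma ins_letter_commute_less:
  assumes "x < y"
  shows "ins_letter x (insort y l) \<cdot> (\<one> (go x) \<boxtimes> ins_letter y l) =
     ins_letter y (insort x l) \<cdot> (\<one> (go y) \<boxtimes> ins_letter x l) \<cdot> exch (go x) (go y) (list_obj l)"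
proof (induction l)
  have [simp]: "x \<le> y" "\<not> y \<le> x" "x \<noteq> y" "y \<noteq> x" using assms by auto
  case Nil
  then show ?case by simp
next
  have [simp]: "x \<le> y" "\<not> y \<le> x" "x \<noteq> y" "y \<noteq> x" using assms by auto
  case (Cons z l)
  consider "y \<le> z" | "x \<le> z" "z < y" | "z < x" by fastforce
  then show ?case
  proof cases
    case 1
    then have "x \<le> z" using assms by auto
    with 1 show ?thesis by simp
  next
    case 2
    then have "\<not> y \<le> z" by auto
    with 2 show ?thesis by simp
  next
    case 3
    then have [simp]: "\<not> x \<le> z" "\<not> y \<le> z" using assms by auto
    let ?L = "list_obj l"
    have "ins_letter x (insort y (z # l)) \<cdot> (\<one> (go x) \<boxtimes> ins_letter y (z # l))
      = (\<one> (go z) \<boxtimes> ins_letter x (insort y l)) \<cdot> exch (go x) (go z) (list_obj (insort y l)) \<cdot>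
        (\<one> (go x) \<boxtimes> (\<one> (go z) \<boxtimes> ins_letter y l)) \<cdot> (\<one> (go x) \<boxtimes> exch (go y) (go z) ?L)"
      by simp
    also have "\<dots> = (\<one> (go z) \<boxtimes> ins_letter x (insort y l)) \<cdot> (\<one> (go z) \<boxtimes> (\<one> (go x) \<boxtimes> ins_letter y l)) \<cdot>
        exch (go x) (go z) (go y \<odot> ?L) \<cdot> (\<one> (go x) \<boxtimes> exch (go y) (go z) ?L)"
      by (simp add: exch_nat[THEN comp_ext] del: ten_comp_ext ten_comp')
    also have "\<dots> = (\<one> (go z) \<boxtimes> ins_letter y (insort x l)) \<cdot> (\<one> (go z) \<boxtimes> (\<one> (go y) \<boxtimes> ins_letter x l)) \<cdot>
        ((\<one> (go z) \<boxtimes> exch (go x) (go y) ?L) \<cdot> exch (go x) (go z) (go y \<odot> ?L) \<cdot> (\<one> (go x) \<boxtimes> exch (go y) (go z) ?L))"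
      by (simp add: Cons.IH insort_left_comm)
    also have "\<dots> = (\<one> (go z) \<boxtimes> ins_letter y (insort x l)) \<cdot> (\<one> (go z) \<boxtimes> (\<one> (go y) \<boxtimes> ins_letter x l)) \<cdot>
        exch (go y) (go z) (go x \<odot> ?L) \<cdot> (\<one> (go y) \<boxtimes> exch (go x) (go z) ?L) \<cdot> exch (go x) (go y) (go z \<odot> ?L)"
      by (simp add: yang_baxter del: ten_comp_ext)
    also have "\<dots> = (\<one> (go z) \<boxtimes> ins_letter y (insort x l)) \<cdot> exch (go y) (go z) (list_obj (insort x l)) \<cdot>
        (\<one> (go y) \<boxtimes> (\<one> (go z) \<boxtimes> ins_letter x l)) \<cdot> (\<one> (go y) \<boxtimes> exch (go x) (go z) ?L) \<cdot> exch (go x) (go y) (go z \<odot> ?L)"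
      by (simp add: exch_nat[THEN comp_ext] del: ten_comp_ext ten_comp')
    also have "\<dots> = ins_letter y (insort x (z # l)) \<cdot> (\<one> (go y) \<boxtimes> ins_letter x (z # l)) \<cdot> exch (go x) (go y) (list_obj (z # l))"
      by simp
    finally show ?thesis .
  qed
qed

definition commuting :: "'x word \<Rightarrow> 'x word \<Rightarrow> bool" where
  "commuting X Y \<longleftrightarrow> (\<forall>l. ins_word X (insert_letters Y l) \<cdot> (\<one> (ew X) \<boxtimes> ins_word Y l) =
     ins_word Y (insert_letters X l) \<cdot> (\<one> (ew Y) \<boxtimes> ins_word X l) \<cdot> exch (ew X) (ew Y) (list_obj l))"

lemma commuting_sym:
  assumes "commuting X Y" shows "commuting Y X"
  unfolding commuting_def
proof
  fix l
  let ?s = "exch (ew Y) (ew X) (list_obj l)"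
  have "(ins_word X (insert_letters Y l) \<cdot> (\<one> (ew X) \<boxtimes> ins_word Y l)) \<cdot> ?s =
     (ins_word Y (insert_letters X l) \<cdot> (\<one> (ew Y) \<boxtimes> ins_word X l) \<cdot> exch (ew X) (ew Y) (list_obj l)) \<cdot> ?s"
    using assms by (simp add: commuting_def)
  then show "ins_word Y (insert_letters X l) \<cdot> (\<one> (ew Y) \<boxtimes> ins_word X l) =
     ins_word X (insert_letters Y l) \<cdot> (\<one> (ew X) \<boxtimes> ins_word Y l) \<cdot> ?s"
    by (simp add: insert_letters_commute)
qed

lemma commuting_letters: "x \<noteq> y \<Longrightarrow> commuting (WGen x) (WGen y)"
proof (induction x y rule: linorder_wlog)
  case (le x y)
  then show ?case by (simp add: commuting_def ins_letter_commute_less)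
next
  case (sym x y)
  then show ?case by (simp add: commuting_sym)
qed

text \<open>
  By induction on \<open>X\<close> it suffices to move the letters of \<open>X\<close> past \<open>Y\<close> one at a time. Used twice, with the symmetry
  of the relation, this reduces disjoint words to distinct letters.
\<close>

lemma commuting_word:
  assumes "\<And>x. x \<in> set_word X \<Longrightarrow> commuting (WGen x) Y"
  shows "commuting X Y"
  using assms
proof (induction X)
  case WUnit
  show ?case unfolding commuting_def
    by (simp add: exch_unit_left lun_nat')
next
  case (WTen X1 X2)
  have 1: "ins_word X1 (insert_letters Y l) \<cdot> (\<one> (ew X1) \<boxtimes> ins_word Y l) =
     ins_word Y (insert_letters X1 l) \<cdot> (\<one> (ew Y) \<boxtimes> ins_word X1 l) \<cdot> exch (ew X1) (ew Y) (list_obj l)" for l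
    using WTen by (simp add: commuting_def)
  have 2: "ins_word X2 (insert_letters Y l) \<cdot> (\<one> (ew X2) \<boxtimes> ins_word Y l) =
     ins_word Y (insert_letters X2 l) \<cdot> (\<one> (ew Y) \<boxtimes> ins_word X2 l) \<cdot> exch (ew X2) (ew Y) (list_obj l)" for l
    using WTen by (simp add: commuting_def)
  show ?case unfolding commuting_def
  proof
    fix l
    let ?L = "list_obj l" and ?l2 = "insert_letters X2 l" and ?x = "ew X1" and ?y = "ew X2" and ?z = "ew Y"
    have "ins_word (WTen X1 X2) (insert_letters Y l) \<cdot> (\<one> (ew (WTen X1 X2)) \<boxtimes> ins_word Y l)
      = ins_word X1 (insert_letters X2 (insert_letters Y l)) \<cdot> (\<one> ?x \<boxtimes> ins_word X2 (insert_letters Y l)) \<cdot>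
        AssInv M ?x ?y (list_obj (insert_letters Y l)) \<cdot> ((\<one> ?x \<boxtimes> \<one> ?y) \<boxtimes> ins_word Y l)"
      by simp
    also have "\<dots> = ins_word X1 (insert_letters X2 (insert_letters Y l)) \<cdot>
        (\<one> ?x \<boxtimes> (ins_word X2 (insert_letters Y l) \<cdot> (\<one> ?y \<boxtimes> ins_word Y l))) \<cdot> AssInv M ?x ?y (?z \<odot> ?L)"
      by (simp add: assinv_nat_rev assinv_nat_rev[THEN comp_ext] del: ten_id')
    also have "\<dots> = (ins_word X1 (insert_letters Y ?l2) \<cdot> (\<one> ?x \<boxtimes> ins_word Y ?l2)) \<cdot>
        (\<one> ?x \<boxtimes> (\<one> ?z \<boxtimes> ins_word X2 l)) \<cdot> (\<one> ?x \<boxtimes> exch ?y ?z ?L) \<cdot> AssInv M ?x ?y (?z \<odot> ?L)"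
      by (simp add: 2 insert_letters_commute[of Y])
    also have "\<dots> = ins_word Y (insert_letters X1 ?l2) \<cdot> (\<one> ?z \<boxtimes> ins_word X1 ?l2) \<cdot> exch ?x ?z (list_obj ?l2) \<cdot>
        (\<one> ?x \<boxtimes> (\<one> ?z \<boxtimes> ins_word X2 l)) \<cdot> (\<one> ?x \<boxtimes> exch ?y ?z ?L) \<cdot> AssInv M ?x ?y (?z \<odot> ?L)"
      by (simp add: 1 insert_letters_commute[of _ Y] del: ten_comp_ext ten_comp')
    also have "\<dots> = ins_word Y (insert_letters X1 ?l2) \<cdot> (\<one> ?z \<boxtimes> ins_word X1 ?l2) \<cdot> (\<one> ?z \<boxtimes> (\<one> ?x \<boxtimes> ins_word X2 l)) \<cdot>
        (exch ?x ?z (?y \<odot> ?L) \<cdot> (\<one> ?x \<boxtimes> exch ?y ?z ?L) \<cdot> AssInv M ?x ?y (?z \<odot> ?L))"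
      by (simp add: exch_nat[THEN comp_ext] del: ten_comp_ext ten_comp')
    also have "\<dots> = ins_word Y (insert_letters (WTen X1 X2) l) \<cdot> (\<one> ?z \<boxtimes> ins_word (WTen X1 X2) l) \<cdot> exch (ew (WTen X1 X2)) ?z ?L"
      by (simp add: exch_ten_inv)
    finally show "ins_word (WTen X1 X2) (insert_letters Y l) \<cdot> (\<one> (ew (WTen X1 X2)) \<boxtimes> ins_word Y l) =
      ins_word Y (insert_letters (WTen X1 X2) l) \<cdot> (\<one> ?z \<boxtimes> ins_word (WTen X1 X2) l) \<cdot> exch (ew (WTen X1 X2)) ?z ?L" .
  qed
qed simp

lemma commuting_disjoint:
  assumes "set_word X \<inter> set_word Y = {}"
  shows "commuting X Y"
proof (rule commuting_word)
  fix x assume x: "x \<in> set_word X"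
  have "commuting Y (WGen x)"
  proof (rule commuting_word)
    fix y assume "y \<in> set_word Y"
    then show "commuting (WGen y) (WGen x)" using assms x by (intro commuting_letters) auto
  qed
  then show "commuting (WGen x) Y" by (rule commuting_sym)
qed

lemma ins_word_ass:
  "ins_word (WTen (WTen X Y) Z) l \<cdot> (Ass M (ew X) (ew Y) (ew Z) \<boxtimes> \<one> (list_obj l)) = ins_word (WTen X (WTen Y Z)) l"
proof -
  let ?L = "list_obj l" and ?x = "ew X" and ?y = "ew Y" and ?z = "ew Z" and ?lz = "insert_letters Z l"
  have "ins_word (WTen (WTen X Y) Z) l \<cdot> (Ass M ?x ?y ?z \<boxtimes> \<one> ?L)
    = ins_word X (insert_letters Y ?lz) \<cdot> (\<one> ?x \<boxtimes> ins_word Y ?lz) \<cdot> AssInv M ?x ?y (list_obj ?lz) \<cdot>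
      ((\<one> ?x \<boxtimes> \<one> ?y) \<boxtimes> ins_word Z l) \<cdot> AssInv M (?x \<odot> ?y) ?z ?L \<cdot> (Ass M ?x ?y ?z \<boxtimes> \<one> ?L)"
    by simp
  also have "\<dots> = ins_word X (insert_letters Y ?lz) \<cdot> (\<one> ?x \<boxtimes> ins_word Y ?lz) \<cdot> (\<one> ?x \<boxtimes> (\<one> ?y \<boxtimes> ins_word Z l)) \<cdot>
      AssInv M ?x ?y (?z \<odot> ?L) \<cdot> AssInv M (?x \<odot> ?y) ?z ?L \<cdot> (Ass M ?x ?y ?z \<boxtimes> \<one> ?L)"
    by (simp add: assinv_nat_rev[THEN comp_ext] del: ten_id' ten_comp_ext ten_comp')
  also have "AssInv M ?x ?y (?z \<odot> ?L) \<cdot> AssInv M (?x \<odot> ?y) ?z ?L \<cdot> (Ass M ?x ?y ?z \<boxtimes> \<one> ?L)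
    = (\<one> ?x \<boxtimes> AssInv M ?y ?z ?L) \<cdot> AssInv M ?x (?y \<odot> ?z) ?L"
    by (rule cancel_right[where m = "Ass M ?x (?y \<odot> ?z) ?L \<cdot> (\<one> ?x \<boxtimes> Ass M ?y ?z ?L)"
          and s = "(\<one> ?x \<boxtimes> AssInv M ?y ?z ?L) \<cdot> AssInv M ?x (?y \<odot> ?z) ?L"])
      (simp_all add: pentagon'[symmetric])
  finally show ?thesis by simp
qed

lemma ins_word_lun: "ins_word X l \<cdot> (Lun M (ew X) \<boxtimes> \<one> (list_obj l)) = ins_word (WTen WUnit X) l"
proof -
  have "ins_word (WTen WUnit X) l = ins_word X l \<cdot> Lun M (ew X \<odot> list_obj l) \<cdot> AssInv M (Unit M) (ew X) (list_obj l)"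
    by (simp add: lun_nat'[THEN comp_ext])
  then show ?thesis by (simp add: lun_ten[symmetric])
qed

lemma insert_letters_arrow: "farrow free_sig t \<Longrightarrow> insert_letters (tcod free_sig t) l = insert_letters (tdom free_sig t) l"
  by (induction t arbitrary: l) (auto simp: insert_letters_commute)

text \<open>
  The associativity and unit cases hold by the pentagon, the triangle and Kelly's law; they only concern the
  bracketing. The case of the symmetry is the commutation of disjoint words.
\<close>

lemma ins_word_arrow:
  assumes "farrow free_sig t" "linear_word (tdom free_sig t)"
  shows "ins_word (tcod free_sig t) l \<cdot> (et t \<boxtimes> \<one> (list_obj l)) = ins_word (tdom free_sig t) l"
  using assms
proof (induction t arbitrary: l)
  case (TGen e)
  then show ?case by simp
next
  case (TId X)
  then show ?case by simp
next
  case (TComp u t)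
  have "ins_word (tcod free_sig u) l \<cdot> (et (TComp u t) \<boxtimes> \<one> (list_obj l))
     = (ins_word (tcod free_sig u) l \<cdot> (et u \<boxtimes> \<one> (list_obj l))) \<cdot> (et t \<boxtimes> \<one> (list_obj l))"
    using TComp.prems by simp
  also have "\<dots> = ins_word (tdom free_sig t) l"
    using TComp by (simp add: free_arrow_letters del: ten_comp_ext ten_comp' comp_assoc')
  finally show ?case by simp
next
  case (TLeft Z t)
  let ?L = "list_obj l" and ?c = "tcod free_sig t" and ?d = "tdom free_sig t"
  have "ins_word (WTen Z ?c) l \<cdot> (et (TLeft Z t) \<boxtimes> \<one> ?L)
    = ins_word Z (insert_letters ?c l) \<cdot> (\<one> (ew Z) \<boxtimes> ins_word ?c l) \<cdot> AssInv M (ew Z) (ew ?c) ?L \<cdot> ((\<one> (ew Z) \<boxtimes> et t) \<boxtimes> \<one> ?L)"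
    using TLeft.prems by simp
  also have "\<dots> = ins_word Z (insert_letters ?c l) \<cdot> (\<one> (ew Z) \<boxtimes> (ins_word ?c l \<cdot> (et t \<boxtimes> \<one> ?L))) \<cdot> AssInv M (ew Z) (ew ?d) ?L"
    using TLeft.prems by (simp add: assinv_nat_rev assinv_nat_rev[THEN comp_ext])
  also have "\<dots> = ins_word (WTen Z ?d) l"
    using TLeft by (simp add: insert_letters_arrow)
  finally show ?case by simp
next
  case (TRight t Z)
  let ?L = "list_obj l" and ?c = "tcod free_sig t" and ?d = "tdom free_sig t" and ?l' = "insert_letters Z l"
  have "ins_word (WTen ?c Z) l \<cdot> (et (TRight t Z) \<boxtimes> \<one> ?L)
    = ins_word ?c ?l' \<cdot> (\<one> (ew ?c) \<boxtimes> ins_word Z l) \<cdot> AssInv M (ew ?c) (ew Z) ?L \<cdot> ((et t \<boxtimes> \<one> (ew Z)) \<boxtimes> \<one> ?L)"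
    using TRight.prems by simp
  also have "\<dots> = (ins_word ?c ?l' \<cdot> (et t \<boxtimes> \<one> (list_obj ?l'))) \<cdot> (\<one> (ew ?d) \<boxtimes> ins_word Z l) \<cdot> AssInv M (ew ?d) (ew Z) ?L"
    using TRight.prems by (simp add: assinv_nat_rev assinv_nat_rev[THEN comp_ext])
  also have "\<dots> = ins_word (WTen ?d Z) l"
    using TRight by simp
  finally show ?case by simp
next
  case (TAss X Y Z)
  show ?case using ins_word_ass[of X Y Z l] by simp
next
  case (TAssInv X Y Z)
  have "(ins_word (WTen (WTen X Y) Z) l \<cdot> (Ass M (ew X) (ew Y) (ew Z) \<boxtimes> \<one> (list_obj l))) \<cdot>
      (AssInv M (ew X) (ew Y) (ew Z) \<boxtimes> \<one> (list_obj l)) = ins_word (WTen (WTen X Y) Z) l"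
    by (simp del: ins_word.simps)
  then show ?case unfolding ins_word_ass by simp
next
  case (TRun X)
  have "(\<one> (ew X) \<boxtimes> Lun M (list_obj l)) \<cdot> AssInv M (ew X) (Unit M) (list_obj l) = Run M (ew X) \<boxtimes> \<one> (list_obj l)"
    by (simp add: triangle'[symmetric])
  then show ?case by simp
next
  case (TRunInv X)
  have "(\<one> (ew X) \<boxtimes> Lun M (list_obj l)) \<cdot> AssInv M (ew X) (Unit M) (list_obj l) \<cdot> (RunInv M (ew X) \<boxtimes> \<one> (list_obj l))
    = (Run M (ew X) \<boxtimes> \<one> (list_obj l)) \<cdot> (RunInv M (ew X) \<boxtimes> \<one> (list_obj l))"
    by (rule comp_ext1) (simp_all add: triangle'[symmetric])
  then show ?case by simp
next
  case (TLun X)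
  show ?case using ins_word_lun[of X l] by simp
next
  case (TLunInv X)
  have "(ins_word (WTen WUnit X) l) \<cdot> (LunInv M (ew X) \<boxtimes> \<one> (list_obj l)) =
      (ins_word X l \<cdot> (Lun M (ew X) \<boxtimes> \<one> (list_obj l))) \<cdot> (LunInv M (ew X) \<boxtimes> \<one> (list_obj l))"
    unfolding ins_word_lun ..
  then show ?case by simp
next
  case (TSwap X Y)
  let ?L = "list_obj l" and ?x = "ew X" and ?y = "ew Y"
  have c: "ins_word X (insert_letters Y l) \<cdot> (\<one> ?x \<boxtimes> ins_word Y l) =
     ins_word Y (insert_letters X l) \<cdot> (\<one> ?y \<boxtimes> ins_word X l) \<cdot> exch ?x ?y ?L"
    using commuting_disjoint[of X Y] TSwap.prems by (simp add: commuting_def)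
  have "ins_word (WTen X Y) l = (ins_word X (insert_letters Y l) \<cdot> (\<one> ?x \<boxtimes> ins_word Y l)) \<cdot> AssInv M ?x ?y ?L"
    by simp
  also have "\<dots> = ins_word (WTen Y X) l \<cdot> (Swap M ?x ?y \<boxtimes> \<one> ?L)"
    unfolding c by (simp add: exch_def insert_letters_commute[of Y])
  finally show ?case by simp
qed

theorem coherence:
  assumes "farrow free_sig t" "farrow free_sig u"
    and "tdom free_sig t = tdom free_sig u" "tcod free_sig t = tcod free_sig u"
    and "linear_word (tdom free_sig t)"
  shows "et t = et u"
proof (rule ten_unit_cancel)
  \<comment> \<open>The empty list is the unit, and tensoring with the unit is faithful.\<close>
  let ?J = "ins_word (tcod free_sig t) []"
  obtain s where s: "s \<in> Arr M" "Dom M s = Cod M ?J" "s \<cdot> ?J = \<one> (Dom M ?J)"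
    using split_mono_ins_word unfolding split_mono_def by blast
  have "?J \<cdot> (et t \<boxtimes> \<one> (Unit M)) = ?J \<cdot> (et u \<boxtimes> \<one> (Unit M))"
    using ins_word_arrow[of t "[]"] ins_word_arrow[of u "[]"] assms by simp
  then show "et t \<boxtimes> \<one> (Unit M) = et u \<boxtimes> \<one> (Unit M)"
    by (rule cancel_left[rotated, of _ _ _ s]) (use s assms in auto)
qed (use assms in auto)

end

context letters
begin

text \<open>
  To apply coherence to an equation between composites in \<open>M\<close>, both sides must be recognised as values of
  formal arrows. The rules below do this by following the syntax of a composite, and find the
  source and target words on the way.
\<close>

definition denotes :: "'x word \<Rightarrow> 'o \<Rightarrow> bool" where
  "denotes X x \<longleftrightarrow> ew X = x"

definition structural :: "'m \<Rightarrow> 'x word \<Rightarrow> 'x word \<Rightarrow> bool" where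
  "structural f X Y \<longleftrightarrow> (\<exists>t. t \<in> Arr (term_alg free_sig) \<and> Dom (term_alg free_sig) t = X \<and>
     Cod (term_alg free_sig) t = Y \<and> et t = f)"

lemma free_words [simp]:
  "X \<in> Obj (term_alg free_sig)" "TenO (term_alg S) = WTen" "Unit (term_alg S) = WUnit"
  by (simp_all add: term_alg_simps)

lemma denotes_rules:
  "denotes WUnit (Unit M)" "denotes X x \<Longrightarrow> denotes Y y \<Longrightarrow> denotes (WTen X Y) (x \<odot> y)"
  by (simp_all add: denotes_def)

lemma structural_ten: "structural f X Y \<Longrightarrow> structural g Z W \<Longrightarrow> structural (f \<boxtimes> g) (WTen X Z) (WTen Y W)"
  unfolding structural_def by (elim exE conjE, rename_tac t u, rule_tac x = "t \<boxtimes>\<^bsub>term_alg free_sig\<^esub> u" in exI) auto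

lemma structural_comp: "structural g Y Z \<Longrightarrow> structural f X Y \<Longrightarrow> structural (g \<cdot> f) X Z"
  unfolding structural_def by (elim exE conjE, rename_tac t u, rule_tac x = "t \<cdot>\<^bsub>term_alg free_sig\<^esub> u" in exI) auto

lemma structural_rules:
  "denotes X x \<Longrightarrow> structural (\<one> x) X X"
  "denotes X x \<Longrightarrow> denotes Y y \<Longrightarrow> denotes Z z \<Longrightarrow> structural (Ass M x y z) (WTen X (WTen Y Z)) (WTen (WTen X Y) Z)"
  "denotes X x \<Longrightarrow> structural (Run M x) (WTen X WUnit) X"
  "denotes X x \<Longrightarrow> structural (RunInv M x) X (WTen X WUnit)"
  "denotes X x \<Longrightarrow> structural (Lun M x) (WTen WUnit X) X"
  "denotes X x \<Longrightarrow> denotes Y y \<Longrightarrow> structural (Swap M x y) (WTen X Y) (WTen Y X)"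
  "denotes X x \<Longrightarrow> denotes Y y \<Longrightarrow> denotes Z z \<Longrightarrow> denotes W w \<Longrightarrow> structural (interchange M x y z w) (WTen (WTen X Y) (WTen Z W)) (WTen (WTen X Z) (WTen Y W))"
proof -
  let ?T = "term_alg free_sig"
  show "denotes X x \<Longrightarrow> structural (\<one> x) X X"
    unfolding structural_def denotes_def by (intro exI[of _ "\<one>\<^bsub>?T\<^esub> X"]) auto
  show "denotes X x \<Longrightarrow> denotes Y y \<Longrightarrow> denotes Z z \<Longrightarrow> structural (Ass M x y z) (WTen X (WTen Y Z)) (WTen (WTen X Y) Z)"
    unfolding structural_def denotes_def by (intro exI[of _ "Ass ?T X Y Z"]) auto
  show "denotes X x \<Longrightarrow> structural (Run M x) (WTen X WUnit) X"
    unfolding structural_def denotes_def by (intro exI[of _ "Run ?T X"]) auto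
  show "denotes X x \<Longrightarrow> structural (RunInv M x) X (WTen X WUnit)"
    unfolding structural_def denotes_def by (intro exI[of _ "RunInv ?T X"]) auto
  show "denotes X x \<Longrightarrow> structural (Lun M x) (WTen WUnit X) X"
    unfolding structural_def denotes_def by (intro exI[of _ "Lun ?T X"]) auto
  show "denotes X x \<Longrightarrow> denotes Y y \<Longrightarrow> structural (Swap M x y) (WTen X Y) (WTen Y X)"
    unfolding structural_def denotes_def by (intro exI[of _ "Swap ?T X Y"]) auto
  show "denotes X x \<Longrightarrow> denotes Y y \<Longrightarrow> denotes Z z \<Longrightarrow> denotes W w \<Longrightarrow> structural (interchange M x y z w) (WTen (WTen X Y) (WTen Z W)) (WTen (WTen X Z) (WTen Y W))"
    unfolding structural_def denotes_def by (intro exI[of _ "interchange ?T X Y Z W"]) auto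
qed

lemma structural_unique:
  "structural f X Y \<Longrightarrow> structural g X Y \<Longrightarrow> linear_word X \<Longrightarrow> f = g"
  using coherence unfolding structural_def term_alg_simps by metis

end

section \<open>The interchange isomorphism\<close>

context sm_category
begin

text \<open>
  The generic letters of coherence are natural numbers; here they are instantiated by given objects.
\<close>

lemma obtain_letters:
  assumes "set xs \<subseteq> Obj M"
  obtains go :: "nat \<Rightarrow> 'a" where "letters M go" "\<And>n. n < length xs \<Longrightarrow> go n = xs ! n"
proof
  show "letters M (\<lambda>n. if n < length xs then xs ! n else Unit M)"
    by unfold_locales (use assms in \<open>auto dest: nth_mem\<close>)
qed simp

lemma interchange_nat:
  assumes [simp]: "f \<in> Arr M" "g \<in> Arr M" "f' \<in> Arr M" "g' \<in> Arr M"
    "x = Dom M f" "y = Dom M g" "z = Dom M f'" "w = Dom M g'"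
  shows "((f \<boxtimes> f') \<boxtimes> (g \<boxtimes> g')) \<cdot> interchange M x y z w =
    interchange M (Cod M f) (Cod M g) (Cod M f') (Cod M g') \<cdot> ((f \<boxtimes> g) \<boxtimes> (f' \<boxtimes> g'))"
proof -
  let ?x = "Cod M f" and ?y = "Cod M g" and ?z = "Cod M f'" and ?w = "Cod M g'"
  have "((f \<boxtimes> f') \<boxtimes> (g \<boxtimes> g')) \<cdot> interchange M x y z w
     = Ass M ?x ?z (?y \<odot> ?w) \<cdot> (f \<boxtimes> ((f' \<boxtimes> (g \<boxtimes> g')) \<cdot> AssInv M z y w \<cdot> (Swap M y z \<boxtimes> \<one> w) \<cdot> Ass M y z w)) \<cdot> AssInv M x y (z \<odot> w)"
    by (simp add: interchange_def nat_exts)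
  also have "\<dots> = Ass M ?x ?z (?y \<odot> ?w) \<cdot> (f \<boxtimes> (AssInv M ?z ?y ?w \<cdot> (((f' \<boxtimes> g) \<cdot> Swap M y z) \<boxtimes> g') \<cdot> Ass M y z w)) \<cdot> AssInv M x y (z \<odot> w)"
    by (simp add: nat_exts)
  also have "\<dots> = Ass M ?x ?z (?y \<odot> ?w) \<cdot> (f \<boxtimes> (AssInv M ?z ?y ?w \<cdot> (Swap M ?y ?z \<boxtimes> \<one> ?w) \<cdot> ((g \<boxtimes> f') \<boxtimes> g') \<cdot> Ass M y z w)) \<cdot> AssInv M x y (z \<odot> w)"
    by (simp add: swap_nat')
  also have "\<dots> = Ass M ?x ?z (?y \<odot> ?w) \<cdot> (\<one> ?x \<boxtimes> (AssInv M ?z ?y ?w \<cdot> (Swap M ?y ?z \<boxtimes> \<one> ?w) \<cdot> Ass M ?y ?z ?w)) \<cdot> (f \<boxtimes> (g \<boxtimes> (f' \<boxtimes> g'))) \<cdot> AssInv M x y (z \<odot> w)"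
    by (simp add: ass_nat' del: ten_comp_ext) (simp add: ass_nat')
  also have "\<dots> = interchange M ?x ?y ?z ?w \<cdot> ((f \<boxtimes> g) \<boxtimes> (f' \<boxtimes> g'))"
    by (simp add: interchange_def assinv_nat' del: ten_comp_ext) simp
  finally show ?thesis .
qed

lemma interchange_nat_rev:
  assumes "f \<in> Arr M" "g \<in> Arr M" "f' \<in> Arr M" "g' \<in> Arr M"
    "x = Cod M f" "y = Cod M g" "z = Cod M f'" "w = Cod M g'"
  shows "interchange M x y z w \<cdot> ((f \<boxtimes> g) \<boxtimes> (f' \<boxtimes> g')) =
    ((f \<boxtimes> f') \<boxtimes> (g \<boxtimes> g')) \<cdot> interchange M (Dom M f) (Dom M g) (Dom M f') (Dom M g')"
  using assms by (simp add: interchange_nat)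

text \<open>
  The equations up to \<open>swap_interchange\<close> say that the tensor is a symmetric monoidal functor of two
  variables whose structure arrow is the interchange, and that \<open>Ass\<close>, \<open>Run\<close>, \<open>Lun\<close> and \<open>Swap\<close> are monoidal natural
  transformations. All of them, and the equations for units after them, are instances of coherence.
\<close>

lemma interchange_ass:
  assumes "x \<in> Obj M" "y \<in> Obj M" "z \<in> Obj M" "w \<in> Obj M" "u \<in> Obj M" "v \<in> Obj M"
  shows "(Ass M x z u \<boxtimes> Ass M y w v) \<cdot> interchange M x y (z \<odot> u) (w \<odot> v) \<cdot> (\<one> (x \<odot> y) \<boxtimes> interchange M z w u v)
    = interchange M (x \<odot> z) (y \<odot> w) u v \<cdot> (interchange M x y z w \<boxtimes> \<one> (u \<odot> v)) \<cdot> Ass M (x \<odot> y) (z \<odot> w) (u \<odot> v)"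
proof -
  obtain go :: "nat \<Rightarrow> 'a" where "letters M go" and go: "\<And>n. n < length [x, y, z, w, u, v] \<Longrightarrow> go n = [x, y, z, w, u, v] ! n"
    by (rule obtain_letters[of "[x, y, z, w, u, v]"]) (use assms in auto)
  interpret letters M go by fact
  have letters: "denotes (WGen 0) x" "denotes (WGen 1) y" "denotes (WGen 2) z" "denotes (WGen 3) w" "denotes (WGen 4) u" "denotes (WGen 5) v"
    by (simp_all add: denotes_def go)
  show ?thesis by (rule structural_unique, (rule structural_ten structural_comp structural_rules denotes_rules letters)+, simp)
qed

lemma interchange_run:
  assumes "x \<in> Obj M" "y \<in> Obj M"
  shows "(Run M x \<boxtimes> Run M y) \<cdot> interchange M x y (Unit M) (Unit M) \<cdot> (\<one> (x \<odot> y) \<boxtimes> RunInv M (Unit M))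
    = Run M (x \<odot> y)"
proof -
  obtain go :: "nat \<Rightarrow> 'a" where "letters M go" and go: "\<And>n. n < length [x, y] \<Longrightarrow> go n = [x, y] ! n"
    by (rule obtain_letters[of "[x, y]"]) (use assms in auto)
  interpret letters M go by fact
  have letters: "denotes (WGen 0) x" "denotes (WGen 1) y"
    by (simp_all add: denotes_def go)
  show ?thesis by (rule structural_unique, (rule structural_ten structural_comp structural_rules denotes_rules letters)+, simp)
qed

lemma interchange_lun:
  assumes "x \<in> Obj M" "y \<in> Obj M"
  shows "(Lun M x \<boxtimes> Lun M y) \<cdot> interchange M (Unit M) (Unit M) x y \<cdot> (RunInv M (Unit M) \<boxtimes> \<one> (x \<odot> y))
    = Lun M (x \<odot> y)"
proof -
  obtain go :: "nat \<Rightarrow> 'a" where "letters M go" and go: "\<And>n. n < length [x, y] \<Longrightarrow> go n = [x, y] ! n"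
    by (rule obtain_letters[of "[x, y]"]) (use assms in auto)
  interpret letters M go by fact
  have letters: "denotes (WGen 0) x" "denotes (WGen 1) y"
    by (simp_all add: denotes_def go)
  show ?thesis by (rule structural_unique, (rule structural_ten structural_comp structural_rules denotes_rules letters)+, simp)
qed

lemma interchange_exchap:
  assumes "x \<in> Obj M" "y \<in> Obj M" "z \<in> Obj M" "w \<in> Obj M"
  shows "(Swap M x z \<boxtimes> Swap M y w) \<cdot> interchange M x y z w
    = interchange M z w x y \<cdot> Swap M (x \<odot> y) (z \<odot> w)"
proof -
  obtain go :: "nat \<Rightarrow> 'a" where "letters M go" and go: "\<And>n. n < length [x, y, z, w] \<Longrightarrow> go n = [x, y, z, w] ! n"
    by (rule obtain_letters[of "[x, y, z, w]"]) (use assms in auto)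
  interpret letters M go by fact
  have letters: "denotes (WGen 0) x" "denotes (WGen 1) y" "denotes (WGen 2) z" "denotes (WGen 3) w"
    by (simp_all add: denotes_def go)
  show ?thesis by (rule structural_unique, (rule structural_ten structural_comp structural_rules denotes_rules letters)+, simp)
qed

lemma ass_interchange:
  assumes "x \<in> Obj M" "y \<in> Obj M" "z \<in> Obj M" "w \<in> Obj M" "u \<in> Obj M" "v \<in> Obj M"
  shows "Ass M (x \<odot> w) (y \<odot> u) (z \<odot> v) \<cdot> (\<one> (x \<odot> w) \<boxtimes> interchange M y z u v) \<cdot> interchange M x (y \<odot> z) w (u \<odot> v)
    = (interchange M x y w u \<boxtimes> \<one> (z \<odot> v)) \<cdot> interchange M (x \<odot> y) z (w \<odot> u) v \<cdot> (Ass M x y z \<boxtimes> Ass M w u v)"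
proof -
  obtain go :: "nat \<Rightarrow> 'a" where "letters M go" and go: "\<And>n. n < length [x, y, z, w, u, v] \<Longrightarrow> go n = [x, y, z, w, u, v] ! n"
    by (rule obtain_letters[of "[x, y, z, w, u, v]"]) (use assms in auto)
  interpret letters M go by fact
  have letters: "denotes (WGen 0) x" "denotes (WGen 1) y" "denotes (WGen 2) z" "denotes (WGen 3) w" "denotes (WGen 4) u" "denotes (WGen 5) v"
    by (simp_all add: denotes_def go)
  show ?thesis by (rule structural_unique, (rule structural_ten structural_comp structural_rules denotes_rules letters)+, simp)
qed

lemma run_interchange:
  assumes "x \<in> Obj M" "y \<in> Obj M"
  shows "Run M (x \<odot> y) \<cdot> (\<one> (x \<odot> y) \<boxtimes> Run M (Unit M)) \<cdot> interchange M x (Unit M) y (Unit M)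
    = Run M x \<boxtimes> Run M y"
proof -
  obtain go :: "nat \<Rightarrow> 'a" where "letters M go" and go: "\<And>n. n < length [x, y] \<Longrightarrow> go n = [x, y] ! n"
    by (rule obtain_letters[of "[x, y]"]) (use assms in auto)
  interpret letters M go by fact
  have letters: "denotes (WGen 0) x" "denotes (WGen 1) y"
    by (simp_all add: denotes_def go)
  show ?thesis by (rule structural_unique, (rule structural_ten structural_comp structural_rules denotes_rules letters)+, simp)
qed

lemma lun_interchange:
  assumes "x \<in> Obj M" "y \<in> Obj M"
  shows "Lun M (x \<odot> y) \<cdot> (Run M (Unit M) \<boxtimes> \<one> (x \<odot> y)) \<cdot> interchange M (Unit M) x (Unit M) y
    = Lun M x \<boxtimes> Lun M y"
proof -
  obtain go :: "nat \<Rightarrow> 'a" where "letters M go" and go: "\<And>n. n < length [x, y] \<Longrightarrow> go n = [x, y] ! n"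
    by (rule obtain_letters[of "[x, y]"]) (use assms in auto)
  interpret letters M go by fact
  have letters: "denotes (WGen 0) x" "denotes (WGen 1) y"
    by (simp_all add: denotes_def go)
  show ?thesis by (rule structural_unique, (rule structural_ten structural_comp structural_rules denotes_rules letters)+, simp)
qed

lemma swap_interchange:
  assumes "x \<in> Obj M" "y \<in> Obj M" "z \<in> Obj M" "w \<in> Obj M"
  shows "Swap M (x \<odot> z) (y \<odot> w) \<cdot> interchange M x y z w
    = interchange M y x w z \<cdot> (Swap M x y \<boxtimes> Swap M z w)"
proof -
  obtain go :: "nat \<Rightarrow> 'a" where "letters M go" and go: "\<And>n. n < length [x, y, z, w] \<Longrightarrow> go n = [x, y, z, w] ! n"
    by (rule obtain_letters[of "[x, y, z, w]"]) (use assms in auto)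
  interpret letters M go by fact
  have letters: "denotes (WGen 0) x" "denotes (WGen 1) y" "denotes (WGen 2) z" "denotes (WGen 3) w"
    by (simp_all add: denotes_def go)
  show ?thesis by (rule structural_unique, (rule structural_ten structural_comp structural_rules denotes_rules letters)+, simp)
qed

lemma interchange_interchange:
  assumes "x \<in> Obj M" "y \<in> Obj M" "z \<in> Obj M" "w \<in> Obj M"
  shows "interchange M x z y w \<cdot> interchange M x y z w
    = \<one> ((x \<odot> y) \<odot> (z \<odot> w))"
proof -
  obtain go :: "nat \<Rightarrow> 'a" where "letters M go" and go: "\<And>n. n < length [x, y, z, w] \<Longrightarrow> go n = [x, y, z, w] ! n"
    by (rule obtain_letters[of "[x, y, z, w]"]) (use assms in auto)
  interpret letters M go by fact
  have letters: "denotes (WGen 0) x" "denotes (WGen 1) y" "denotes (WGen 2) z" "denotes (WGen 3) w"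
    by (simp_all add: denotes_def go)
  show ?thesis by (rule structural_unique, (rule structural_ten structural_comp structural_rules denotes_rules letters)+, simp)
qed

lemma lun_unit:
  shows "Lun M (Unit M)
    = Run M (Unit M)"
proof -
  obtain go :: "nat \<Rightarrow> 'a" where "letters M go" and go: "\<And>n. n < length [] \<Longrightarrow> go n = [] ! n"
    by (rule obtain_letters[of "[]"]) (use Unit_in in auto)
  interpret letters M go by fact
  show ?thesis by (rule structural_unique, (rule structural_ten structural_comp structural_rules denotes_rules )+, simp)
qed

lemma swap_unit_unit:
  shows "Swap M (Unit M) (Unit M)
    = \<one> (Unit M \<odot> Unit M)"
proof -
  obtain go :: "nat \<Rightarrow> 'a" where "letters M go" and go: "\<And>n. n < length [] \<Longrightarrow> go n = [] ! n"
    by (rule obtain_letters[of "[]"]) (use Unit_in in auto)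
  interpret letters M go by fact
  show ?thesis by (rule structural_unique, (rule structural_ten structural_comp structural_rules denotes_rules )+, simp)
qed

lemma run_ten_unit:
  shows "Run M (Unit M) \<cdot> (Run M (Unit M) \<boxtimes> \<one> (Unit M)) \<cdot> Ass M (Unit M) (Unit M) (Unit M)
    = Run M (Unit M) \<cdot> (\<one> (Unit M) \<boxtimes> Run M (Unit M))"
proof -
  obtain go :: "nat \<Rightarrow> 'a" where "letters M go" and go: "\<And>n. n < length [] \<Longrightarrow> go n = [] ! n"
    by (rule obtain_letters[of "[]"]) (use Unit_in in auto)
  interpret letters M go by fact
  show ?thesis by (rule structural_unique, (rule structural_ten structural_comp structural_rules denotes_rules )+, simp)
qed

lemma ass_run_inv:
  shows "Ass M (Unit M) (Unit M) (Unit M) \<cdot> (\<one> (Unit M) \<boxtimes> RunInv M (Unit M)) \<cdot> RunInv M (Unit M)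
    = (RunInv M (Unit M) \<boxtimes> \<one> (Unit M)) \<cdot> RunInv M (Unit M)"
proof -
  obtain go :: "nat \<Rightarrow> 'a" where "letters M go" and go: "\<And>n. n < length [] \<Longrightarrow> go n = [] ! n"
    by (rule obtain_letters[of "[]"]) (use Unit_in in auto)
  interpret letters M go by fact
  show ?thesis by (rule structural_unique, (rule structural_ten structural_comp structural_rules denotes_rules )+, simp)
qed

end

section \<open>The internal hom\<close>

lemma const_functor:
  assumes "sm_category A" "sm_category B"
  shows "sm_functor A B (const_fun A B)"
proof -
  interpret A: sm_category A by fact
  interpret B: sm_category B by fact
  show ?thesis
  proof (rule sm_functorI)
    show "functor_data A B (const_fun A B)"
      by unfold_locales (auto simp: const_fun_def Hom_iff)
    fix p q assume "functor_eq A B (const_fun A B) p q"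
    then show "p = q"
      by cases (auto simp: const_fun_def Hom_iff B.run_ten_unit B.lun_unit B.swap_unit_unit)
  qed (use assms in \<open>auto simp: const_fun_def\<close>)
qed

text \<open>
  Each axiom for \<open>F \<box> G\<close> splits into the axiom for \<open>F\<close>, tensored with the one for \<open>G\<close>, and an equation for the
  interchange, once naturality has moved the interchange to the right of the structure arrows.
\<close>

lemma box_functor:
  fixes B (structure)
  assumes "sm_functor A B F" "sm_functor A B G"
  shows "sm_functor A B (box_fun A B F G)"
proof -
  interpret F: sm_functor A B F by fact
  interpret G: sm_functor A B G by fact
  note A = F.M.sm_category_axioms and B = F.N.sm_category_axioms
  let ?i = "interchange B"
  show ?thesis
  proof (rule sm_functorI[OF A B])
    show "functor_data A B (box_fun A B F G)"
      by unfold_locales (auto simp: box_fun_def Hom_iff)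
    fix p q assume "functor_eq A B (box_fun A B F G) p q"
    then show "p = q"
    proof cases
      case (fun_id x)
      then show ?thesis by (simp add: box_fun_def)
    next
      case (fun_comp f x y g z)
      then show ?thesis by (clarsimp simp: box_fun_def Hom_iff F.fun_comp' G.fun_comp')
    next
      case (F2_nat f x x' g y y')
      then show ?thesis
        by (clarsimp simp: box_fun_def Hom_iff F.F2_nat' G.F2_nat' F.N.interchange_nat_rev)
    next
      case (F2_ass x y z)
      let ?H = "box_fun A B F G"
      have "p = ((FA F (Ass A x y z) \<cdot> F2 F (x, y \<odot>\<^bsub>A\<^esub> z)) \<boxtimes> (FA G (Ass A x y z) \<cdot> F2 G (x, y \<odot>\<^bsub>A\<^esub> z)))
          \<cdot> (?i (FO F x) (FO G x) (FO F (y \<odot>\<^bsub>A\<^esub> z)) (FO G (y \<odot>\<^bsub>A\<^esub> z))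
          \<cdot> ((\<one> (FO F x) \<boxtimes> \<one> (FO G x)) \<boxtimes> (F2 F (y, z) \<boxtimes> F2 G (y, z))))
          \<cdot> (\<one> (FO F x \<odot> FO G x) \<boxtimes> ?i (FO F y) (FO G y) (FO F z) (FO G z))"
        using F2_ass by (simp add: box_fun_def)
      also have "\<dots> = ((FA F (Ass A x y z) \<cdot> F2 F (x, y \<odot>\<^bsub>A\<^esub> z) \<cdot> (\<one> (FO F x) \<boxtimes> F2 F (y, z))) \<boxtimes>
           (FA G (Ass A x y z) \<cdot> F2 G (x, y \<odot>\<^bsub>A\<^esub> z) \<cdot> (\<one> (FO G x) \<boxtimes> F2 G (y, z))))
          \<cdot> ?i (FO F x) (FO G x) (FO F y \<odot> FO F z) (FO G y \<odot> FO G z)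
          \<cdot> (\<one> (FO F x \<odot> FO G x) \<boxtimes> ?i (FO F y) (FO G y) (FO F z) (FO G z))"
        using F2_ass by (simp only: F.N.interchange_nat_rev F.N.Ident_typing F.FO_Obj G.FO_Obj F.F2_typing G.F2_typing F.M.Unit_TenO_Obj) simp
      also have "\<dots> = ((F2 F (x \<odot>\<^bsub>A\<^esub> y, z) \<cdot> (F2 F (x, y) \<boxtimes> \<one> (FO F z))) \<boxtimes>
           (F2 G (x \<odot>\<^bsub>A\<^esub> y, z) \<cdot> (F2 G (x, y) \<boxtimes> \<one> (FO G z))))
          \<cdot> ((Ass B (FO F x) (FO F y) (FO F z) \<boxtimes> Ass B (FO G x) (FO G y) (FO G z))
          \<cdot> ?i (FO F x) (FO G x) (FO F y \<odot> FO F z) (FO G y \<odot> FO G z)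
          \<cdot> (\<one> (FO F x \<odot> FO G x) \<boxtimes> ?i (FO F y) (FO G y) (FO F z) (FO G z)))"
        using F2_ass by (simp add: F.F2_ass' G.F2_ass')
      also have "\<dots> = (F2 F (x \<odot>\<^bsub>A\<^esub> y, z) \<boxtimes> F2 G (x \<odot>\<^bsub>A\<^esub> y, z))
          \<cdot> (((F2 F (x, y) \<boxtimes> \<one> (FO F z)) \<boxtimes> (F2 G (x, y) \<boxtimes> \<one> (FO G z)))
          \<cdot> ?i (FO F x \<odot> FO F y) (FO G x \<odot> FO G y) (FO F z) (FO G z))
          \<cdot> (?i (FO F x) (FO G x) (FO F y) (FO G y) \<boxtimes> \<one> (FO F z \<odot> FO G z))
          \<cdot> Ass B (FO F x \<odot> FO G x) (FO F y \<odot> FO G y) (FO F z \<odot> FO G z)"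
        using F2_ass by (simp add: F.N.interchange_ass)
      also have "\<dots> = q"
        using F2_ass by (simp add: F.N.interchange_nat box_fun_def del: F.N.ten_comp_ext F.N.ten_comp') simp
      finally show ?thesis .
    next
      case (F2_run x)
      have "p = ((FA F (Run A x) \<cdot> F2 F (x, Unit A)) \<boxtimes> (FA G (Run A x) \<cdot> F2 G (x, Unit A)))
          \<cdot> (?i (FO F x) (FO G x) (FO F (Unit A)) (FO G (Unit A))
          \<cdot> ((\<one> (FO F x) \<boxtimes> \<one> (FO G x)) \<boxtimes> (F0 F \<boxtimes> F0 G)))
          \<cdot> (\<one> (FO F x \<odot> FO G x) \<boxtimes> RunInv B (Unit B))"
        using F2_run by (simp add: box_fun_def)
      also have "\<dots> = ((FA F (Run A x) \<cdot> F2 F (x, Unit A) \<cdot> (\<one> (FO F x) \<boxtimes> F0 F)) \<boxtimes>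
           (FA G (Run A x) \<cdot> F2 G (x, Unit A) \<cdot> (\<one> (FO G x) \<boxtimes> F0 G)))
          \<cdot> ?i (FO F x) (FO G x) (Unit B) (Unit B)
          \<cdot> (\<one> (FO F x \<odot> FO G x) \<boxtimes> RunInv B (Unit B))"
        using F2_run by (simp only: F.N.interchange_nat_rev F.N.Ident_typing F.FO_Obj G.FO_Obj F.F0_typing G.F0_typing) simp
      also have "\<dots> = q"
        using F2_run by (simp add: F.F2_run' G.F2_run' F.N.interchange_run box_fun_def)
      finally show ?thesis .
    next
      case (F2_lun x)
      have "p = ((FA F (Lun A x) \<cdot> F2 F (Unit A, x)) \<boxtimes> (FA G (Lun A x) \<cdot> F2 G (Unit A, x)))
          \<cdot> (?i (FO F (Unit A)) (FO G (Unit A)) (FO F x) (FO G x)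
          \<cdot> ((F0 F \<boxtimes> F0 G) \<boxtimes> (\<one> (FO F x) \<boxtimes> \<one> (FO G x))))
          \<cdot> (RunInv B (Unit B) \<boxtimes> \<one> (FO F x \<odot> FO G x))"
        using F2_lun by (simp add: box_fun_def)
      also have "\<dots> = ((FA F (Lun A x) \<cdot> F2 F (Unit A, x) \<cdot> (F0 F \<boxtimes> \<one> (FO F x))) \<boxtimes>
           (FA G (Lun A x) \<cdot> F2 G (Unit A, x) \<cdot> (F0 G \<boxtimes> \<one> (FO G x))))
          \<cdot> ?i (Unit B) (Unit B) (FO F x) (FO G x)
          \<cdot> (RunInv B (Unit B) \<boxtimes> \<one> (FO F x \<odot> FO G x))"
        using F2_lun by (simp only: F.N.interchange_nat_rev F.N.Ident_typing F.FO_Obj G.FO_Obj F.F0_typing G.F0_typing) simp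
      also have "\<dots> = q"
        using F2_lun by (simp add: F.F2_lun' G.F2_lun' F.N.interchange_lun box_fun_def)
      finally show ?thesis .
    next
      case (F2_swap x y)
      have "p = ((FA F (Swap A x y) \<cdot> F2 F (x, y)) \<boxtimes> (FA G (Swap A x y) \<cdot> F2 G (x, y)))
          \<cdot> ?i (FO F x) (FO G x) (FO F y) (FO G y)"
        using F2_swap by (simp add: box_fun_def)
      also have "\<dots> = (F2 F (y, x) \<boxtimes> F2 G (y, x)) \<cdot> (Swap B (FO F x) (FO F y) \<boxtimes> Swap B (FO G x) (FO G y))
          \<cdot> ?i (FO F x) (FO G x) (FO F y) (FO G y)"
        using F2_swap by (simp add: F.F2_swap' G.F2_swap')
      also have "\<dots> = q"
        using F2_swap by (simp add: F.N.interchange_exchap box_fun_def del: F.N.ten_comp_ext)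
      finally show ?thesis .
    qed
  qed (auto simp: box_fun_def)
qed

context mon_nat
begin

lemma ntMap_typing [simp]:
  assumes "x \<in> Obj M"
  shows "ntMap \<sigma> x \<in> Arr N" "Dom N (ntMap \<sigma> x) = FO (ntDom \<sigma>) x" "Cod N (ntMap \<sigma> x) = FO (ntCod \<sigma>) x"
  using ntMap_in[OF assms] by (auto simp: Hom_iff)

lemma naturality': "f \<in> Arr M \<Longrightarrow> x = Dom M f \<Longrightarrow>
    FA (ntCod \<sigma>) f \<cdot>\<^bsub>N\<^esub> ntMap \<sigma> x = ntMap \<sigma> (Cod M f) \<cdot>\<^bsub>N\<^esub> FA (ntDom \<sigma>) f"
  by (rule mnat_axioms_hold, rule naturality) (auto simp: Hom_iff)

lemma mon_unit': "ntMap \<sigma> (Unit M) \<cdot>\<^bsub>N\<^esub> F0 (ntDom \<sigma>) = F0 (ntCod \<sigma>)"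
  by (rule mnat_axioms_hold, rule mon_unit)

lemma mon_ten': "x \<in> Obj M \<Longrightarrow> y \<in> Obj M \<Longrightarrow>
    ntMap \<sigma> (x \<odot>\<^bsub>M\<^esub> y) \<cdot>\<^bsub>N\<^esub> F2 (ntDom \<sigma>) (x, y) = F2 (ntCod \<sigma>) (x, y) \<cdot>\<^bsub>N\<^esub> (ntMap \<sigma> x \<boxtimes>\<^bsub>N\<^esub> ntMap \<sigma> y)"
  by (rule mnat_axioms_hold, rule mon_ten)

end

lemma mon_natI:
  fixes B (structure)
  assumes "sm_functor A B F" "sm_functor A B G"
    and "\<And>x. x \<in> Obj A \<Longrightarrow> \<theta> x \<in> Hom B (FO F x) (FO G x)"
    and "\<And>f. f \<in> Arr A \<Longrightarrow> FA G f \<cdot> \<theta> (Dom A f) = \<theta> (Cod A f) \<cdot> FA F f"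
    and "\<theta> (Unit A) \<cdot> F0 F = F0 G"
    and "\<And>x y. x \<in> Obj A \<Longrightarrow> y \<in> Obj A \<Longrightarrow>
       \<theta> (x \<odot>\<^bsub>A\<^esub> y) \<cdot> F2 F (x, y) = F2 G (x, y) \<cdot> (\<theta> x \<boxtimes> \<theta> y)"
  shows "mon_nat A B \<lparr> ntDom = F, ntCod = G, ntMap = (\<lambda>x\<in>Obj A. \<theta> x) \<rparr>"
proof -
  interpret F: sm_functor A B F by fact
  interpret G: sm_functor A B G by fact
  let ?\<sigma> = "\<lparr> ntDom = F, ntCod = G, ntMap = (\<lambda>x\<in>Obj A. \<theta> x) \<rparr>"
  show ?thesis
  proof (rule mon_nat.intro)
    show "mon_nat_axioms A B ?\<sigma>"
    proof
      fix p q assume "mnat_eq A B (ntDom ?\<sigma>) (ntCod ?\<sigma>) (ntMap ?\<sigma>) p q"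
      then show "p = q" by cases (auto simp: Hom_iff assms(4-6))
    qed (use assms(3) in auto)
  qed (use assms in auto)
qed

lemma hom_simps:
  "F \<in> Obj (hom A B) \<longleftrightarrow> sm_functor A B F" "\<sigma> \<in> Arr (hom A B) \<longleftrightarrow> mon_nat A B \<sigma>"
  "Dom (hom A B) = ntDom" "Cod (hom A B) = ntCod" "Unit (hom A B) = const_fun A B" "TenO (hom A B) = box_fun A B"
  "Ident (hom A B) F = \<lparr> ntDom = F, ntCod = F, ntMap = (\<lambda>a\<in>Obj A. \<one>\<^bsub>B\<^esub> (FO F a)) \<rparr>"
  "Comp (hom A B) \<tau> \<sigma> = \<lparr> ntDom = ntDom \<sigma>, ntCod = ntCod \<tau>, ntMap = (\<lambda>a\<in>Obj A. ntMap \<tau> a \<cdot>\<^bsub>B\<^esub> ntMap \<sigma> a) \<rparr>"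
  "TenA (hom A B) \<sigma> \<tau> = \<lparr> ntDom = box_fun A B (ntDom \<sigma>) (ntDom \<tau>), ntCod = box_fun A B (ntCod \<sigma>) (ntCod \<tau>),
                        ntMap = (\<lambda>a\<in>Obj A. ntMap \<sigma> a \<boxtimes>\<^bsub>B\<^esub> ntMap \<tau> a) \<rparr>"
  "Ass (hom A B) F G H = \<lparr> ntDom = box_fun A B F (box_fun A B G H), ntCod = box_fun A B (box_fun A B F G) H,
                         ntMap = (\<lambda>a\<in>Obj A. Ass B (FO F a) (FO G a) (FO H a)) \<rparr>"
  "AssInv (hom A B) F G H = \<lparr> ntDom = box_fun A B (box_fun A B F G) H, ntCod = box_fun A B F (box_fun A B G H),
                            ntMap = (\<lambda>a\<in>Obj A. AssInv B (FO F a) (FO G a) (FO H a)) \<rparr>"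
  "Run (hom A B) F = \<lparr> ntDom = box_fun A B F (const_fun A B), ntCod = F, ntMap = (\<lambda>a\<in>Obj A. Run B (FO F a)) \<rparr>"
  "RunInv (hom A B) F = \<lparr> ntDom = F, ntCod = box_fun A B F (const_fun A B), ntMap = (\<lambda>a\<in>Obj A. RunInv B (FO F a)) \<rparr>"
  "Lun (hom A B) F = \<lparr> ntDom = box_fun A B (const_fun A B) F, ntCod = F, ntMap = (\<lambda>a\<in>Obj A. Lun B (FO F a)) \<rparr>"
  "LunInv (hom A B) F = \<lparr> ntDom = F, ntCod = box_fun A B (const_fun A B) F, ntMap = (\<lambda>a\<in>Obj A. LunInv B (FO F a)) \<rparr>"
  "Swap (hom A B) F G = \<lparr> ntDom = box_fun A B F G, ntCod = box_fun A B G F, ntMap = (\<lambda>a\<in>Obj A. Swap B (FO F a) (FO G a)) \<rparr>"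
  by (simp_all add: hom_def)

lemma ntMap_comp: "a \<in> Obj A \<Longrightarrow> ntMap (\<tau> \<cdot>\<^bsub>hom A B\<^esub> \<sigma>) a = ntMap \<tau> a \<cdot>\<^bsub>B\<^esub> ntMap \<sigma> a"
  by (simp add: hom_simps)

lemma box_fun_simps:
  fixes B (structure)
  shows
  "x \<in> Obj A \<Longrightarrow> FO (box_fun A B F G) x = FO F x \<odot> FO G x"
  "f \<in> Arr A \<Longrightarrow> FA (box_fun A B F G) f = FA F f \<boxtimes> FA G f"
  "F0 (box_fun A B F G) = (F0 F \<boxtimes> F0 G) \<cdot> RunInv B (Unit B)"
  "x \<in> Obj A \<Longrightarrow> y \<in> Obj A \<Longrightarrow> F2 (box_fun A B F G) (x, y) =
     (F2 F (x, y) \<boxtimes> F2 G (x, y)) \<cdot> interchange B (FO F x) (FO G x) (FO F y) (FO G y)"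
  by (simp_all add: box_fun_def)

lemma const_fun_simps:
  "x \<in> Obj A \<Longrightarrow> FO (const_fun A B) x = Unit B"
  "f \<in> Arr A \<Longrightarrow> FA (const_fun A B) f = \<one>\<^bsub>B\<^esub> (Unit B)"
  "F0 (const_fun A B) = \<one>\<^bsub>B\<^esub> (Unit B)"
  "x \<in> Obj A \<Longrightarrow> y \<in> Obj A \<Longrightarrow> F2 (const_fun A B) (x, y) = Run B (Unit B)"
  by (simp_all add: const_fun_def)

lemma mon_nat_id:
  assumes "sm_functor A B F"
  shows "mon_nat A B \<lparr> ntDom = F, ntCod = F, ntMap = (\<lambda>a\<in>Obj A. \<one>\<^bsub>B\<^esub> (FO F a)) \<rparr>"
proof -
  interpret F: sm_functor A B F by fact
  show ?thesis by (rule mon_natI[OF assms assms]) (auto simp: Hom_iff)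
qed

lemma mon_nat_comp:
  fixes B (structure)
  assumes "mon_nat A B \<sigma>" "mon_nat A B \<tau>" "ntDom \<tau> = ntCod \<sigma>"
  shows "mon_nat A B \<lparr> ntDom = ntDom \<sigma>, ntCod = ntCod \<tau>, ntMap = (\<lambda>a\<in>Obj A. ntMap \<tau> a \<cdot> ntMap \<sigma> a) \<rparr>"
proof -
  interpret s: mon_nat A B \<sigma> by fact
  interpret t: mon_nat A B \<tau> by fact
  note N = s.F.N.comp_ext
  show ?thesis
  proof (rule mon_natI)
    fix f assume [simp]: "f \<in> Arr A"
    have "FA (ntCod \<tau>) f \<cdot> ntMap \<tau> (Dom A f) \<cdot> ntMap \<sigma> (Dom A f) =
        ntMap \<tau> (Cod A f) \<cdot> FA (ntDom \<tau>) f \<cdot> ntMap \<sigma> (Dom A f)"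
      by (rule N[OF t.naturality']) (auto simp: assms)
    then show "FA (ntCod \<tau>) f \<cdot> (ntMap \<tau> (Dom A f) \<cdot> ntMap \<sigma> (Dom A f)) =
        (ntMap \<tau> (Cod A f) \<cdot> ntMap \<sigma> (Cod A f)) \<cdot> FA (ntDom \<sigma>) f"
      by (simp add: assms s.naturality')
  next
    show "(ntMap \<tau> (Unit A) \<cdot> ntMap \<sigma> (Unit A)) \<cdot> F0 (ntDom \<sigma>) = F0 (ntCod \<tau>)"
      using t.mon_unit' by (simp add: assms s.mon_unit')
  next
    fix x y assume [simp]: "x \<in> Obj A" "y \<in> Obj A"
    have "ntMap \<tau> (x \<odot>\<^bsub>A\<^esub> y) \<cdot> F2 (ntDom \<tau>) (x, y) \<cdot> (ntMap \<sigma> x \<boxtimes> ntMap \<sigma> y) =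
        F2 (ntCod \<tau>) (x, y) \<cdot> (ntMap \<tau> x \<boxtimes> ntMap \<tau> y) \<cdot> (ntMap \<sigma> x \<boxtimes> ntMap \<sigma> y)"
      by (rule N[OF t.mon_ten']) (auto simp: assms)
    then show "(ntMap \<tau> (x \<odot>\<^bsub>A\<^esub> y) \<cdot> ntMap \<sigma> (x \<odot>\<^bsub>A\<^esub> y)) \<cdot> F2 (ntDom \<sigma>) (x, y) =
        F2 (ntCod \<tau>) (x, y) \<cdot> ((ntMap \<tau> x \<cdot> ntMap \<sigma> x) \<boxtimes> (ntMap \<tau> y \<cdot> ntMap \<sigma> y))"
      by (simp add: assms s.mon_ten')
  qed (use assms in \<open>auto simp: Hom_iff s.F.sm_functor_axioms t.G.sm_functor_axioms\<close>)
qed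

lemma mon_nat_ten:
  fixes B (structure)
  assumes "mon_nat A B \<sigma>" "mon_nat A B \<tau>"
  shows "mon_nat A B \<lparr> ntDom = box_fun A B (ntDom \<sigma>) (ntDom \<tau>), ntCod = box_fun A B (ntCod \<sigma>) (ntCod \<tau>),
     ntMap = (\<lambda>a\<in>Obj A. ntMap \<sigma> a \<boxtimes> ntMap \<tau> a) \<rparr>"
proof -
  interpret s: mon_nat A B \<sigma> by fact
  interpret t: mon_nat A B \<tau> by fact
  show ?thesis
  proof (rule mon_natI)
    fix x y assume [simp]: "x \<in> Obj A" "y \<in> Obj A"
    show "(ntMap \<sigma> (x \<odot>\<^bsub>A\<^esub> y) \<boxtimes> ntMap \<tau> (x \<odot>\<^bsub>A\<^esub> y)) \<cdot> F2 (box_fun A B (ntDom \<sigma>) (ntDom \<tau>)) (x, y) =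
        F2 (box_fun A B (ntCod \<sigma>) (ntCod \<tau>)) (x, y) \<cdot>
        ((ntMap \<sigma> x \<boxtimes> ntMap \<tau> x) \<boxtimes> (ntMap \<sigma> y \<boxtimes> ntMap \<tau> y))"
      by (simp add: box_fun_simps s.mon_ten' t.mon_ten' s.F.N.interchange_nat_rev)
  qed (auto simp: Hom_iff box_fun_simps box_functor s.F.sm_functor_axioms s.G.sm_functor_axioms
      t.F.sm_functor_axioms t.G.sm_functor_axioms s.naturality' t.naturality' s.mon_unit' t.mon_unit')
qed

text \<open>
  The conditions on the inverse are those on the given transformation, composed with inverse components on
  both sides.
\<close>

lemma mon_nat_inverse:
  fixes B (structure)
  assumes "mon_nat A B \<sigma>"
    and \<theta>: "\<And>x. x \<in> Obj A \<Longrightarrow> \<theta> x \<in> Hom B (FO (ntCod \<sigma>) x) (FO (ntDom \<sigma>) x)"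
    and inv1: "\<And>x. x \<in> Obj A \<Longrightarrow> \<theta> x \<cdot> ntMap \<sigma> x = \<one> (FO (ntDom \<sigma>) x)"
    and inv2: "\<And>x. x \<in> Obj A \<Longrightarrow> ntMap \<sigma> x \<cdot> \<theta> x = \<one> (FO (ntCod \<sigma>) x)"
  shows "mon_nat A B \<lparr> ntDom = ntCod \<sigma>, ntCod = ntDom \<sigma>, ntMap = (\<lambda>x\<in>Obj A. \<theta> x) \<rparr>"
proof -
  interpret s: mon_nat A B \<sigma> by fact
  have [simp]: "\<theta> x \<in> Arr B" "Dom B (\<theta> x) = FO (ntCod \<sigma>) x" "Cod B (\<theta> x) = FO (ntDom \<sigma>) x" if "x \<in> Obj A" for x
    using \<theta>[OF that] by (auto simp: Hom_iff)
  note [simp] = inv1 inv2 s.F.N.comp_ext_id[OF inv1] s.F.N.comp_ext_id[OF inv2]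
  show ?thesis
  proof (rule mon_natI)
    fix f assume [simp]: "f \<in> Arr A"
    have "\<theta> (Cod A f) \<cdot> (FA (ntCod \<sigma>) f \<cdot> ntMap \<sigma> (Dom A f)) \<cdot> \<theta> (Dom A f) =
      \<theta> (Cod A f) \<cdot> (ntMap \<sigma> (Cod A f) \<cdot> FA (ntDom \<sigma>) f) \<cdot> \<theta> (Dom A f)"
      by (simp only: s.naturality' \<open>f \<in> Arr A\<close>)
    then show "FA (ntDom \<sigma>) f \<cdot> \<theta> (Dom A f) = \<theta> (Cod A f) \<cdot> FA (ntCod \<sigma>) f"
      by simp
  next
    show "\<theta> (Unit A) \<cdot> F0 (ntCod \<sigma>) = F0 (ntDom \<sigma>)"
      by (simp add: s.mon_unit'[symmetric])
  next
    fix x y assume [simp]: "x \<in> Obj A" "y \<in> Obj A"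
    have "\<theta> (x \<odot>\<^bsub>A\<^esub> y) \<cdot> (ntMap \<sigma> (x \<odot>\<^bsub>A\<^esub> y) \<cdot> F2 (ntDom \<sigma>) (x, y)) \<cdot> (\<theta> x \<boxtimes> \<theta> y) =
      \<theta> (x \<odot>\<^bsub>A\<^esub> y) \<cdot> (F2 (ntCod \<sigma>) (x, y) \<cdot> (ntMap \<sigma> x \<boxtimes> ntMap \<sigma> y)) \<cdot> (\<theta> x \<boxtimes> \<theta> y)"
      by (simp only: s.mon_ten' \<open>x \<in> Obj A\<close> \<open>y \<in> Obj A\<close>)
    then show "\<theta> (x \<odot>\<^bsub>A\<^esub> y) \<cdot> F2 (ntCod \<sigma>) (x, y) = F2 (ntDom \<sigma>) (x, y) \<cdot> (\<theta> x \<boxtimes> \<theta> y)"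
      by simp
  qed (use s.F.sm_functor_axioms s.G.sm_functor_axioms in \<open>auto simp: Hom_iff\<close>)
qed

text \<open>
  Monoidality at two objects is naturality of \<open>Ass\<close> in the structure arrows of the functors, followed
  by the compatibility of \<open>Ass\<close> with the interchange; in the same way below for the unit laws and the
  symmetry.
\<close>

lemma mon_nat_ass:
  fixes B (structure)
  assumes "sm_functor A B F" "sm_functor A B G" "sm_functor A B H"
  shows "mon_nat A B (Ass (hom A B) F G H)" "mon_nat A B (AssInv (hom A B) F G H)"
proof -
  interpret F: sm_functor A B F by fact
  interpret G: sm_functor A B G by fact
  interpret H: sm_functor A B H by fact
  show *: "mon_nat A B (Ass (hom A B) F G H)" unfolding hom_simps
  proof (rule mon_natI)
    show "Ass B (FO F (Unit A)) (FO G (Unit A)) (FO H (Unit A)) \<cdot> F0 (box_fun A B F (box_fun A B G H)) =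
      F0 (box_fun A B (box_fun A B F G) H)"
    proof -
      have "Ass B (FO F (Unit A)) (FO G (Unit A)) (FO H (Unit A)) \<cdot> F0 (box_fun A B F (box_fun A B G H)) =
        Ass B (FO F (Unit A)) (FO G (Unit A)) (FO H (Unit A)) \<cdot> (F0 F \<boxtimes> (F0 G \<boxtimes> F0 H)) \<cdot>
          (\<one> (Unit B) \<boxtimes> RunInv B (Unit B)) \<cdot> RunInv B (Unit B)"
        by (simp add: box_fun_simps)
      also have "\<dots> = ((F0 F \<boxtimes> F0 G) \<boxtimes> F0 H) \<cdot> Ass B (Unit B) (Unit B) (Unit B) \<cdot>
          (\<one> (Unit B) \<boxtimes> RunInv B (Unit B)) \<cdot> RunInv B (Unit B)"
        by (simp add: F.N.nat_exts del: F.N.ten_comp_ext)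
      also have "\<dots> = F0 (box_fun A B (box_fun A B F G) H)"
        by (simp add: F.N.ass_run_inv box_fun_simps)
      finally show ?thesis .
    qed
  next
    fix x y assume [simp]: "x \<in> Obj A" "y \<in> Obj A"
    let ?a = "\<lambda>x. Ass B (FO F x) (FO G x) (FO H x)"
    have "?a (x \<odot>\<^bsub>A\<^esub> y) \<cdot> F2 (box_fun A B F (box_fun A B G H)) (x, y) =
      (?a (x \<odot>\<^bsub>A\<^esub> y) \<cdot> (F2 F (x, y) \<boxtimes> (F2 G (x, y) \<boxtimes> F2 H (x, y)))) \<cdot>
      (\<one> (FO F x \<odot> FO F y) \<boxtimes> interchange B (FO G x) (FO H x) (FO G y) (FO H y)) \<cdot>
      interchange B (FO F x) (FO G x \<odot> FO H x) (FO F y) (FO G y \<odot> FO H y)"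
      by (simp add: box_fun_simps)
    also have "\<dots> = (((F2 F (x, y) \<boxtimes> F2 G (x, y)) \<boxtimes> F2 H (x, y)) \<cdot>
        Ass B (FO F x \<odot> FO F y) (FO G x \<odot> FO G y) (FO H x \<odot> FO H y)) \<cdot>
      (\<one> (FO F x \<odot> FO F y) \<boxtimes> interchange B (FO G x) (FO H x) (FO G y) (FO H y)) \<cdot>
      interchange B (FO F x) (FO G x \<odot> FO H x) (FO F y) (FO G y \<odot> FO H y)"
      by (simp add: F.N.ass_nat' del: F.N.comp_assoc')
    also have "\<dots> = ((F2 F (x, y) \<boxtimes> F2 G (x, y)) \<boxtimes> F2 H (x, y)) \<cdot>
        (Ass B (FO F x \<odot> FO F y) (FO G x \<odot> FO G y) (FO H x \<odot> FO H y) \<cdot>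
      (\<one> (FO F x \<odot> FO F y) \<boxtimes> interchange B (FO G x) (FO H x) (FO G y) (FO H y)) \<cdot>
      interchange B (FO F x) (FO G x \<odot> FO H x) (FO F y) (FO G y \<odot> FO H y))"
      by simp
    also have "\<dots> = F2 (box_fun A B (box_fun A B F G) H) (x, y) \<cdot> (?a x \<boxtimes> ?a y)"
      by (simp add: F.N.ass_interchange box_fun_simps)
    finally show "?a (x \<odot>\<^bsub>A\<^esub> y) \<cdot> F2 (box_fun A B F (box_fun A B G H)) (x, y) =
      F2 (box_fun A B (box_fun A B F G) H) (x, y) \<cdot> (?a x \<boxtimes> ?a y)" .
  qed (use assms in \<open>auto simp: Hom_iff box_fun_simps box_functor F.N.ass_nat'\<close>)
  show "mon_nat A B (AssInv (hom A B) F G H)"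
    using mon_nat_inverse[OF *, of "\<lambda>a. AssInv B (FO F a) (FO G a) (FO H a)"]
    by (simp add: hom_simps box_fun_simps Hom_iff)
qed

lemma mon_nat_units:
  fixes B (structure)
  assumes "sm_functor A B F"
  shows "mon_nat A B (Run (hom A B) F)" "mon_nat A B (RunInv (hom A B) F)"
    "mon_nat A B (Lun (hom A B) F)" "mon_nat A B (LunInv (hom A B) F)"
proof -
  interpret F: sm_functor A B F by fact
  have c: "sm_functor A B (const_fun A B)"
    by (intro const_functor F.M.sm_category_axioms F.N.sm_category_axioms)
  show r: "mon_nat A B (Run (hom A B) F)" unfolding hom_simps
  proof (rule mon_natI)
    show "Run B (FO F (Unit A)) \<cdot> F0 (box_fun A B F (const_fun A B)) = F0 F"
      using F.N.run_nat'[of "F0 F" "Unit B", THEN F.N.comp_ext, where k = "RunInv B (Unit B)"]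
      by (simp add: box_fun_simps const_fun_simps)
  next
    fix x y assume [simp]: "x \<in> Obj A" "y \<in> Obj A"
    have "Run B (FO F (x \<odot>\<^bsub>A\<^esub> y)) \<cdot> F2 (box_fun A B F (const_fun A B)) (x, y) =
      Run B (FO F (x \<odot>\<^bsub>A\<^esub> y)) \<cdot> (F2 F (x, y) \<boxtimes> \<one> (Unit B)) \<cdot> (\<one> (FO F x \<odot> FO F y) \<boxtimes> Run B (Unit B)) \<cdot>
        interchange B (FO F x) (Unit B) (FO F y) (Unit B)"
      by (simp add: box_fun_simps const_fun_simps)
    also have "\<dots> = F2 F (x, y) \<cdot> Run B (FO F x \<odot> FO F y) \<cdot> (\<one> (FO F x \<odot> FO F y) \<boxtimes> Run B (Unit B)) \<cdot>
        interchange B (FO F x) (Unit B) (FO F y) (Unit B)"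
      by (simp add: F.N.nat_exts del: F.N.ten_comp_ext)
    also have "\<dots> = F2 F (x, y) \<cdot> (Run B (FO F x) \<boxtimes> Run B (FO F y))"
      by (simp add: F.N.run_interchange)
    finally show "Run B (FO F (x \<odot>\<^bsub>A\<^esub> y)) \<cdot> F2 (box_fun A B F (const_fun A B)) (x, y) =
      F2 F (x, y) \<cdot> (Run B (FO F x) \<boxtimes> Run B (FO F y))" .
  qed (use assms c in \<open>auto simp: Hom_iff box_fun_simps const_fun_simps box_functor F.N.run_nat'\<close>)
  show "mon_nat A B (RunInv (hom A B) F)"
    using mon_nat_inverse[OF r, of "\<lambda>a. RunInv B (FO F a)"]
    by (simp add: hom_simps box_fun_simps const_fun_simps Hom_iff)
  show l: "mon_nat A B (Lun (hom A B) F)" unfolding hom_simps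
  proof (rule mon_natI)
    have "Lun B (FO F (Unit A)) \<cdot> F0 (box_fun A B (const_fun A B) F)
       = F0 F \<cdot> Lun B (Unit B) \<cdot> RunInv B (Unit B)"
      using F.N.lun_nat'[of "F0 F" "Unit B", THEN F.N.comp_ext, where k = "RunInv B (Unit B)"]
      by (simp add: box_fun_simps const_fun_simps)
    then show "Lun B (FO F (Unit A)) \<cdot> F0 (box_fun A B (const_fun A B) F) = F0 F"
      by (simp add: F.N.lun_unit)
  next
    fix x y assume [simp]: "x \<in> Obj A" "y \<in> Obj A"
    have "Lun B (FO F (x \<odot>\<^bsub>A\<^esub> y)) \<cdot> F2 (box_fun A B (const_fun A B) F) (x, y) =
      Lun B (FO F (x \<odot>\<^bsub>A\<^esub> y)) \<cdot> (\<one> (Unit B) \<boxtimes> F2 F (x, y)) \<cdot> (Run B (Unit B) \<boxtimes> \<one> (FO F x \<odot> FO F y)) \<cdot>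
        interchange B (Unit B) (FO F x) (Unit B) (FO F y)"
      by (simp add: box_fun_simps const_fun_simps)
    also have "\<dots> = F2 F (x, y) \<cdot> Lun B (FO F x \<odot> FO F y) \<cdot> (Run B (Unit B) \<boxtimes> \<one> (FO F x \<odot> FO F y)) \<cdot>
        interchange B (Unit B) (FO F x) (Unit B) (FO F y)"
      by (simp add: F.N.nat_exts del: F.N.ten_comp_ext)
    also have "\<dots> = F2 F (x, y) \<cdot> (Lun B (FO F x) \<boxtimes> Lun B (FO F y))"
      by (simp add: F.N.lun_interchange)
    finally show "Lun B (FO F (x \<odot>\<^bsub>A\<^esub> y)) \<cdot> F2 (box_fun A B (const_fun A B) F) (x, y) =
      F2 F (x, y) \<cdot> (Lun B (FO F x) \<boxtimes> Lun B (FO F y))" .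
  qed (use assms c in \<open>auto simp: Hom_iff box_fun_simps const_fun_simps box_functor F.N.lun_nat'\<close>)
  show "mon_nat A B (LunInv (hom A B) F)"
    using mon_nat_inverse[OF l, of "\<lambda>a. LunInv B (FO F a)"]
    by (simp add: hom_simps box_fun_simps const_fun_simps Hom_iff)
qed

lemma mon_nat_swap:
  fixes B (structure)
  assumes "sm_functor A B F" "sm_functor A B G"
  shows "mon_nat A B (Swap (hom A B) F G)"
proof -
  interpret F: sm_functor A B F by fact
  interpret G: sm_functor A B G by fact
  show ?thesis unfolding hom_simps
  proof (rule mon_natI)
    have "Swap B (FO F (Unit A)) (FO G (Unit A)) \<cdot> (F0 F \<boxtimes> F0 G) \<cdot> RunInv B (Unit B) =
      (F0 G \<boxtimes> F0 F) \<cdot> Swap B (Unit B) (Unit B) \<cdot> RunInv B (Unit B)"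
      by (simp add: F.N.nat_exts)
    then show "Swap B (FO F (Unit A)) (FO G (Unit A)) \<cdot> F0 (box_fun A B F G) = F0 (box_fun A B G F)"
      by (simp add: box_fun_simps F.N.swap_unit_unit)
  next
    fix x y assume [simp]: "x \<in> Obj A" "y \<in> Obj A"
    have "Swap B (FO F (x \<odot>\<^bsub>A\<^esub> y)) (FO G (x \<odot>\<^bsub>A\<^esub> y)) \<cdot> (F2 F (x, y) \<boxtimes> F2 G (x, y)) \<cdot> interchange B (FO F x) (FO G x) (FO F y) (FO G y)
      = (F2 G (x, y) \<boxtimes> F2 F (x, y)) \<cdot> Swap B (FO F x \<odot> FO F y) (FO G x \<odot> FO G y) \<cdot> interchange B (FO F x) (FO G x) (FO F y) (FO G y)"
      by (simp add: F.N.nat_exts)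
    then show "Swap B (FO F (x \<odot>\<^bsub>A\<^esub> y)) (FO G (x \<odot>\<^bsub>A\<^esub> y)) \<cdot> F2 (box_fun A B F G) (x, y) =
      F2 (box_fun A B G F) (x, y) \<cdot> (Swap B (FO F x) (FO G x) \<boxtimes> Swap B (FO F y) (FO G y))"
      by (simp add: box_fun_simps F.N.swap_interchange)
  qed (use assms in \<open>auto simp: Hom_iff box_fun_simps box_functor F.N.swap_nat'\<close>)
qed

lemma hom_data:
  assumes "sm_category A" "sm_category B"
  shows "sm_data (hom A B)"
proof
  fix F assume "F \<in> Obj (hom A B)"
  then have F: "sm_functor A B F" by (simp add: hom_simps)
  show "\<one>\<^bsub>hom A B\<^esub> F \<in> Hom (hom A B) F F" "Run (hom A B) F \<in> Hom (hom A B) (F \<odot>\<^bsub>hom A B\<^esub> Unit (hom A B)) F"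
    "RunInv (hom A B) F \<in> Hom (hom A B) F (F \<odot>\<^bsub>hom A B\<^esub> Unit (hom A B))"
    "Lun (hom A B) F \<in> Hom (hom A B) (Unit (hom A B) \<odot>\<^bsub>hom A B\<^esub> F) F"
    "LunInv (hom A B) F \<in> Hom (hom A B) F (Unit (hom A B) \<odot>\<^bsub>hom A B\<^esub> F)"
    using mon_nat_id[OF F] mon_nat_units[OF F] by (simp_all add: hom_simps Hom_iff)
  fix G assume "G \<in> Obj (hom A B)"
  then have G: "sm_functor A B G" by (simp add: hom_simps)
  show "F \<odot>\<^bsub>hom A B\<^esub> G \<in> Obj (hom A B)" "Swap (hom A B) F G \<in> Hom (hom A B) (F \<odot>\<^bsub>hom A B\<^esub> G) (G \<odot>\<^bsub>hom A B\<^esub> F)"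
    using box_functor[OF F G] mon_nat_swap[OF F G] by (simp_all add: hom_simps Hom_iff)
  fix H assume "H \<in> Obj (hom A B)"
  then have H: "sm_functor A B H" by (simp add: hom_simps)
  show "Ass (hom A B) F G H \<in> Hom (hom A B) (F \<odot>\<^bsub>hom A B\<^esub> (G \<odot>\<^bsub>hom A B\<^esub> H)) ((F \<odot>\<^bsub>hom A B\<^esub> G) \<odot>\<^bsub>hom A B\<^esub> H)"
    "AssInv (hom A B) F G H \<in> Hom (hom A B) ((F \<odot>\<^bsub>hom A B\<^esub> G) \<odot>\<^bsub>hom A B\<^esub> H) (F \<odot>\<^bsub>hom A B\<^esub> (G \<odot>\<^bsub>hom A B\<^esub> H))"
    using mon_nat_ass[OF F G H] by (simp_all add: hom_simps Hom_iff)
next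
  show "Unit (hom A B) \<in> Obj (hom A B)" using assms by (simp add: hom_simps const_functor)
next
  fix \<sigma> assume "\<sigma> \<in> Arr (hom A B)"
  then interpret mon_nat A B \<sigma> by (simp add: hom_simps)
  show "Dom (hom A B) \<sigma> \<in> Obj (hom A B)" "Cod (hom A B) \<sigma> \<in> Obj (hom A B)"
    by (simp_all add: hom_simps F.sm_functor_axioms G.sm_functor_axioms)
next
  fix \<sigma> \<tau> F G F' G'
  assume "\<sigma> \<in> Hom (hom A B) F G" "\<tau> \<in> Hom (hom A B) F' G'"
  then show "\<sigma> \<boxtimes>\<^bsub>hom A B\<^esub> \<tau> \<in> Hom (hom A B) (F \<odot>\<^bsub>hom A B\<^esub> F') (G \<odot>\<^bsub>hom A B\<^esub> G')"
    by (auto simp: hom_simps Hom_iff intro: mon_nat_ten)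
next
  fix \<sigma> \<tau> F G H
  assume "\<sigma> \<in> Hom (hom A B) F G" "\<tau> \<in> Hom (hom A B) G H"
  then show "\<tau> \<cdot>\<^bsub>hom A B\<^esub> \<sigma> \<in> Hom (hom A B) F H"
    by (auto simp: hom_simps Hom_iff intro: mon_nat_comp)
qed

lemma hom_evaluation:
  assumes "sm_category A" "sm_category B" "a \<in> Obj A"
  shows "strict_hom (hom A B) B (\<lambda>F. FO F a) (\<lambda>\<sigma>. ntMap \<sigma> a)"
proof -
  interpret A: sm_category A by fact
  interpret B: sm_category B by fact
  interpret H: sm_data "hom A B" by (rule hom_data) fact+
  show ?thesis
    by unfold_locales (use assms(3) in \<open>auto simp: hom_simps box_fun_simps const_fun_simps
      mon_nat.ntMap_typing intro: sm_functor.FO_in\<close>)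
qed

lemma mnt_eqI:
  assumes "parallel (hom A B) \<sigma> \<tau>" and "\<And>a. a \<in> Obj A \<Longrightarrow> ntMap \<sigma> a = ntMap \<tau> a"
  shows "\<sigma> = \<tau>"
proof -
  interpret s: mon_nat A B \<sigma> using assms(1) by (simp add: parallel_def hom_simps)
  interpret t: mon_nat A B \<tau> using assms(1) by (simp add: parallel_def hom_simps)
  have "ntMap \<sigma> = ntMap \<tau>"
    using s.ntMap_ext t.ntMap_ext assms(2) by (rule extensionalityI)
  then show ?thesis using assms(1) by (simp add: parallel_def hom_simps mnt.equality)
qed

text \<open>
  An equation between natural transformations holds if it holds at every object, and evaluation at an object
  is strict. So the axioms for the internal hom are those of its target.
\<close>

lemma hom_category:
  assumes "sm_category A" "sm_category B"
  shows "sm_category (hom A B)"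
proof -
  interpret B: sm_category B by fact
  interpret H: sm_data "hom A B" by (rule hom_data) fact+
  show ?thesis
  proof
    fix \<sigma> \<tau> assume eq: "smc_eq (hom A B) \<sigma> \<tau>"
    show "\<sigma> = \<tau>"
    proof (rule mnt_eqI)
      show "parallel (hom A B) \<sigma> \<tau>" using eq by (rule H.smc_eq_parallel)
      fix a assume "a \<in> Obj A"
      then interpret strict_hom "hom A B" B "\<lambda>F. FO F a" "\<lambda>\<sigma>. ntMap \<sigma> a"
        by (intro hom_evaluation assms)
      show "ntMap \<sigma> a = ntMap \<tau> a" using smc_eq_image[OF eq] by (rule B.axioms_hold)
    qed
  qed
qed

text \<open>
  For the same reason, a functor into an internal hom only has to be checked after evaluation at each object.
  The functor \<open>dual_obj M F a\<close> is \<open>F\<close> followed by evaluation at \<open>a\<close>.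
\<close>

lemma functor_into_hom:
  assumes "functor_data M (hom A B) F" and "sm_category M" "sm_category A" "sm_category B"
    and ext: "FO F \<in> extensional (Obj M)" "FA F \<in> extensional (Arr M)" "F2 F \<in> extensional (Obj M \<times> Obj M)"
    and pointwise: "\<And>a. a \<in> Obj A \<Longrightarrow> sm_functor M B (dual_obj M F a)"
  shows "sm_functor M (hom A B) F"
proof (rule sm_functorI)
  interpret F: functor_data M "hom A B" F by fact
  fix \<sigma> \<tau> assume eq: "functor_eq M (hom A B) F \<sigma> \<tau>"
  show "\<sigma> = \<tau>"
  proof (rule mnt_eqI)
    show "parallel (hom A B) \<sigma> \<tau>" using eq by (rule F.functor_eq_parallel)
    fix a assume a: "a \<in> Obj A"
    then interpret strict_hom "hom A B" B "\<lambda>F. FO F a" "\<lambda>\<sigma>. ntMap \<sigma> a"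
      by (intro hom_evaluation assms)
    interpret D: sm_functor M B "dual_obj M F a" using a by (rule pointwise)
    have "is_image M F (dual_obj M F a)"
      by (simp add: is_image_def dual_obj_def)
    from functor_eq_image[OF this F.functor_data_axioms eq] show "ntMap \<sigma> a = ntMap \<tau> a"
      by (rule D.functor_axioms_hold)
  qed
qed (use assms hom_category in auto)

text \<open>
  Likewise for transformations between functors into an internal hom. The values of \<open>Rn\<close> on arrows are such
  transformations, and at an object of the inner source they are plain whiskerings.
\<close>

lemma mon_nat_into_hom:
  assumes "sm_functor M (hom A B) P" "sm_functor M (hom A B) Q" and AB: "sm_category A" "sm_category B"
    and \<theta>: "\<And>x. x \<in> Obj M \<Longrightarrow> \<theta> x \<in> Hom (hom A B) (FO P x) (FO Q x)"
    and pointwise: "\<And>a. a \<in> Obj A \<Longrightarrow>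
      mon_nat M B \<lparr> ntDom = dual_obj M P a, ntCod = dual_obj M Q a, ntMap = (\<lambda>x\<in>Obj M. ntMap (\<theta> x) a) \<rparr>"
  shows "mon_nat M (hom A B) \<lparr> ntDom = P, ntCod = Q, ntMap = (\<lambda>x\<in>Obj M. \<theta> x) \<rparr>"
proof -
  interpret P: sm_functor M "hom A B" P by fact
  interpret Q: sm_functor M "hom A B" Q by fact
  let ?\<theta> = "\<lambda>x\<in>Obj M. \<theta> x"
  have \<theta>': "?\<theta> x \<in> Hom (hom A B) (FO P x) (FO Q x)" if "x \<in> Obj M" for x
    using \<theta>[OF that] that by simp
  have "\<sigma> = \<tau>" if eq: "mnat_eq M (hom A B) P Q ?\<theta> \<sigma> \<tau>" for \<sigma> \<tau>
  proof (rule mnt_eqI)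
    show "parallel (hom A B) \<sigma> \<tau>" by (rule P.mnat_eq_parallel[OF eq Q.functor_data_axioms \<theta>'])
    fix a assume a: "a \<in> Obj A"
    then interpret strict_hom "hom A B" B "\<lambda>F. FO F a" "\<lambda>\<sigma>. ntMap \<sigma> a" by (intro hom_evaluation AB)
    have im: "is_image M F (dual_obj M F a)" for F
      by (simp add: is_image_def dual_obj_def)
    have "mnat_eq M B (dual_obj M P a) (dual_obj M Q a) (\<lambda>x\<in>Obj M. ntMap (\<theta> x) a) (ntMap \<sigma> a) (ntMap \<tau> a)"
      by (rule mnat_eq_image[OF im P.functor_data_axioms im Q.functor_data_axioms \<theta>' _ eq]) simp_all
    then show "ntMap \<sigma> a = ntMap \<tau> a" using mon_nat.mnat_axioms_hold[OF pointwise[OF a]] by simp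
  qed
  then show ?thesis
    using P.sm_functor_axioms Q.sm_functor_axioms \<theta>' by (intro mon_nat.intro mon_nat_axioms.intro) simp_all
qed

lemma dual_obj_functor:
  assumes "sm_functor M (hom A B) F" "sm_category A" "sm_category B" "a \<in> Obj A"
  shows "sm_functor M B (dual_obj M F a)"
proof -
  interpret F: sm_functor M "hom A B" F by fact
  interpret strict_hom "hom A B" B "\<lambda>F. FO F a" "\<lambda>\<sigma>. ntMap \<sigma> a"
    using assms by (intro hom_evaluation)
  have im: "is_image M F (dual_obj M F a)"
    by (simp add: is_image_def dual_obj_def)
  show ?thesis
  proof (rule sm_functorI)
    show "functor_data M B (dual_obj M F a)"
      using im F.functor_data_axioms by (rule image_functor_data)
    fix p q assume "functor_eq M B (dual_obj M F a) p q"
    with im F.functor_data_axioms obtain \<sigma> \<tau> where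
      "functor_eq M (hom A B) F \<sigma> \<tau>" "p = ntMap \<sigma> a" "q = ntMap \<tau> a" by (rule functor_eq_lift)
    then show "p = q" using F.functor_axioms_hold[of \<sigma> \<tau>] by simp
  qed (use assms F.M.sm_category_axioms in \<open>auto simp: dual_obj_def\<close>)
qed

section \<open>Composition\<close>

lemma comp_fun_simps:
  "x \<in> Obj A \<Longrightarrow> FO (comp_fun A C G F) x = FO G (FO F x)"
  "f \<in> Arr A \<Longrightarrow> FA (comp_fun A C G F) f = FA G (FA F f)"
  "F0 (comp_fun A C G F) = FA G (F0 F) \<cdot>\<^bsub>C\<^esub> F0 G"
  "x \<in> Obj A \<Longrightarrow> y \<in> Obj A \<Longrightarrow> F2 (comp_fun A C G F) (x, y) = FA G (F2 F (x, y)) \<cdot>\<^bsub>C\<^esub> F2 G (FO F x, FO F y)"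
  by (simp_all add: comp_fun_def)

text \<open>
  The structure arrow of \<open>G F\<close> is the image of that of \<open>F\<close> after that of \<open>G\<close>; each axiom follows by moving the
  latter past images of arrows by naturality and using the axiom for \<open>F\<close> under \<open>G\<close>, then the one for \<open>G\<close>.
\<close>

lemma comp_functor:
  fixes C (structure)
  assumes "sm_functor A B F" "sm_functor B C G"
  shows "sm_functor A C (comp_fun A C G F)"
proof -
  interpret F: sm_functor A B F by fact
  interpret G: sm_functor B C G by fact
  show ?thesis
  proof (rule sm_functorI)
    show "functor_data A C (comp_fun A C G F)"
      by unfold_locales (auto simp: comp_fun_simps Hom_iff)
    fix p q assume "functor_eq A C (comp_fun A C G F) p q"
    then show "p = q"
    proof cases
      case (fun_id x)
      then show ?thesis by (simp add: comp_fun_simps)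
    next
      case (fun_comp f x y g z)
      then show ?thesis by (clarsimp simp: comp_fun_simps Hom_iff F.fun_comp' G.fun_comp')
    next
      case (F2_nat f x x' g y y')
      then have [simp]: "f \<in> Arr A" "g \<in> Arr A" "Dom A f = x" "Dom A g = y" "Cod A f = x'" "Cod A g = y'"
        "x \<in> Obj A" "y \<in> Obj A" "x' \<in> Obj A" "y' \<in> Obj A"
        by (auto simp: Hom_iff)
      have "p = FA G (FA F (f \<boxtimes>\<^bsub>A\<^esub> g) \<cdot>\<^bsub>B\<^esub> F2 F (x, y)) \<cdot> F2 G (FO F x, FO F y)"
        using F2_nat by (simp add: comp_fun_simps G.fun_comp')
      also have "\<dots> = q"
        using F2_nat by (simp add: F.F2_nat' G.fun_comp' G.F2_nat' comp_fun_simps)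
      finally show ?thesis .
    next
      case (F2_ass x y z)
      let ?F = "FO F" and ?G = "\<lambda>x. FO G (FO F x)"
      have "p = FA G (FA F (Ass A x y z) \<cdot>\<^bsub>B\<^esub> F2 F (x, y \<odot>\<^bsub>A\<^esub> z)) \<cdot>
          (F2 G (?F x, ?F (y \<odot>\<^bsub>A\<^esub> z)) \<cdot> (FA G (\<one>\<^bsub>B\<^esub> (?F x)) \<boxtimes> FA G (F2 F (y, z)))) \<cdot> (\<one> (?G x) \<boxtimes> F2 G (?F y, ?F z))"
        using F2_ass by (simp add: comp_fun_simps G.fun_comp')
      also have "\<dots> = FA G (FA F (Ass A x y z) \<cdot>\<^bsub>B\<^esub> F2 F (x, y \<odot>\<^bsub>A\<^esub> z) \<cdot>\<^bsub>B\<^esub> (\<one>\<^bsub>B\<^esub> (?F x) \<boxtimes>\<^bsub>B\<^esub> F2 F (y, z))) \<cdot>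
          F2 G (?F x, ?F y \<odot>\<^bsub>B\<^esub> ?F z) \<cdot> (\<one> (?G x) \<boxtimes> F2 G (?F y, ?F z))"
        using F2_ass G.F2_nat'[of "\<one>\<^bsub>B\<^esub> (?F x)" "F2 F (y, z)" "?F x" "?F y \<odot>\<^bsub>B\<^esub> ?F z", symmetric]
        by (simp add: G.fun_comp' del: G.N.ten_comp_ext G.fun_id')
      also have "\<dots> = FA G (F2 F (x \<odot>\<^bsub>A\<^esub> y, z)) \<cdot> FA G (F2 F (x, y) \<boxtimes>\<^bsub>B\<^esub> \<one>\<^bsub>B\<^esub> (?F z)) \<cdot>
          (FA G (Ass B (?F x) (?F y) (?F z)) \<cdot>
          F2 G (?F x, ?F y \<odot>\<^bsub>B\<^esub> ?F z) \<cdot> (\<one> (?G x) \<boxtimes> F2 G (?F y, ?F z)))"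
        using F2_ass by (simp add: F.F2_ass' G.fun_comp')
      also have "\<dots> = q"
        using F2_ass by (simp add: G.F2_ass' G.F2_nat_ext comp_fun_simps)
      finally show ?thesis .
    next
      case (F2_run x)
      let ?F = "FO F" and ?G = "\<lambda>x. FO G (FO F x)"
      have "p = FA G (FA F (Run A x) \<cdot>\<^bsub>B\<^esub> F2 F (x, Unit A)) \<cdot>
          (F2 G (?F x, ?F (Unit A)) \<cdot> (FA G (\<one>\<^bsub>B\<^esub> (?F x)) \<boxtimes> FA G (F0 F))) \<cdot> (\<one> (?G x) \<boxtimes> F0 G)"
        using F2_run by (simp add: comp_fun_simps G.fun_comp')
      also have "\<dots> = FA G (FA F (Run A x) \<cdot>\<^bsub>B\<^esub> F2 F (x, Unit A) \<cdot>\<^bsub>B\<^esub> (\<one>\<^bsub>B\<^esub> (?F x) \<boxtimes>\<^bsub>B\<^esub> F0 F)) \<cdot>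
          F2 G (?F x, Unit B) \<cdot> (\<one> (?G x) \<boxtimes> F0 G)"
        using F2_run G.F2_nat'[of "\<one>\<^bsub>B\<^esub> (?F x)" "F0 F" "?F x" "Unit B", symmetric]
        by (simp add: G.fun_comp' del: G.N.ten_comp_ext G.fun_id')
      also have "\<dots> = q"
        using F2_run by (simp add: F.F2_run' G.F2_run' comp_fun_simps)
      finally show ?thesis .
    next
      case (F2_lun x)
      let ?F = "FO F" and ?G = "\<lambda>x. FO G (FO F x)"
      have "p = FA G (FA F (Lun A x) \<cdot>\<^bsub>B\<^esub> F2 F (Unit A, x)) \<cdot>
          (F2 G (?F (Unit A), ?F x) \<cdot> (FA G (F0 F) \<boxtimes> FA G (\<one>\<^bsub>B\<^esub> (?F x)))) \<cdot> (F0 G \<boxtimes> \<one> (?G x))"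
        using F2_lun by (simp add: comp_fun_simps G.fun_comp')
      also have "\<dots> = FA G (FA F (Lun A x) \<cdot>\<^bsub>B\<^esub> F2 F (Unit A, x) \<cdot>\<^bsub>B\<^esub> (F0 F \<boxtimes>\<^bsub>B\<^esub> \<one>\<^bsub>B\<^esub> (?F x))) \<cdot>
          F2 G (Unit B, ?F x) \<cdot> (F0 G \<boxtimes> \<one> (?G x))"
        using F2_lun G.F2_nat'[of "F0 F" "\<one>\<^bsub>B\<^esub> (?F x)" "Unit B" "?F x", symmetric]
        by (simp add: G.fun_comp' del: G.N.ten_comp_ext G.fun_id')
      also have "\<dots> = q"
        using F2_lun by (simp add: F.F2_lun' G.F2_lun' comp_fun_simps)
      finally show ?thesis .
    next
      case (F2_swap x y)
      have "p = FA G (FA F (Swap A x y) \<cdot>\<^bsub>B\<^esub> F2 F (x, y)) \<cdot> F2 G (FO F x, FO F y)"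
        using F2_swap by (simp add: comp_fun_simps G.fun_comp')
      also have "\<dots> = q"
        using F2_swap by (simp add: F.F2_swap' G.fun_comp' G.F2_swap' comp_fun_simps)
      finally show ?thesis .
    qed
  qed (use F.M.sm_category_axioms G.N.sm_category_axioms in \<open>auto simp: comp_fun_def\<close>)
qed

lemma comp_fun_assoc:
  assumes "sm_functor A B F" "sm_functor B C G" "sm_functor C D H"
  shows "comp_fun A D H (comp_fun A C G F) = comp_fun A D (comp_fun B D H G) F"
proof -
  interpret F: sm_functor A B F by fact
  interpret G: sm_functor B C G by fact
  interpret H: sm_functor C D H by fact
  show ?thesis
    by (rule smfun.equality) (auto simp: comp_fun_def H.fun_comp' intro!: restrict_ext)
qed

lemma eval_at_functor:
  assumes "sm_category A" "sm_category B" "a \<in> Obj A"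
  shows "sm_functor (hom A B) B (eval_at A B a)"
  unfolding eval_at_def
  by (intro strict_hom.strict_fun_functor hom_evaluation hom_category assms)

lemma comp_eval_at:
  assumes "sm_functor M (hom A B) F" "sm_category A" "sm_category B" "a \<in> Obj A"
  shows "comp_fun M B (eval_at A B a) F = dual_obj M F a"
proof -
  interpret F: sm_functor M "hom A B" F by fact
  interpret B: sm_category B by fact
  interpret strict_hom "hom A B" B "\<lambda>F. FO F a" "\<lambda>\<sigma>. ntMap \<sigma> a"
    using assms by (intro hom_evaluation)
  show ?thesis
    by (rule smfun.equality)
      (auto simp: comp_fun_def dual_obj_def eval_at_def strict_fun_def intro!: restrict_ext)
qed

lemma whisker_right_nat:
  fixes C (structure)
  assumes "mon_nat B C \<sigma>" "sm_functor A B H"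
  shows "mon_nat A C (whisker_right A C \<sigma> H)"
proof -
  interpret s: mon_nat B C \<sigma> by fact
  interpret H: sm_functor A B H by fact
  show ?thesis unfolding whisker_right_def
  proof (rule mon_natI)
    have "ntMap \<sigma> (FO H (Unit A)) \<cdot> FA (ntDom \<sigma>) (F0 H) \<cdot> F0 (ntDom \<sigma>) =
      FA (ntCod \<sigma>) (F0 H) \<cdot> ntMap \<sigma> (Unit B) \<cdot> F0 (ntDom \<sigma>)"
      by (rule s.F.N.comp_ext) (simp_all add: s.naturality')
    then show "ntMap \<sigma> (FO H (Unit A)) \<cdot> F0 (comp_fun A C (ntDom \<sigma>) H) = F0 (comp_fun A C (ntCod \<sigma>) H)"
      by (simp add: comp_fun_simps s.mon_unit')
  next
    fix x y assume [simp]: "x \<in> Obj A" "y \<in> Obj A"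
    let ?F2 = "F2 (ntDom \<sigma>) (FO H x, FO H y)"
    have "ntMap \<sigma> (FO H (x \<odot>\<^bsub>A\<^esub> y)) \<cdot> FA (ntDom \<sigma>) (F2 H (x, y)) \<cdot> ?F2 =
      FA (ntCod \<sigma>) (F2 H (x, y)) \<cdot> ntMap \<sigma> (FO H x \<odot>\<^bsub>B\<^esub> FO H y) \<cdot> ?F2"
      by (rule s.F.N.comp_ext) (simp_all add: s.naturality')
    then show "ntMap \<sigma> (FO H (x \<odot>\<^bsub>A\<^esub> y)) \<cdot> F2 (comp_fun A C (ntDom \<sigma>) H) (x, y) =
      F2 (comp_fun A C (ntCod \<sigma>) H) (x, y) \<cdot> (ntMap \<sigma> (FO H x) \<boxtimes> ntMap \<sigma> (FO H y))"
      by (simp add: comp_fun_simps s.mon_ten')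
  qed (use assms(2) s.F.sm_functor_axioms s.G.sm_functor_axioms in
      \<open>auto simp: Hom_iff comp_fun_simps s.naturality' intro: comp_functor\<close>)
qed

lemma whisker_left_nat:
  fixes C (structure)
  assumes "mon_nat A B \<theta>" "sm_functor B C F"
  shows "mon_nat A C (whisker_left A C F \<theta>)"
proof -
  interpret t: mon_nat A B \<theta> by fact
  interpret F: sm_functor B C F by fact
  have merge: "FA F g \<cdot> FA F f \<cdot> k = FA F (g \<cdot>\<^bsub>B\<^esub> f) \<cdot> k"
    if "f \<in> Arr B" "g \<in> Arr B" "k \<in> Arr C" "Dom B g = Cod B f" "Cod C k = FO F (Dom B f)" for f g k
    using that by (simp add: F.fun_comp')
  show ?thesis unfolding whisker_left_def
  proof (rule mon_natI)
    fix x y assume [simp]: "x \<in> Obj A" "y \<in> Obj A"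
    show "FA F (ntMap \<theta> (x \<odot>\<^bsub>A\<^esub> y)) \<cdot> F2 (comp_fun A C F (ntDom \<theta>)) (x, y) =
      F2 (comp_fun A C F (ntCod \<theta>)) (x, y) \<cdot> (FA F (ntMap \<theta> x) \<boxtimes> FA F (ntMap \<theta> y))"
      by (simp add: comp_fun_simps merge t.mon_ten') (simp add: F.fun_comp' F.F2_nat')
  qed (use assms(2) t.F.sm_functor_axioms t.G.sm_functor_axioms in
      \<open>auto simp: Hom_iff comp_fun_simps merge t.mon_unit' t.naturality' simp flip: F.fun_comp' intro: comp_functor\<close>)
qed

text \<open>
  Precomposition is strict with respect to the pointwise structure: pointwise operations commute with
  substitution on objects, and with the structure arrows because \<open>\<boxtimes>\<close> preserves composition.
\<close>

lemma comp_box_fun: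
  assumes "sm_functor A B F" "sm_functor B C G" "sm_functor B C H"
  shows "comp_fun A C (box_fun B C G H) F = box_fun A C (comp_fun A C G F) (comp_fun A C H F)"
proof -
  interpret F: sm_functor A B F by fact
  interpret G: sm_functor B C G by fact
  interpret H: sm_functor B C H by fact
  show ?thesis
    by (rule smfun.equality) (auto simp: comp_fun_def box_fun_def intro!: restrict_ext)
qed

lemma comp_const_fun:
  assumes "sm_functor A B F" "sm_category C"
  shows "comp_fun A C (const_fun B C) F = const_fun A C"
proof -
  interpret F: sm_functor A B F by fact
  interpret C: sm_category C by fact
  show ?thesis
    by (rule smfun.equality) (auto simp: comp_fun_def const_fun_def intro!: restrict_ext)
qed

section \<open>Postcomposition\<close>

lemma (in sm_category) interchange_exch:
  assumes "x \<in> Obj M" "y \<in> Obj M" "z \<in> Obj M" "w \<in> Obj M"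
  shows "interchange M x y z w = Ass M x z (y \<odot> w) \<cdot> (\<one> x \<boxtimes> exch y z w) \<cdot> AssInv M x y (z \<odot> w)"
  using assms by (simp add: interchange_def exch_def)

text \<open>
  A symmetric monoidal functor preserves the arrows \<open>exch\<close> and \<open>interchange\<close>, up to the comparison arrows
  \<open>F x \<otimes> (F y \<otimes> F z) \<rightarrow> F (x \<otimes> (y \<otimes> z))\<close> and \<open>(F x \<otimes> F y) \<otimes> (F z \<otimes> F w) \<rightarrow> F ((x \<otimes> y) \<otimes> (z \<otimes> w))\<close>. This
  is what makes the structure arrows of \<open>[A, F]\<close> monoidal.
\<close>

locale functor_into = sm_functor M N F
  for M :: "('o1, 'm1) smcat" and N :: "('o2, 'm2) smcat" (structure) and F
begin

lemma fun_comp_ext: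
  assumes "f \<in> Arr M" "g \<in> Arr M" "Dom M g = Cod M f" "k \<in> Arr N" "Cod N k = FO F (Dom M f)"
  shows "FA F (g \<cdot>\<^bsub>M\<^esub> f) \<cdot> k = FA F g \<cdot> FA F f \<cdot> k"
  using assms by (simp add: fun_comp')

lemma F2_id_left:
  assumes "x \<in> Obj M" "g \<in> Arr M" "y = Dom M g" "k \<in> Arr N" "Cod N k = FO F x \<odot> FO F y"
  shows "FA F (\<one>\<^bsub>M\<^esub> x \<boxtimes>\<^bsub>M\<^esub> g) \<cdot> F2 F (x, y) \<cdot> k = F2 F (x, Cod M g) \<cdot> (\<one> (FO F x) \<boxtimes> FA F g) \<cdot> k"
  using F2_nat_ext[of "\<one>\<^bsub>M\<^esub> x" g x y k] assms by simp

lemma F2_id_right: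
  assumes "x \<in> Obj M" "g \<in> Arr M" "y = Dom M g" "k \<in> Arr N" "Cod N k = FO F y \<odot> FO F x"
  shows "FA F (g \<boxtimes>\<^bsub>M\<^esub> \<one>\<^bsub>M\<^esub> x) \<cdot> F2 F (y, x) \<cdot> k = F2 F (Cod M g, x) \<cdot> (FA F g \<boxtimes> \<one> (FO F x)) \<cdot> k"
  using F2_nat_ext[of g "\<one>\<^bsub>M\<^esub> x" y x k] assms by simp

lemma F2_assinv:
  assumes [simp]: "x \<in> Obj M" "y \<in> Obj M" "z \<in> Obj M"
  shows "FA F (AssInv M x y z) \<cdot> F2 F (x \<odot>\<^bsub>M\<^esub> y, z) \<cdot> (F2 F (x, y) \<boxtimes> \<one> (FO F z)) =
    F2 F (x, y \<odot>\<^bsub>M\<^esub> z) \<cdot> (\<one> (FO F x) \<boxtimes> F2 F (y, z)) \<cdot> AssInv N (FO F x) (FO F y) (FO F z)"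
proof -
  have "FA F (AssInv M x y z) \<cdot> F2 F (x \<odot>\<^bsub>M\<^esub> y, z) \<cdot> (F2 F (x, y) \<boxtimes> \<one> (FO F z))
     = FA F (AssInv M x y z) \<cdot> (F2 F (x \<odot>\<^bsub>M\<^esub> y, z) \<cdot> (F2 F (x, y) \<boxtimes> \<one> (FO F z)) \<cdot>
        Ass N (FO F x) (FO F y) (FO F z)) \<cdot> AssInv N (FO F x) (FO F y) (FO F z)"
    by simp
  also have "\<dots> = FA F (AssInv M x y z \<cdot>\<^bsub>M\<^esub> Ass M x y z) \<cdot> F2 F (x, y \<odot>\<^bsub>M\<^esub> z) \<cdot>
      (\<one> (FO F x) \<boxtimes> F2 F (y, z)) \<cdot> AssInv N (FO F x) (FO F y) (FO F z)"
    by (subst F2_ass'[symmetric]) (simp_all add: fun_comp_ext del: M.isos)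
  finally show ?thesis by simp
qed

lemma F_exch:
  assumes [simp]: "x \<in> Obj M" "y \<in> Obj M" "z \<in> Obj M"
  shows "FA F (M.exch x y z) \<cdot> F2 F (x, y \<odot>\<^bsub>M\<^esub> z) \<cdot> (\<one> (FO F x) \<boxtimes> F2 F (y, z)) =
    F2 F (y, x \<odot>\<^bsub>M\<^esub> z) \<cdot> (\<one> (FO F y) \<boxtimes> F2 F (x, z)) \<cdot> N.exch (FO F x) (FO F y) (FO F z)"
proof -
  let ?x = "FO F x" and ?y = "FO F y" and ?z = "FO F z"
  have "FA F (M.exch x y z) \<cdot> F2 F (x, y \<odot>\<^bsub>M\<^esub> z) \<cdot> (\<one> ?x \<boxtimes> F2 F (y, z))
    = FA F (AssInv M y x z) \<cdot> FA F (Swap M x y \<boxtimes>\<^bsub>M\<^esub> \<one>\<^bsub>M\<^esub> z) \<cdot>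
      (FA F (Ass M x y z) \<cdot> F2 F (x, y \<odot>\<^bsub>M\<^esub> z) \<cdot> (\<one> ?x \<boxtimes> F2 F (y, z)))"
    by (simp add: M.exch_def fun_comp_ext)
  also have "\<dots> = FA F (AssInv M y x z) \<cdot> F2 F (y \<odot>\<^bsub>M\<^esub> x, z) \<cdot>
      ((FA F (Swap M x y) \<cdot> F2 F (x, y)) \<boxtimes> \<one> ?z) \<cdot> Ass N ?x ?y ?z"
    by (simp add: F2_ass' F2_id_right)
  also have "\<dots> = (FA F (AssInv M y x z) \<cdot> F2 F (y \<odot>\<^bsub>M\<^esub> x, z) \<cdot> (F2 F (y, x) \<boxtimes> \<one> ?z)) \<cdot>
      (Swap N ?x ?y \<boxtimes> \<one> ?z) \<cdot> Ass N ?x ?y ?z"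
    by (simp add: F2_swap')
  also have "\<dots> = F2 F (y, x \<odot>\<^bsub>M\<^esub> z) \<cdot> (\<one> ?y \<boxtimes> F2 F (x, z)) \<cdot> N.exch ?x ?y ?z"
    by (simp add: F2_assinv N.exch_def del: N.ten_comp_ext)
  finally show ?thesis .
qed

text \<open>
  With the outer brackets nested to the right, the interchange is \<open>exch\<close> in the last three factors, so
  that \<open>F_exch\<close> applies under \<open>F x \<otimes> -\<close>; the rest is compatibility with associativity.
\<close>

lemma F_interchange:
  assumes [simp]: "x \<in> Obj M" "y \<in> Obj M" "z \<in> Obj M" "w \<in> Obj M"
  shows "FA F (interchange M x y z w) \<cdot> F2 F (x \<odot>\<^bsub>M\<^esub> y, z \<odot>\<^bsub>M\<^esub> w) \<cdot> (F2 F (x, y) \<boxtimes> F2 F (z, w)) =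
    F2 F (x \<odot>\<^bsub>M\<^esub> z, y \<odot>\<^bsub>M\<^esub> w) \<cdot> (F2 F (x, z) \<boxtimes> F2 F (y, w)) \<cdot> interchange N (FO F x) (FO F y) (FO F z) (FO F w)"
proof -
  let ?x = "FO F x" and ?y = "FO F y" and ?z = "FO F z" and ?w = "FO F w"
  let ?e = "\<one> ?x"
  have "FA F (interchange M x y z w) \<cdot> F2 F (x \<odot>\<^bsub>M\<^esub> y, z \<odot>\<^bsub>M\<^esub> w) \<cdot> (F2 F (x, y) \<boxtimes> F2 F (z, w))
    = FA F (Ass M x z (y \<odot>\<^bsub>M\<^esub> w)) \<cdot> FA F (\<one>\<^bsub>M\<^esub> x \<boxtimes>\<^bsub>M\<^esub> M.exch y z w) \<cdot>
      (FA F (AssInv M x y (z \<odot>\<^bsub>M\<^esub> w)) \<cdot> F2 F (x \<odot>\<^bsub>M\<^esub> y, z \<odot>\<^bsub>M\<^esub> w) \<cdot> (F2 F (x, y) \<boxtimes> \<one> (FO F (z \<odot>\<^bsub>M\<^esub> w)))) \<cdot>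
      ((?e \<boxtimes> \<one> ?y) \<boxtimes> F2 F (z, w))"
    by (simp add: M.interchange_exch fun_comp_ext)
  also have "\<dots> = FA F (Ass M x z (y \<odot>\<^bsub>M\<^esub> w)) \<cdot> (FA F (\<one>\<^bsub>M\<^esub> x \<boxtimes>\<^bsub>M\<^esub> M.exch y z w) \<cdot>
      F2 F (x, y \<odot>\<^bsub>M\<^esub> (z \<odot>\<^bsub>M\<^esub> w)) \<cdot> (?e \<boxtimes> F2 F (y, z \<odot>\<^bsub>M\<^esub> w)) \<cdot> (?e \<boxtimes> (\<one> ?y \<boxtimes> F2 F (z, w))) \<cdot>
      AssInv N ?x ?y (?z \<odot> ?w))"
    by (simp only: F2_assinv assms M.Unit_TenO_Obj) (simp add: N.assinv_nat_rev del: N.ten_id' N.ten_comp_ext N.ten_comp')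
  also have "\<dots> = FA F (Ass M x z (y \<odot>\<^bsub>M\<^esub> w)) \<cdot> F2 F (x, z \<odot>\<^bsub>M\<^esub> (y \<odot>\<^bsub>M\<^esub> w)) \<cdot>
      (?e \<boxtimes> (FA F (M.exch y z w) \<cdot> F2 F (y, z \<odot>\<^bsub>M\<^esub> w) \<cdot> (\<one> ?y \<boxtimes> F2 F (z, w)))) \<cdot>
      AssInv N ?x ?y (?z \<odot> ?w)"
    by (simp add: F2_id_left)
  also have "\<dots> = (FA F (Ass M x z (y \<odot>\<^bsub>M\<^esub> w)) \<cdot> F2 F (x, z \<odot>\<^bsub>M\<^esub> (y \<odot>\<^bsub>M\<^esub> w)) \<cdot> (?e \<boxtimes> F2 F (z, y \<odot>\<^bsub>M\<^esub> w))) \<cdot>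
      (?e \<boxtimes> (\<one> ?z \<boxtimes> F2 F (y, w))) \<cdot> (?e \<boxtimes> N.exch ?y ?z ?w) \<cdot> AssInv N ?x ?y (?z \<odot> ?w)"
    by (simp add: F_exch)
  also have "\<dots> = F2 F (x \<odot>\<^bsub>M\<^esub> z, y \<odot>\<^bsub>M\<^esub> w) \<cdot> (F2 F (x, z) \<boxtimes> \<one> (FO F (y \<odot>\<^bsub>M\<^esub> w))) \<cdot>
      ((?e \<boxtimes> \<one> ?z) \<boxtimes> F2 F (y, w)) \<cdot> Ass N ?x ?z (?y \<odot> ?w) \<cdot> (?e \<boxtimes> N.exch ?y ?z ?w) \<cdot> AssInv N ?x ?y (?z \<odot> ?w)"
    by (simp only: F2_ass' assms M.Unit_TenO_Obj) (simp add: N.nat_exts del: N.ten_id' N.ten_comp_ext N.ten_comp')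
  also have "\<dots> = F2 F (x \<odot>\<^bsub>M\<^esub> z, y \<odot>\<^bsub>M\<^esub> w) \<cdot> (F2 F (x, z) \<boxtimes> F2 F (y, w)) \<cdot> interchange N ?x ?y ?z ?w"
    by (simp add: N.interchange_exch)
  finally show ?thesis .
qed

lemma F2_units: "F2 F (Unit M, Unit M) \<cdot> (F0 F \<boxtimes> F0 F) \<cdot> RunInv N (Unit N) = FA F (RunInv M (Unit M)) \<cdot> F0 F"
proof -
  let ?I = "Unit M" and ?J = "Unit N"
  have "F2 F (?I, ?I) \<cdot> (F0 F \<boxtimes> F0 F) \<cdot> RunInv N ?J
    = FA F (RunInv M ?I) \<cdot> (FA F (Run M ?I) \<cdot> F2 F (?I, ?I) \<cdot> (\<one> (FO F ?I) \<boxtimes> F0 F)) \<cdot> (F0 F \<boxtimes> \<one> ?J) \<cdot> RunInv N ?J"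
    using fun_comp_ext[of "Run M ?I" "RunInv M ?I" "F2 F (?I, ?I) \<cdot> (F0 F \<boxtimes> F0 F) \<cdot> RunInv N ?J", symmetric] by simp
  also have "\<dots> = FA F (RunInv M ?I) \<cdot> Run N (FO F ?I) \<cdot> (F0 F \<boxtimes> \<one> ?J) \<cdot> RunInv N ?J"
    by (simp add: F2_run' del: N.ten_comp_ext)
  also have "\<dots> = FA F (RunInv M ?I) \<cdot> F0 F \<cdot> Run N ?J \<cdot> RunInv N ?J"
    using N.run_nat'[of "F0 F" ?J, THEN N.comp_ext, where k = "RunInv N ?J"] by (simp del: N.isos)
  finally show ?thesis by simp
qed

end

text \<open>
  Postcomposition with \<open>F\<close>, evaluated at \<open>a\<close>, is \<open>F\<close> after evaluation at \<open>a\<close>, hence a functor. What is left is that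
  its values and structure arrows lie in the internal hom; for the structure arrow at two functors this is the
  preservation of the interchange.
\<close>

lemma postcomp_functor:
  fixes C (structure)
  assumes A: "sm_category A" and F: "sm_functor B C F"
  shows "sm_functor (hom A B) (hom A C) (postcomp A B C F)"
proof (rule functor_into_hom)
  interpret A: sm_category A by fact
  interpret F: functor_into B C F by (intro functor_into.intro F)
  have B: "sm_category B" by (rule F.M.sm_category_axioms)
  show C: "sm_category C" by (rule F.N.sm_category_axioms)
  show AB: "sm_category (hom A B)" by (intro hom_category A F.M.sm_category_axioms)
  then interpret AB: sm_category "hom A B" .
  interpret AC: sm_category "hom A C" by (intro hom_category A F.N.sm_category_axioms)
  have merge: "FA F g \<cdot> FA F f \<cdot> k = FA F (g \<cdot>\<^bsub>B\<^esub> f) \<cdot> k"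
    if "f \<in> Arr B" "g \<in> Arr B" "k \<in> Arr C" "Dom B g = Cod B f" "Cod C k = FO F (Dom B f)" for f g k
    using that by (simp add: F.fun_comp')
  show "functor_data (hom A B) (hom A C) (postcomp A B C F)"
  proof unfold_locales
    fix H assume "H \<in> Obj (hom A B)"
    then show "FO (postcomp A B C F) H \<in> Obj (hom A C)"
      by (simp add: postcomp_def hom_simps comp_functor[OF _ F])
  next
    fix \<theta> assume t: "\<theta> \<in> Arr (hom A B)"
    show "FA (postcomp A B C F) \<theta> \<in> Hom (hom A C) (FO (postcomp A B C F) (Dom (hom A B) \<theta>)) (FO (postcomp A B C F) (Cod (hom A B) \<theta>))"
      using t AB.Dom_Obj[OF t] AB.Cod_Obj[OF t] whisker_left_nat[OF _ F]
      by (simp add: postcomp_def Hom_iff hom_simps whisker_left_def)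
  next
    have "mon_nat A C (F0 (postcomp A B C F))" unfolding postcomp_def smfun.select_convs hom_simps
    proof (rule mon_natI)
      fix x y assume [simp]: "x \<in> Obj A" "y \<in> Obj A"
      let ?I = "Unit B" and ?J = "Unit C"
      have "F0 F \<cdot> Run C ?J = Run C (FO F ?I) \<cdot> (F0 F \<boxtimes> \<one> ?J)"
        by (simp add: F.N.run_nat')
      also have "\<dots> = (FA F (Run B ?I) \<cdot> F2 F (?I, ?I) \<cdot> (\<one> (FO F ?I) \<boxtimes> F0 F)) \<cdot> (F0 F \<boxtimes> \<one> ?J)"
        by (simp only: F.F2_run' F.M.Unit_TenO_Obj)
      also have "\<dots> = FA F (Run B ?I) \<cdot> F2 F (?I, ?I) \<cdot> (F0 F \<boxtimes> F0 F)" by simp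
      finally show "F0 F \<cdot> F2 (const_fun A C) (x, y) = F2 (comp_fun A C F (const_fun A B)) (x, y) \<cdot> (F0 F \<boxtimes> F0 F)"
        by (simp add: const_fun_simps comp_fun_simps)
    qed (use A B C F in \<open>auto simp: Hom_iff comp_fun_simps const_fun_simps intro: const_functor comp_functor\<close>)
    then show "F0 (postcomp A B C F) \<in> Hom (hom A C) (Unit (hom A C)) (FO (postcomp A B C F) (Unit (hom A B)))"
      using const_functor[OF A B] by (simp add: Hom_iff postcomp_def hom_simps)
  next
    fix H K assume "H \<in> Obj (hom A B)" "K \<in> Obj (hom A B)"
    then have HK: "sm_functor A B H" "sm_functor A B K" by (simp_all add: hom_simps)
    interpret H: sm_functor A B H by fact
    interpret K: sm_functor A B K by fact
    have "mon_nat A C \<lparr> ntDom = box_fun A C (comp_fun A C F H) (comp_fun A C F K), ntCod = comp_fun A C F (box_fun A B H K),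
       ntMap = \<lambda>a\<in>Obj A. F2 F (FO H a, FO K a) \<rparr>"
    proof (rule mon_natI)
      fix f assume [simp]: "f \<in> Arr A"
      show "FA (comp_fun A C F (box_fun A B H K)) f \<cdot> F2 F (FO H (Dom A f), FO K (Dom A f)) =
        F2 F (FO H (Cod A f), FO K (Cod A f)) \<cdot> FA (box_fun A C (comp_fun A C F H) (comp_fun A C F K)) f"
        by (simp add: comp_fun_simps box_fun_simps F.F2_nat')
    next
      let ?I = "Unit A"
      have "F2 F (FO H ?I, FO K ?I) \<cdot> F0 (box_fun A C (comp_fun A C F H) (comp_fun A C F K)) =
        (F2 F (FO H ?I, FO K ?I) \<cdot> (FA F (F0 H) \<boxtimes> FA F (F0 K))) \<cdot> (F0 F \<boxtimes> F0 F) \<cdot> RunInv C (Unit C)"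
        by (simp add: comp_fun_simps box_fun_simps)
      also have "\<dots> = FA F (F0 H \<boxtimes>\<^bsub>B\<^esub> F0 K) \<cdot> (F2 F (Unit B, Unit B) \<cdot> (F0 F \<boxtimes> F0 F) \<cdot> RunInv C (Unit C))"
        by (simp add: F.F2_nat_ext)
      also have "\<dots> = F0 (comp_fun A C F (box_fun A B H K))"
        by (simp add: F.F2_units merge comp_fun_simps box_fun_simps del: F.N.comp_assoc')
      finally show "F2 F (FO H ?I, FO K ?I) \<cdot> F0 (box_fun A C (comp_fun A C F H) (comp_fun A C F K)) =
        F0 (comp_fun A C F (box_fun A B H K))" .
    next
      fix x y assume [simp]: "x \<in> Obj A" "y \<in> Obj A"
      let ?i = "interchange C (FO F (FO H x)) (FO F (FO K x)) (FO F (FO H y)) (FO F (FO K y))"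
      have "F2 F (FO H (x \<odot>\<^bsub>A\<^esub> y), FO K (x \<odot>\<^bsub>A\<^esub> y)) \<cdot> F2 (box_fun A C (comp_fun A C F H) (comp_fun A C F K)) (x, y) =
        F2 F (FO H (x \<odot>\<^bsub>A\<^esub> y), FO K (x \<odot>\<^bsub>A\<^esub> y)) \<cdot> (FA F (F2 H (x, y)) \<boxtimes> FA F (F2 K (x, y))) \<cdot>
          (F2 F (FO H x, FO H y) \<boxtimes> F2 F (FO K x, FO K y)) \<cdot> ?i"
        by (simp add: comp_fun_simps box_fun_simps)
      also have "\<dots> = FA F (F2 H (x, y) \<boxtimes>\<^bsub>B\<^esub> F2 K (x, y)) \<cdot>
          (F2 F (FO H x \<odot>\<^bsub>B\<^esub> FO H y, FO K x \<odot>\<^bsub>B\<^esub> FO K y) \<cdot> (F2 F (FO H x, FO H y) \<boxtimes> F2 F (FO K x, FO K y)) \<cdot> ?i)"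
        by (simp add: F.F2_nat_ext)
      also have "\<dots> = F2 (comp_fun A C F (box_fun A B H K)) (x, y) \<cdot> (F2 F (FO H x, FO K x) \<boxtimes> F2 F (FO H y, FO K y))"
        by (simp add: F.F_interchange[symmetric] F.fun_comp' comp_fun_simps box_fun_simps)
      finally show "F2 F (FO H (x \<odot>\<^bsub>A\<^esub> y), FO K (x \<odot>\<^bsub>A\<^esub> y)) \<cdot> F2 (box_fun A C (comp_fun A C F H) (comp_fun A C F K)) (x, y) =
        F2 (comp_fun A C F (box_fun A B H K)) (x, y) \<cdot> (F2 F (FO H x, FO K x) \<boxtimes> F2 F (FO H y, FO K y))" .
    qed (use HK F in \<open>auto simp: Hom_iff comp_fun_simps box_fun_simps intro: box_functor comp_functor\<close>)
    then show "F2 (postcomp A B C F) (H, K) \<in> Hom (hom A C) (FO (postcomp A B C F) H \<odot>\<^bsub>hom A C\<^esub> FO (postcomp A B C F) K)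
        (FO (postcomp A B C F) (H \<odot>\<^bsub>hom A B\<^esub> K))"
      using HK box_functor[OF HK] by (simp add: Hom_iff postcomp_def hom_simps)
  qed
  fix a assume a: "a \<in> Obj A"
  \<comment> \<open>At each object, postcomposition with \<open>F\<close> is \<open>F\<close> after evaluation.\<close>
  have "dual_obj (hom A B) (postcomp A B C F) a = comp_fun (hom A B) C F (eval_at A B a)"
    by (rule smfun.equality)
      (use a const_functor[OF A B] in \<open>auto simp: dual_obj_def postcomp_def comp_fun_def eval_at_def strict_fun_def whisker_left_def
        hom_simps const_fun_simps sm_functor.FO_in intro!: restrict_ext\<close>)
  then show "sm_functor (hom A B) C (dual_obj (hom A B) (postcomp A B C F) a)"
    using comp_functor[OF eval_at_functor[OF A B a] F] by simp
qed (use assms in \<open>auto simp: postcomp_def\<close>)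

section \<open>Functors into an internal hom, and \<open>Rn\<close>\<close>

text \<open>
  Arrows and structure arrows of a functor into an internal hom are transformations, hence determined by their
  components, and those are recorded by the functors \<open>dual_obj\<close>.
\<close>

lemma functor_hom_eqI:
  assumes "sm_functor M (hom A B) P" "sm_functor M (hom A B) Q"
    and FO_eq: "\<And>x. x \<in> Obj M \<Longrightarrow> FO P x = FO Q x"
    and dual_eq: "\<And>a. a \<in> Obj A \<Longrightarrow> dual_obj M P a = dual_obj M Q a"
  shows "P = Q"
proof -
  interpret P: sm_functor M "hom A B" P by fact
  interpret Q: sm_functor M "hom A B" Q by fact
  have FA: "FA P f = FA Q f" if [simp]: "f \<in> Arr M" for f
  proof (rule mnt_eqI)
    show "parallel (hom A B) (FA P f) (FA Q f)" by (simp add: parallel_def FO_eq)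
    fix a assume "a \<in> Obj A"
    from arg_cong[OF dual_eq[OF this], of "\<lambda>H. FA H f"] show "ntMap (FA P f) a = ntMap (FA Q f) a"
      by (simp add: dual_obj_def)
  qed
  have F0: "F0 P = F0 Q"
  proof (rule mnt_eqI)
    show "parallel (hom A B) (F0 P) (F0 Q)" by (simp add: parallel_def FO_eq)
    fix a assume "a \<in> Obj A"
    from arg_cong[OF dual_eq[OF this], of F0] show "ntMap (F0 P) a = ntMap (F0 Q) a"
      by (simp add: dual_obj_def)
  qed
  have F2: "F2 P (x, y) = F2 Q (x, y)" if [simp]: "x \<in> Obj M" "y \<in> Obj M" for x y
  proof (rule mnt_eqI)
    show "parallel (hom A B) (F2 P (x, y)) (F2 Q (x, y))" by (simp add: parallel_def FO_eq)
    fix a assume "a \<in> Obj A"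
    from arg_cong[OF dual_eq[OF this], of "\<lambda>H. F2 H (x, y)"] show "ntMap (F2 P (x, y)) a = ntMap (F2 Q (x, y)) a"
      by (simp add: dual_obj_def)
  qed
  show ?thesis
  proof (rule smfun.equality)
    show "FO P = FO Q" by (rule extensionalityI[OF P.FO_ext Q.FO_ext FO_eq])
    show "FA P = FA Q" by (rule extensionalityI[OF P.FA_ext Q.FA_ext FA])
    show "F2 P = F2 Q" by (rule extensionalityI[OF P.F2_ext Q.F2_ext]) (auto simp: F2)
  qed (simp_all add: F0)
qed

lemma dual_obj_box:
  assumes "sm_functor M (hom A B) P" "sm_functor M (hom A B) Q" "sm_category A" "sm_category B" "a \<in> Obj A"
  shows "dual_obj M (box_fun M (hom A B) P Q) a = box_fun M B (dual_obj M P a) (dual_obj M Q a)"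
proof -
  interpret P: sm_functor M "hom A B" P by fact
  interpret Q: sm_functor M "hom A B" Q by fact
  interpret strict_hom "hom A B" B "\<lambda>F. FO F a" "\<lambda>\<sigma>. ntMap \<sigma> a"
    using assms by (intro hom_evaluation)
  show ?thesis
    by (rule smfun.equality) (auto simp: dual_obj_def box_fun_def intro!: restrict_ext)
qed

lemma dual_obj_const:
  assumes "sm_category M" "sm_category A" "sm_category B" "a \<in> Obj A"
  shows "dual_obj M (const_fun M (hom A B)) a = const_fun M B"
proof -
  interpret M: sm_category M by fact
  interpret strict_hom "hom A B" B "\<lambda>F. FO F a" "\<lambda>\<sigma>. ntMap \<sigma> a"
    using assms by (intro hom_evaluation)
  show ?thesis
    by (rule smfun.equality) (auto simp: dual_obj_def const_fun_def intro!: restrict_ext)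
qed

text \<open>
  The functor \<open>F \<mapsto> [B, F] \<circ> E\<close> for a fixed \<open>E : A \<rightarrow> [B, T]\<close>; for \<open>E = \<eta>\<close> this is \<open>Rn\<close>.
\<close>

locale into_hom = A: sm_category A + B: sm_category B + T: sm_category T + C: sm_category C +
    E: sm_functor A "hom B T" E
  for A :: "('a1, 'm1) smcat" and B :: "('a2, 'm2) smcat" and T :: "('a3, 'm3) smcat" and C :: "('a4, 'm4) smcat"
    and E
begin

definition after :: "('a3, 'm3, 'a4, 'm4) smfun \<Rightarrow> _" where
  "after F = comp_fun A (hom B C) (postcomp B T C F) E"

definition after_nt where
  "after_nt \<sigma> = whisker_right A (hom B C) (postcomp_nt B T C \<sigma>) E"

lemma E_functor: "a \<in> Obj A \<Longrightarrow> sm_functor B T (FO E a)"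
  using E.FO_Obj[of a] by (simp add: hom_simps)

lemma after_functor:
  assumes "sm_functor T C F"
  shows "sm_functor A (hom B C) (after F)"
  unfolding after_def
  by (rule comp_functor[OF E.sm_functor_axioms postcomp_functor[OF B.sm_category_axioms assms]])

lemma FO_after: "a \<in> Obj A \<Longrightarrow> FO (after F) a = comp_fun B C F (FO E a)"
  by (simp add: after_def comp_fun_simps) (simp add: postcomp_def)

text \<open>
  With the second argument fixed, \<open>[B, F] \<circ> E\<close> is plain composition with \<open>F\<close>. This reduces the strictness of
  \<open>after\<close> to that of precomposition.
\<close>

lemma dual_obj_after:
  assumes "sm_functor T C F" "b \<in> Obj B"
  shows "dual_obj A (after F) b = comp_fun A C F (dual_obj A E b)"
proof -
  interpret F: sm_functor T C F by fact
  interpret D: sm_functor A T "dual_obj A E b"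
    by (rule dual_obj_functor[OF E.sm_functor_axioms B.sm_category_axioms T.sm_category_axioms assms(2)])
  interpret evT: strict_hom "hom B T" T "\<lambda>F. FO F b" "\<lambda>\<sigma>. ntMap \<sigma> b"
    by (intro hom_evaluation B.sm_category_axioms T.sm_category_axioms assms(2))
  show ?thesis
    by (rule smfun.equality)
      (use assms(2) in \<open>auto simp: dual_obj_def after_def comp_fun_def postcomp_def whisker_left_def
        hom_simps[where A = B and B = C] intro!: restrict_ext\<close>)
qed

lemma after_box:
  assumes "sm_functor T C F" "sm_functor T C G"
  shows "after (box_fun T C F G) = box_fun A (hom B C) (after F) (after G)"
proof (rule functor_hom_eqI)
  show "sm_functor A (hom B C) (after (box_fun T C F G))" "sm_functor A (hom B C) (box_fun A (hom B C) (after F) (after G))"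
    by (simp_all add: after_functor box_functor assms)
  fix a assume "a \<in> Obj A"
  then show "FO (after (box_fun T C F G)) a = FO (box_fun A (hom B C) (after F) (after G)) a"
    by (simp add: FO_after box_fun_simps hom_simps comp_box_fun[OF E_functor] assms)
next
  fix b assume b: "b \<in> Obj B"
  have "sm_functor A T (dual_obj A E b)"
    by (rule dual_obj_functor[OF E.sm_functor_axioms B.sm_category_axioms T.sm_category_axioms b])
  then show "dual_obj A (after (box_fun T C F G)) b = dual_obj A (box_fun A (hom B C) (after F) (after G)) b"
    using b by (simp add: dual_obj_after box_functor assms comp_box_fun dual_obj_box after_functor
        B.sm_category_axioms C.sm_category_axioms)
qed

lemma after_const: "after (const_fun T C) = const_fun A (hom B C)"
proof (rule functor_hom_eqI)
  have c: "sm_functor T C (const_fun T C)" by (intro const_functor T.sm_category_axioms C.sm_category_axioms)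
  show "sm_functor A (hom B C) (after (const_fun T C))" "sm_functor A (hom B C) (const_fun A (hom B C))"
    by (simp_all add: after_functor c const_functor hom_category A.sm_category_axioms B.sm_category_axioms C.sm_category_axioms)
  fix a assume "a \<in> Obj A"
  then show "FO (after (const_fun T C)) a = FO (const_fun A (hom B C)) a"
    by (simp add: FO_after const_fun_simps hom_simps comp_const_fun[OF E_functor] C.sm_category_axioms)
next
  have c: "sm_functor T C (const_fun T C)" by (intro const_functor T.sm_category_axioms C.sm_category_axioms)
  fix b assume b: "b \<in> Obj B"
  have "sm_functor A T (dual_obj A E b)"
    by (rule dual_obj_functor[OF E.sm_functor_axioms B.sm_category_axioms T.sm_category_axioms b])
  then show "dual_obj A (after (const_fun T C)) b = dual_obj A (const_fun A (hom B C)) b"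
    using b by (simp add: dual_obj_after c comp_const_fun dual_obj_const
        A.sm_category_axioms B.sm_category_axioms C.sm_category_axioms)
qed

lemma after_strict_hom: "strict_hom (hom T C) (hom A (hom B C)) after after_nt"
proof -
  note cats = A.sm_category_axioms B.sm_category_axioms T.sm_category_axioms C.sm_category_axioms
  interpret HT: sm_data "hom T C" by (intro hom_data cats)
  interpret HA: sm_data "hom A (hom B C)" by (intro hom_data hom_category cats)
  have after_nt: "after_nt \<sigma> = \<lparr> ntDom = after (ntDom \<sigma>), ntCod = after (ntCod \<sigma>),
     ntMap = (\<lambda>a\<in>Obj A. whisker_right B C \<sigma> (FO E a)) \<rparr>" for \<sigma>
    by (auto simp: after_nt_def whisker_right_def[of A] after_def postcomp_nt_def intro!: restrict_ext)
  have [simp]: "FO (FO E a) b \<in> Obj T" if "a \<in> Obj A" "b \<in> Obj B" for a b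
    using E_functor[OF that(1)] that(2) by (rule sm_functor.FO_in)
  note simps = hom_simps after_nt after_box after_const FO_after whisker_right_def comp_fun_simps
    comp_box_fun[OF E_functor] comp_const_fun[OF E_functor] box_functor const_functor cats
  show ?thesis
  proof unfold_locales
    fix \<sigma> assume "\<sigma> \<in> Arr (hom T C)"
    then have \<sigma>: "mon_nat T C \<sigma>" by (simp add: hom_simps)
    interpret \<sigma>: mon_nat T C \<sigma> by fact
    have "mon_nat A (hom B C) (after_nt \<sigma>)" unfolding after_nt
    proof (rule mon_nat_into_hom)
      fix b assume b: "b \<in> Obj B"
      have "mon_nat A C (whisker_right A C \<sigma> (dual_obj A E b))"
        by (intro whisker_right_nat[OF \<sigma>] dual_obj_functor[OF E.sm_functor_axioms] cats b)
      moreover have "(\<lambda>a\<in>Obj A. ntMap (whisker_right B C \<sigma> (FO E a)) b) = (\<lambda>a\<in>Obj A. ntMap \<sigma> (FO (dual_obj A E b) a))"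
        using b by (auto simp: whisker_right_def dual_obj_def intro!: restrict_ext)
      ultimately show "mon_nat A C \<lparr> ntDom = dual_obj A (after (ntDom \<sigma>)) b, ntCod = dual_obj A (after (ntCod \<sigma>)) b,
         ntMap = (\<lambda>a\<in>Obj A. ntMap (whisker_right B C \<sigma> (FO E a)) b) \<rparr>"
        by (simp add: dual_obj_after b \<sigma>.F.sm_functor_axioms \<sigma>.G.sm_functor_axioms whisker_right_def)
    next
      fix a assume "a \<in> Obj A"
      then show "whisker_right B C \<sigma> (FO E a) \<in> Hom (hom B C) (FO (after (ntDom \<sigma>)) a) (FO (after (ntCod \<sigma>)) a)"
        using whisker_right_nat[OF \<sigma> E_functor] by (simp add: Hom_iff hom_simps FO_after) (simp add: whisker_right_def)
    qed (simp_all add: after_functor \<sigma>.F.sm_functor_axioms \<sigma>.G.sm_functor_axioms cats)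
    then show "after_nt \<sigma> \<in> Arr (hom A (hom B C))" by (simp add: hom_simps)
  next
    fix F assume F: "F \<in> Obj (hom T C)"
    show "after F \<in> Obj (hom A (hom B C))"
      using F by (simp add: hom_simps after_functor)
    show "after_nt (\<one>\<^bsub>hom T C\<^esub> F) = \<one>\<^bsub>hom A (hom B C)\<^esub> (after F)"
      "after_nt (Run (hom T C) F) = Run (hom A (hom B C)) (after F)"
      "after_nt (RunInv (hom T C) F) = RunInv (hom A (hom B C)) (after F)"
      "after_nt (Lun (hom T C) F) = Lun (hom A (hom B C)) (after F)"
      "after_nt (LunInv (hom T C) F) = LunInv (hom A (hom B C)) (after F)"
      using F by (auto simp: simps const_fun_simps intro!: restrict_ext)
    fix G assume G: "G \<in> Obj (hom T C)"
    show "after (F \<odot>\<^bsub>hom T C\<^esub> G) = after F \<odot>\<^bsub>hom A (hom B C)\<^esub> after G"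
      "after_nt (Swap (hom T C) F G) = Swap (hom A (hom B C)) (after F) (after G)"
      using F G by (auto simp: simps intro!: restrict_ext)
    fix H assume "H \<in> Obj (hom T C)"
    then show "after_nt (Ass (hom T C) F G H) = Ass (hom A (hom B C)) (after F) (after G) (after H)"
      "after_nt (AssInv (hom T C) F G H) = AssInv (hom A (hom B C)) (after F) (after G) (after H)"
      using F G by (auto simp: simps intro!: restrict_ext)
  next
    fix \<sigma> \<tau> assume "\<sigma> \<in> Arr (hom T C)" "\<tau> \<in> Arr (hom T C)"
    then show "after_nt (\<sigma> \<boxtimes>\<^bsub>hom T C\<^esub> \<tau>) = after_nt \<sigma> \<boxtimes>\<^bsub>hom A (hom B C)\<^esub> after_nt \<tau>"
      by (auto simp: simps mon_nat.axioms intro!: restrict_ext)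
  next
    fix \<sigma> \<tau> assume "\<sigma> \<in> Arr (hom T C)" "\<tau> \<in> Arr (hom T C)"
    then show "after_nt (\<tau> \<cdot>\<^bsub>hom T C\<^esub> \<sigma>) = after_nt \<tau> \<cdot>\<^bsub>hom A (hom B C)\<^esub> after_nt \<sigma>"
      by (auto simp: simps intro!: restrict_ext)
  qed (auto simp: simps)
qed

end

section \<open>The tensor and the functor \<open>\<eta>\<close>\<close>

lemma tensor_sig_simps:
  "sObj (tensor_sig A B) = Obj A \<times> Obj B" "sDom (tensor_sig A B) = tgen_dom A B" "sCod (tensor_sig A B) = tgen_cod A B"
  "Alpha b \<in> sArr (tensor_sig A B) \<longleftrightarrow> b \<in> Obj B" "Beta a \<in> sArr (tensor_sig A B) \<longleftrightarrow> a \<in> Obj A"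
  "Gamma a a' b \<in> sArr (tensor_sig A B) \<longleftrightarrow> a \<in> Obj A \<and> a' \<in> Obj A \<and> b \<in> Obj B"
  "Delta a b b' \<in> sArr (tensor_sig A B) \<longleftrightarrow> a \<in> Obj A \<and> b \<in> Obj B \<and> b' \<in> Obj B"
  "ObjArr a g \<in> sArr (tensor_sig A B) \<longleftrightarrow> a \<in> Obj A \<and> g \<in> Arr B"
  "ArrObj f b \<in> sArr (tensor_sig A B) \<longleftrightarrow> f \<in> Arr A \<and> b \<in> Obj B"
  by (auto simp: tensor_sig_def)

lemma formal_simps:
  "FO (formal_left a) b = WGen (a, b)" "FA (formal_left a) g = TGen (ObjArr a g)"
  "F0 (formal_left a) = TGen (Beta a)" "F2 (formal_left a) (b, b') = TGen (Delta a b b')"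
  "FO (formal_right b) a = WGen (a, b)" "FA (formal_right b) f = TGen (ArrObj f b)"
  "F0 (formal_right b) = TGen (Alpha b)" "F2 (formal_right b) (a, a') = TGen (Gamma a a' b)"
  by (simp_all add: formal_left_def formal_right_def)

text \<open>
  All relations of the tensor are instances of \<open>functor_eq\<close> and \<open>mnat_eq\<close> for the formal functors, or
  say that the structure arrows of \<open>\<eta>\<close> are monoidal transformations. So \<open>\<eta>\<close> is a functor by lifting along the quotient
  map.
\<close>

locale smc_pair = A: sm_category A + B: sm_category B
  for A :: "('oa, 'ma) smcat" and B :: "('ob, 'mb) smcat"
begin

abbreviation "sig \<equiv> tensor_sig A B"
abbreviation "TA \<equiv> term_alg (tensor_sig A B)"

sublocale signature "tensor_sig A B"
proof
  fix e assume "e \<in> sArr sig"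
  then show "sDom sig e \<in> fwords sig" "sCod sig e \<in> fwords sig"
    by (cases e; simp add: tensor_sig_simps)+
qed

lemma gen_typing [simp]:
  "TGen e \<in> Arr TA \<longleftrightarrow> e \<in> sArr sig" "Dom TA (TGen e) = tgen_dom A B e" "Cod TA (TGen e) = tgen_cod A B e"
  by (simp_all add: term_alg_simps tensor_sig_simps)

lemma word_typing [simp]: "WGen (a, b) \<in> Obj TA \<longleftrightarrow> a \<in> Obj A \<and> b \<in> Obj B"
  by (simp add: term_alg_simps tensor_sig_simps)

lemma formal_left_data: "a \<in> Obj A \<Longrightarrow> functor_data B TA (formal_left a)"
  by unfold_locales (auto simp: formal_simps Hom_iff tensor_sig_simps term_alg_simps)

lemma formal_right_data: "b \<in> Obj B \<Longrightarrow> functor_data A TA (formal_right b)"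
  by unfold_locales (auto simp: formal_simps Hom_iff tensor_sig_simps term_alg_simps)

sublocale presentation "tensor_sig A B" "tensor_eq A B"
proof
  fix t u assume "tensor_eq A B t u"
  then show "parallel TA t u"
  proof cases
    case (left_functor a)
    then show ?thesis using functor_data.functor_eq_parallel[OF formal_left_data] by blast
  next
    case (right_functor b)
    then show ?thesis using functor_data.functor_eq_parallel[OF formal_right_data] by blast
  next
    case (left_mnat f a a')
    then show ?thesis
      by (intro functor_data.mnat_eq_parallel[OF formal_left_data _ formal_left_data])
        (auto simp: Hom_iff formal_simps tensor_sig_simps)
  next
    case (right_mnat g b b')
    then show ?thesis
      by (intro functor_data.mnat_eq_parallel[OF formal_right_data _ formal_right_data])
        (auto simp: Hom_iff formal_simps tensor_sig_simps)
  qed (auto simp: parallel_def term_alg_simps term_alg_TenA tensor_sig_simps interchange_def)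
qed

lemma tensor_presented: "A \<otimes> B = presented sig (tensor_eq A B)"
  by (simp add: tensor_def)

lemma tensor_category: "sm_category (A \<otimes> B)"
  unfolding tensor_presented by (rule presented_category)

sublocale AB: sm_category "A \<otimes> B"
  by (rule tensor_category)

sublocale cl: strict_hom TA "A \<otimes> B" "\<lambda>X. X" "fclass (tensor_sig A B) (tensor_eq A B)"
  unfolding tensor_presented by (rule cl_strict_hom)

lemma Obj_tensor: "Obj (A \<otimes> B) = fwords sig"
  by (simp add: tensor_presented presented_simps)

lemma tensor_words: "WUnit = Unit (A \<otimes> B)" "WTen X Y = X \<odot>\<^bsub>A \<otimes> B\<^esub> Y"
  by (simp_all add: tensor_presented presented_simps)

lemma tensor_words_Obj [simp]: "Unit (A \<otimes> B) \<in> Obj TA"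
  "X \<in> Obj TA \<Longrightarrow> Y \<in> Obj TA \<Longrightarrow> X \<odot>\<^bsub>A \<otimes> B\<^esub> Y \<in> Obj TA"
  by (simp_all add: tensor_presented presented_simps term_alg_simps)

lemma eta_obj_simps:
  "b \<in> Obj B \<Longrightarrow> FO (eta_obj A B a) b = WGen (a, b)" "g \<in> Arr B \<Longrightarrow> FA (eta_obj A B a) g = tgen_class A B (ObjArr a g)"
  "F0 (eta_obj A B a) = tgen_class A B (Beta a)"
  "b \<in> Obj B \<Longrightarrow> b' \<in> Obj B \<Longrightarrow> F2 (eta_obj A B a) (b, b') = tgen_class A B (Delta a b b')"
  by (simp_all add: eta_obj_def)

lemma eta_simps:
  "a \<in> Obj A \<Longrightarrow> FO (eta A B) a = eta_obj A B a"
  "f \<in> Arr A \<Longrightarrow> b \<in> Obj B \<Longrightarrow> ntMap (FA (eta A B) f) b = tgen_class A B (ArrObj f b)"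
  "b \<in> Obj B \<Longrightarrow> ntMap (F0 (eta A B)) b = tgen_class A B (Alpha b)"
  "a \<in> Obj A \<Longrightarrow> a' \<in> Obj A \<Longrightarrow> b \<in> Obj B \<Longrightarrow> ntMap (F2 (eta A B) (a, a')) b = tgen_class A B (Gamma a a' b)"
  by (simp_all add: eta_def)

lemma left_image: "a \<in> Obj A \<Longrightarrow> cl.is_image B (formal_left a) (eta_obj A B a)"
  by (simp add: cl.is_image_def formal_simps eta_obj_simps)

lemma right_image: "b \<in> Obj B \<Longrightarrow> cl.is_image A (formal_right b) (dual_obj A (eta A B) b)"
  by (simp add: cl.is_image_def formal_simps eta_simps dual_obj_def eta_obj_simps)

lemma eta_obj_functor:
  assumes a: "a \<in> Obj A"
  shows "sm_functor B (A \<otimes> B) (eta_obj A B a)"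
proof (rule sm_functorI)
  show "functor_data B (A \<otimes> B) (eta_obj A B a)"
    by (rule cl.image_functor_data[OF left_image formal_left_data]) fact+
  fix p q assume "functor_eq B (A \<otimes> B) (eta_obj A B a) p q"
  then obtain t u where "functor_eq B TA (formal_left a) t u" "p = cl t" "q = cl u"
    by (rule cl.functor_eq_lift[OF left_image[OF a] formal_left_data[OF a]])
  then show "p = q" using relation_cl[OF tensor_eq.left_functor[OF a]] by simp
qed (auto simp: eta_obj_def B.sm_category_axioms AB.sm_category_axioms)

lemma eta_right_functor:
  assumes b: "b \<in> Obj B"
  shows "sm_functor A (A \<otimes> B) (dual_obj A (eta A B) b)"
proof (rule sm_functorI)
  show "functor_data A (A \<otimes> B) (dual_obj A (eta A B) b)"
    by (rule cl.image_functor_data[OF right_image formal_right_data]) fact+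
  fix p q assume "functor_eq A (A \<otimes> B) (dual_obj A (eta A B) b) p q"
  then obtain t u where "functor_eq A TA (formal_right b) t u" "p = cl t" "q = cl u"
    by (rule cl.functor_eq_lift[OF right_image[OF b] formal_right_data[OF b]])
  then show "p = q" using relation_cl[OF tensor_eq.right_functor[OF b]] by simp
qed (auto simp: dual_obj_def A.sm_category_axioms AB.sm_category_axioms)

lemma relation_right_mnat:
  assumes g: "g \<in> Arr B"
    and "mnat_eq A (A \<otimes> B) (dual_obj A (eta A B) (Dom B g)) (dual_obj A (eta A B) (Cod B g)) (\<lambda>a. tgen_class A B (ObjArr a g)) p q"
  shows "p = q"
proof -
  have b: "Dom B g \<in> Obj B" "Cod B g \<in> Obj B" using g by auto
  have "\<And>a. a \<in> Obj A \<Longrightarrow> TGen (ObjArr a g) \<in> Hom TA (FO (formal_right (Dom B g)) a) (FO (formal_right (Cod B g)) a)"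
    using g by (simp add: Hom_iff formal_simps tensor_sig_simps)
  then obtain t u where "mnat_eq A TA (formal_right (Dom B g)) (formal_right (Cod B g)) (\<lambda>a. TGen (ObjArr a g)) t u"
    "p = cl t" "q = cl u"
    by (rule cl.mnat_eq_lift[OF right_image[OF b(1)] formal_right_data[OF b(1)] right_image[OF b(2)] formal_right_data[OF b(2)]])
      (use assms(2) in simp_all)
  then show "p = q" using relation_cl[OF tensor_eq.right_mnat[of g B "Dom B g" "Cod B g"]] g by (simp add: Hom_iff)
qed

lemma mnat_eta_arr:
  assumes f: "f \<in> Arr A"
  shows "mon_nat B (A \<otimes> B) (FA (eta A B) f)"
proof -
  have a: "Dom A f \<in> Obj A" "Cod A f \<in> Obj A" using f by auto
  have nt [simp]: "ntDom (FA (eta A B) f) = eta_obj A B (Dom A f)" "ntCod (FA (eta A B) f) = eta_obj A B (Cod A f)"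
    using f by (simp_all add: eta_def)
  have typing: "\<And>b. b \<in> Obj B \<Longrightarrow> TGen (ArrObj f b) \<in> Hom TA (FO (formal_left (Dom A f)) b) (FO (formal_left (Cod A f)) b)"
    using f by (simp add: Hom_iff formal_simps tensor_sig_simps)
  have "p = q" if eq: "mnat_eq B (A \<otimes> B) (eta_obj A B (Dom A f)) (eta_obj A B (Cod A f)) (ntMap (FA (eta A B) f)) p q" for p q
  proof -
    obtain t u where "mnat_eq B TA (formal_left (Dom A f)) (formal_left (Cod A f)) (\<lambda>b. TGen (ArrObj f b)) t u"
      "p = cl t" "q = cl u"
      by (rule cl.mnat_eq_lift[OF left_image[OF a(1)] formal_left_data[OF a(1)] left_image[OF a(2)] formal_left_data[OF a(2)] typing _ eq])
        (use f in \<open>simp_all add: eta_simps\<close>)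
    then show "p = q" using relation_cl[OF tensor_eq.left_mnat[of f A "Dom A f" "Cod A f"]] f by (simp add: Hom_iff)
  qed
  then show ?thesis
    using f a by (intro mon_nat.intro mon_nat_axioms.intro)
      (auto simp: eta_obj_functor eta_simps Hom_iff tensor_sig_simps eta_obj_simps, simp add: eta_def)
qed

text \<open>
  Naturality in \<open>b\<close> is the compatibility of the family \<open>a \<otimes> g\<close>, indexed by \<open>a\<close>, with units; the two
  conditions of monoidality are the relations between \<open>\<alpha>\<close>, \<open>\<beta>\<close> and \<open>\<delta>\<close>.
\<close>

lemma mnat_eta_F0: "mon_nat B (A \<otimes> B) (F0 (eta A B))"
proof -
  have "mon_nat B (A \<otimes> B) \<lparr> ntDom = const_fun B (A \<otimes> B), ntCod = eta_obj A B (Unit A),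
     ntMap = (\<lambda>b\<in>Obj B. tgen_class A B (Alpha b)) \<rparr>"
  proof (rule mon_natI)
    show "sm_functor B (A \<otimes> B) (const_fun B (A \<otimes> B))"
      by (intro const_functor B.sm_category_axioms AB.sm_category_axioms)
    fix g assume g [simp]: "g \<in> Arr B"
    have "tgen_class A B (ObjArr (Unit A) g) \<cdot>\<^bsub>A \<otimes> B\<^esub> F0 (dual_obj A (eta A B) (Dom B g)) = F0 (dual_obj A (eta A B) (Cod B g))"
      by (intro relation_right_mnat[OF g] mnat_eq.mon_unit)
    then show "FA (eta_obj A B (Unit A)) g \<cdot>\<^bsub>A \<otimes> B\<^esub> tgen_class A B (Alpha (Dom B g)) =
      tgen_class A B (Alpha (Cod B g)) \<cdot>\<^bsub>A \<otimes> B\<^esub> FA (const_fun B (A \<otimes> B)) g"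
      by (simp add: eta_obj_simps dual_obj_def eta_simps const_fun_simps tensor_sig_simps tensor_words)
  next
    show "tgen_class A B (Alpha (Unit B)) \<cdot>\<^bsub>A \<otimes> B\<^esub> F0 (const_fun B (A \<otimes> B)) = F0 (eta_obj A B (Unit A))"
      using relation_cl[OF tensor_eq.beta_alpha]
      by (simp add: eta_obj_simps const_fun_simps tensor_sig_simps tensor_words)
  next
    fix x y assume xy [simp]: "x \<in> Obj B" "y \<in> Obj B"
    have "cl (TGen (Alpha (x \<odot>\<^bsub>B\<^esub> y)) \<cdot>\<^bsub>TA\<^esub> Run TA (Unit TA)) =
      cl (TGen (Delta (Unit A) x y) \<cdot>\<^bsub>TA\<^esub> (TGen (Alpha x) \<boxtimes>\<^bsub>TA\<^esub> TGen (Alpha y)))"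
      using relation_cl[OF tensor_eq.alpha_delta[OF xy]] by (simp only: term_alg_simps)
    then show "tgen_class A B (Alpha (x \<odot>\<^bsub>B\<^esub> y)) \<cdot>\<^bsub>A \<otimes> B\<^esub> F2 (const_fun B (A \<otimes> B)) (x, y) =
      F2 (eta_obj A B (Unit A)) (x, y) \<cdot>\<^bsub>A \<otimes> B\<^esub> (tgen_class A B (Alpha x) \<boxtimes>\<^bsub>A \<otimes> B\<^esub> tgen_class A B (Alpha y))"
      by (simp add: eta_obj_simps const_fun_simps tensor_sig_simps tensor_words)
  qed (auto simp: eta_obj_functor Hom_iff tensor_sig_simps eta_obj_simps const_fun_simps tensor_words)
  then show ?thesis by (simp add: eta_def hom_simps)
qed

text \<open>
  Naturality in \<open>b\<close> is the compatibility of the family \<open>a \<otimes> g\<close> with tensors, and monoidality is given by the relations of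
  \<open>\<gamma>\<close> with \<open>\<beta>\<close> and with \<open>\<delta>\<close>. The latter has an interchange on its right-hand side, whereas monoidality has the inverse
  interchange on the left.
\<close>

lemma mnat_eta_F2:
  assumes a [simp]: "a \<in> Obj A" "a' \<in> Obj A"
  shows "mon_nat B (A \<otimes> B) (F2 (eta A B) (a, a'))"
proof -
  interpret E: sm_functor B "A \<otimes> B" "eta_obj A B a" by (intro eta_obj_functor a)
  interpret E': sm_functor B "A \<otimes> B" "eta_obj A B a'" by (intro eta_obj_functor a)
  have "mon_nat B (A \<otimes> B) \<lparr> ntDom = box_fun B (A \<otimes> B) (eta_obj A B a) (eta_obj A B a'), ntCod = eta_obj A B (a \<odot>\<^bsub>A\<^esub> a'),
     ntMap = (\<lambda>b\<in>Obj B. tgen_class A B (Gamma a a' b)) \<rparr>"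
  proof (rule mon_natI)
    fix g assume g [simp]: "g \<in> Arr B"
    have "tgen_class A B (ObjArr (a \<odot>\<^bsub>A\<^esub> a') g) \<cdot>\<^bsub>A \<otimes> B\<^esub> F2 (dual_obj A (eta A B) (Dom B g)) (a, a') =
      F2 (dual_obj A (eta A B) (Cod B g)) (a, a') \<cdot>\<^bsub>A \<otimes> B\<^esub> (tgen_class A B (ObjArr a g) \<boxtimes>\<^bsub>A \<otimes> B\<^esub> tgen_class A B (ObjArr a' g))"
      by (intro relation_right_mnat[OF g] mnat_eq.mon_ten a)
    then show "FA (eta_obj A B (a \<odot>\<^bsub>A\<^esub> a')) g \<cdot>\<^bsub>A \<otimes> B\<^esub> tgen_class A B (Gamma a a' (Dom B g)) =
      tgen_class A B (Gamma a a' (Cod B g)) \<cdot>\<^bsub>A \<otimes> B\<^esub> FA (box_fun B (A \<otimes> B) (eta_obj A B a) (eta_obj A B a')) g"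
      by (simp add: eta_obj_simps dual_obj_def eta_simps box_fun_simps)
  next
    have "cl (TGen (Beta (a \<odot>\<^bsub>A\<^esub> a')) \<cdot>\<^bsub>TA\<^esub> Run TA (Unit TA)) =
      cl (TGen (Gamma a a' (Unit B)) \<cdot>\<^bsub>TA\<^esub> (TGen (Beta a) \<boxtimes>\<^bsub>TA\<^esub> TGen (Beta a')))"
      using relation_cl[OF tensor_eq.beta_gamma[OF a]] by (simp only: term_alg_simps)
    then have "(tgen_class A B (Beta (a \<odot>\<^bsub>A\<^esub> a')) \<cdot>\<^bsub>A \<otimes> B\<^esub> Run (A \<otimes> B) (Unit (A \<otimes> B))) \<cdot>\<^bsub>A \<otimes> B\<^esub> RunInv (A \<otimes> B) (Unit (A \<otimes> B)) =
      (tgen_class A B (Gamma a a' (Unit B)) \<cdot>\<^bsub>A \<otimes> B\<^esub> (tgen_class A B (Beta a) \<boxtimes>\<^bsub>A \<otimes> B\<^esub> tgen_class A B (Beta a'))) \<cdot>\<^bsub>A \<otimes> B\<^esub> RunInv (A \<otimes> B) (Unit (A \<otimes> B))"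
      by (simp add: tensor_sig_simps tensor_words del: AB.comp_assoc')
    then show "tgen_class A B (Gamma a a' (Unit B)) \<cdot>\<^bsub>A \<otimes> B\<^esub> F0 (box_fun B (A \<otimes> B) (eta_obj A B a) (eta_obj A B a')) = F0 (eta_obj A B (a \<odot>\<^bsub>A\<^esub> a'))"
      by (simp add: eta_obj_simps box_fun_simps tensor_sig_simps tensor_words)
  next
    fix x y assume xy [simp]: "x \<in> Obj B" "y \<in> Obj B"
    let ?g = "\<lambda>e. tgen_class A B e"
    have "cl (TGen (Gamma a a' (x \<odot>\<^bsub>B\<^esub> y)) \<cdot>\<^bsub>TA\<^esub> (TGen (Delta a x y) \<boxtimes>\<^bsub>TA\<^esub> TGen (Delta a' x y))) =
      cl (TGen (Delta (a \<odot>\<^bsub>A\<^esub> a') x y) \<cdot>\<^bsub>TA\<^esub> (TGen (Gamma a a' x) \<boxtimes>\<^bsub>TA\<^esub> TGen (Gamma a a' y)) \<cdot>\<^bsub>TA\<^esub>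
        interchange TA (WGen (a, x)) (WGen (a, y)) (WGen (a', x)) (WGen (a', y)))"
      using relation_cl[OF tensor_eq.gamma_delta[OF a xy]] by (simp only: term_alg_simps)
    then have gd: "?g (Gamma a a' (x \<odot>\<^bsub>B\<^esub> y)) \<cdot>\<^bsub>A \<otimes> B\<^esub> (?g (Delta a x y) \<boxtimes>\<^bsub>A \<otimes> B\<^esub> ?g (Delta a' x y)) =
      ?g (Delta (a \<odot>\<^bsub>A\<^esub> a') x y) \<cdot>\<^bsub>A \<otimes> B\<^esub> (?g (Gamma a a' x) \<boxtimes>\<^bsub>A \<otimes> B\<^esub> ?g (Gamma a a' y)) \<cdot>\<^bsub>A \<otimes> B\<^esub>
        interchange (A \<otimes> B) (WGen (a, x)) (WGen (a, y)) (WGen (a', x)) (WGen (a', y))"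
      by (simp add: tensor_sig_simps tensor_words)
    have "?g (Gamma a a' (x \<odot>\<^bsub>B\<^esub> y)) \<cdot>\<^bsub>A \<otimes> B\<^esub> F2 (box_fun B (A \<otimes> B) (eta_obj A B a) (eta_obj A B a')) (x, y) =
      (?g (Gamma a a' (x \<odot>\<^bsub>B\<^esub> y)) \<cdot>\<^bsub>A \<otimes> B\<^esub> (?g (Delta a x y) \<boxtimes>\<^bsub>A \<otimes> B\<^esub> ?g (Delta a' x y))) \<cdot>\<^bsub>A \<otimes> B\<^esub>
        interchange (A \<otimes> B) (WGen (a, x)) (WGen (a', x)) (WGen (a, y)) (WGen (a', y))"
      by (simp add: box_fun_simps eta_obj_simps tensor_sig_simps tensor_words cl.k_Obj)
    also have "\<dots> = F2 (eta_obj A B (a \<odot>\<^bsub>A\<^esub> a')) (x, y) \<cdot>\<^bsub>A \<otimes> B\<^esub> (?g (Gamma a a' x) \<boxtimes>\<^bsub>A \<otimes> B\<^esub> ?g (Gamma a a' y))"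
      unfolding gd by (simp add: eta_obj_simps tensor_sig_simps tensor_words AB.interchange_interchange)
    finally show "?g (Gamma a a' (x \<odot>\<^bsub>B\<^esub> y)) \<cdot>\<^bsub>A \<otimes> B\<^esub> F2 (box_fun B (A \<otimes> B) (eta_obj A B a) (eta_obj A B a')) (x, y) =
      F2 (eta_obj A B (a \<odot>\<^bsub>A\<^esub> a')) (x, y) \<cdot>\<^bsub>A \<otimes> B\<^esub> (?g (Gamma a a' x) \<boxtimes>\<^bsub>A \<otimes> B\<^esub> ?g (Gamma a a' y))" .
  qed (auto simp: eta_obj_functor Hom_iff tensor_sig_simps eta_obj_simps box_fun_simps box_functor tensor_words)
  then show ?thesis by (simp add: eta_def hom_simps)
qed

lemma eta_functor: "sm_functor A (hom B (A \<otimes> B)) (eta A B)"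
proof (rule functor_into_hom)
  interpret H: sm_category "hom B (A \<otimes> B)" by (intro hom_category B.sm_category_axioms AB.sm_category_axioms)
  show "functor_data A (hom B (A \<otimes> B)) (eta A B)"
  proof unfold_locales
    fix a assume "a \<in> Obj A"
    then show "FO (eta A B) a \<in> Obj (hom B (A \<otimes> B))" by (simp add: eta_simps hom_simps eta_obj_functor)
  next
    fix f assume "f \<in> Arr A"
    then show "FA (eta A B) f \<in> Hom (hom B (A \<otimes> B)) (FO (eta A B) (Dom A f)) (FO (eta A B) (Cod A f))"
      using mnat_eta_arr[of f] by (simp add: Hom_iff hom_simps) (simp add: eta_def)
  next
    show "F0 (eta A B) \<in> Hom (hom B (A \<otimes> B)) (Unit (hom B (A \<otimes> B))) (FO (eta A B) (Unit A))"
      using mnat_eta_F0 by (simp add: Hom_iff hom_simps) (simp add: eta_def hom_simps)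
  next
    fix a a' assume "a \<in> Obj A" "a' \<in> Obj A"
    then show "F2 (eta A B) (a, a') \<in> Hom (hom B (A \<otimes> B)) (FO (eta A B) a \<odot>\<^bsub>hom B (A \<otimes> B)\<^esub> FO (eta A B) a') (FO (eta A B) (a \<odot>\<^bsub>A\<^esub> a'))"
      using mnat_eta_F2[of a a'] by (simp add: Hom_iff hom_simps) (simp add: eta_def hom_simps)
  qed
qed (auto simp: eta_def eta_right_functor[unfolded eta_def] A.sm_category_axioms B.sm_category_axioms AB.sm_category_axioms)

end

section \<open>Duality\<close>

text \<open>
  A functor \<open>F : A \<rightarrow> [B, C]\<close> as a functor of two variables. The equations relating its structure in the two variables are
  those of the tensor, and they are symmetric in the variables; hence the dual
  is a functor as well.
\<close>

locale bifunctor = smc_pair A B + C: sm_category C + F: sm_functor A "hom B C" F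
  for A :: "('oa, 'ma) smcat" and B :: "('ob, 'mb) smcat" and C :: "('oc, 'mc) smcat" (structure) and F
begin

lemma FO_functor: "a \<in> Obj A \<Longrightarrow> sm_functor B C (FO F a)"
  using F.FO_Obj[of a] by (simp add: hom_simps)

lemma ntDom_ntCod [simp]:
  "f \<in> Arr A \<Longrightarrow> ntDom (FA F f) = FO F (Dom A f)" "f \<in> Arr A \<Longrightarrow> ntCod (FA F f) = FO F (Cod A f)"
  "ntDom (F0 F) = const_fun B C" "ntCod (F0 F) = FO F (Unit A)"
  "a \<in> Obj A \<Longrightarrow> a' \<in> Obj A \<Longrightarrow> ntDom (F2 F (a, a')) = box_fun B C (FO F a) (FO F a')"
  "a \<in> Obj A \<Longrightarrow> a' \<in> Obj A \<Longrightarrow> ntCod (F2 F (a, a')) = FO F (a \<odot>\<^bsub>A\<^esub> a')"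
  using F.FA_typing(2,3)[of f] F.F0_typing(2,3) F.F2_typing(2,3)[of a a'] by (simp_all add: hom_simps)

lemma FA_nat: "f \<in> Arr A \<Longrightarrow> mon_nat B C (FA F f)"
  and F0_nat: "mon_nat B C (F0 F)"
  and F2_nat: "a \<in> Obj A \<Longrightarrow> a' \<in> Obj A \<Longrightarrow> mon_nat B C (F2 F (a, a'))"
  using F.FA_typing(1)[of f] F.F0_typing(1) F.F2_typing(1)[of a a'] by (simp_all add: hom_simps)

lemma dual_obj_simps:
  "a \<in> Obj A \<Longrightarrow> FO (dual_obj A F b) a = FO (FO F a) b" "f \<in> Arr A \<Longrightarrow> FA (dual_obj A F b) f = ntMap (FA F f) b"
  "F0 (dual_obj A F b) = ntMap (F0 F) b"
  "a \<in> Obj A \<Longrightarrow> a' \<in> Obj A \<Longrightarrow> F2 (dual_obj A F b) (a, a') = ntMap (F2 F (a, a')) b"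
  by (simp_all add: dual_obj_def)

lemma dual_at_functor: "b \<in> Obj B \<Longrightarrow> sm_functor A C (dual_obj A F b)"
  by (rule dual_obj_functor[OF F.sm_functor_axioms B.sm_category_axioms C.sm_category_axioms])

lemma FO_FO_Obj [simp]: "a \<in> Obj A \<Longrightarrow> b \<in> Obj B \<Longrightarrow> FO (FO F a) b \<in> Obj C"
  using sm_functor.FO_in[OF FO_functor] .

lemma value_typing [simp]:
  "a \<in> Obj A \<Longrightarrow> g \<in> Arr B \<Longrightarrow> FA (FO F a) g \<in> Hom C (FO (FO F a) (Dom B g)) (FO (FO F a) (Cod B g))"
  "a \<in> Obj A \<Longrightarrow> F0 (FO F a) \<in> Hom C (Unit C) (FO (FO F a) (Unit B))"
  "a \<in> Obj A \<Longrightarrow> b \<in> Obj B \<Longrightarrow> b' \<in> Obj B \<Longrightarrow>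
     F2 (FO F a) (b, b') \<in> Hom C (FO (FO F a) b \<odot> FO (FO F a) b') (FO (FO F a) (b \<odot>\<^bsub>B\<^esub> b'))"
  "f \<in> Arr A \<Longrightarrow> b \<in> Obj B \<Longrightarrow> ntMap (FA F f) b \<in> Hom C (FO (FO F (Dom A f)) b) (FO (FO F (Cod A f)) b)"
  "b \<in> Obj B \<Longrightarrow> ntMap (F0 F) b \<in> Hom C (Unit C) (FO (FO F (Unit A)) b)"
  "a \<in> Obj A \<Longrightarrow> a' \<in> Obj A \<Longrightarrow> b \<in> Obj B \<Longrightarrow>
     ntMap (F2 F (a, a')) b \<in> Hom C (FO (FO F a) b \<odot> FO (FO F a') b) (FO (FO F (a \<odot>\<^bsub>A\<^esub> a')) b)"
  using sm_functor.FA_in[OF FO_functor, of a g "Dom B g" "Cod B g"] sm_functor.F0_in[OF FO_functor]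
    sm_functor.F2_in[OF FO_functor] mon_nat.ntMap_in[OF FA_nat, of f b] mon_nat.ntMap_in[OF F0_nat, of b]
    mon_nat.ntMap_in[OF F2_nat, of a a' b]
  by (simp_all add: Hom_iff const_fun_simps box_fun_simps)

lemmas value_typing' [simp] = value_typing[unfolded Hom_iff, THEN conjunct1]
  value_typing[unfolded Hom_iff, THEN conjunct2, THEN conjunct1]
  value_typing[unfolded Hom_iff, THEN conjunct2, THEN conjunct2]

lemma alpha_delta_value:
  assumes [simp]: "b \<in> Obj B" "b' \<in> Obj B"
  shows "ntMap (F0 F) (b \<odot>\<^bsub>B\<^esub> b') \<cdot> Run C (Unit C) = F2 (FO F (Unit A)) (b, b') \<cdot> (ntMap (F0 F) b \<boxtimes> ntMap (F0 F) b')"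
  using mon_nat.mon_ten'[OF F0_nat assms] by (simp add: const_fun_simps)

lemma beta_alpha_value: "F0 (FO F (Unit A)) = ntMap (F0 F) (Unit B)"
  using mon_nat.mon_unit'[OF F0_nat] by (simp add: const_fun_simps)

lemma beta_gamma_value:
  assumes [simp]: "a \<in> Obj A" "a' \<in> Obj A"
  shows "F0 (FO F (a \<odot>\<^bsub>A\<^esub> a')) \<cdot> Run C (Unit C) = ntMap (F2 F (a, a')) (Unit B) \<cdot> (F0 (FO F a) \<boxtimes> F0 (FO F a'))"
proof -
  have "F0 (FO F (a \<odot>\<^bsub>A\<^esub> a')) \<cdot> Run C (Unit C) =
     (ntMap (F2 F (a, a')) (Unit B) \<cdot> (F0 (FO F a) \<boxtimes> F0 (FO F a')) \<cdot> RunInv C (Unit C)) \<cdot> Run C (Unit C)"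
    using mon_nat.mon_unit'[OF F2_nat[OF assms]] by (simp add: box_fun_simps)
  then show ?thesis by simp
qed

lemma gamma_delta_value:
  assumes [simp]: "a \<in> Obj A" "a' \<in> Obj A" "b \<in> Obj B" "b' \<in> Obj B"
  shows "ntMap (F2 F (a, a')) (b \<odot>\<^bsub>B\<^esub> b') \<cdot> (F2 (FO F a) (b, b') \<boxtimes> F2 (FO F a') (b, b')) =
    F2 (FO F (a \<odot>\<^bsub>A\<^esub> a')) (b, b') \<cdot> (ntMap (F2 F (a, a')) b \<boxtimes> ntMap (F2 F (a, a')) b') \<cdot>
      interchange C (FO (FO F a) b) (FO (FO F a) b') (FO (FO F a') b) (FO (FO F a') b')"
proof -
  have "(F2 (FO F (a \<odot>\<^bsub>A\<^esub> a')) (b, b') \<cdot> (ntMap (F2 F (a, a')) b \<boxtimes> ntMap (F2 F (a, a')) b')) \<cdot>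
      interchange C (FO (FO F a) b) (FO (FO F a) b') (FO (FO F a') b) (FO (FO F a') b') =
    (ntMap (F2 F (a, a')) (b \<odot>\<^bsub>B\<^esub> b') \<cdot> (F2 (FO F a) (b, b') \<boxtimes> F2 (FO F a') (b, b')) \<cdot>
      interchange C (FO (FO F a) b) (FO (FO F a') b) (FO (FO F a) b') (FO (FO F a') b')) \<cdot>
      interchange C (FO (FO F a) b) (FO (FO F a) b') (FO (FO F a') b) (FO (FO F a') b')"
    using mon_nat.mon_ten'[OF F2_nat[OF assms(1,2)] assms(3,4)] by (simp add: box_fun_simps)
  then show ?thesis by (simp add: C.interchange_interchange)
qed

lemma dual_FA_nat:
  assumes [simp]: "g \<in> Arr B"
  shows "mon_nat A C \<lparr> ntDom = dual_obj A F (Dom B g), ntCod = dual_obj A F (Cod B g), ntMap = (\<lambda>a\<in>Obj A. FA (FO F a) g) \<rparr>"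
proof (rule mon_natI)
  fix f assume [simp]: "f \<in> Arr A"
  show "FA (dual_obj A F (Cod B g)) f \<cdot> FA (FO F (Dom A f)) g = FA (FO F (Cod A f)) g \<cdot> FA (dual_obj A F (Dom B g)) f"
    using mon_nat.naturality'[OF FA_nat[of f], of g "Dom B g"] by (simp add: dual_obj_simps)
next
  show "FA (FO F (Unit A)) g \<cdot> F0 (dual_obj A F (Dom B g)) = F0 (dual_obj A F (Cod B g))"
    using mon_nat.naturality'[OF F0_nat, of g "Dom B g"] by (simp add: dual_obj_simps const_fun_simps)
next
  fix x y assume [simp]: "x \<in> Obj A" "y \<in> Obj A"
  show "FA (FO F (x \<odot>\<^bsub>A\<^esub> y)) g \<cdot> F2 (dual_obj A F (Dom B g)) (x, y) =
    F2 (dual_obj A F (Cod B g)) (x, y) \<cdot> (FA (FO F x) g \<boxtimes> FA (FO F y) g)"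
    using mon_nat.naturality'[OF F2_nat[of x y], of g "Dom B g"] by (simp add: dual_obj_simps box_fun_simps)
qed (simp_all add: dual_at_functor dual_obj_simps)

lemma dual_F0_nat:
  "mon_nat A C \<lparr> ntDom = const_fun A C, ntCod = dual_obj A F (Unit B), ntMap = (\<lambda>a\<in>Obj A. F0 (FO F a)) \<rparr>"
proof (rule mon_natI)
  fix f assume [simp]: "f \<in> Arr A"
  show "FA (dual_obj A F (Unit B)) f \<cdot> F0 (FO F (Dom A f)) = F0 (FO F (Cod A f)) \<cdot> FA (const_fun A C) f"
    using mon_nat.mon_unit'[OF FA_nat[of f]] by (simp add: dual_obj_simps const_fun_simps)
qed (simp_all add: dual_at_functor dual_obj_simps const_functor A.sm_category_axioms C.sm_category_axioms
    const_fun_simps beta_alpha_value beta_gamma_value)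

lemma dual_F2_nat:
  assumes [simp]: "b \<in> Obj B" "b' \<in> Obj B"
  shows "mon_nat A C \<lparr> ntDom = box_fun A C (dual_obj A F b) (dual_obj A F b'), ntCod = dual_obj A F (b \<odot>\<^bsub>B\<^esub> b'),
     ntMap = (\<lambda>a\<in>Obj A. F2 (FO F a) (b, b')) \<rparr>"
proof (rule mon_natI)
  fix f assume [simp]: "f \<in> Arr A"
  show "FA (dual_obj A F (b \<odot>\<^bsub>B\<^esub> b')) f \<cdot> F2 (FO F (Dom A f)) (b, b') =
    F2 (FO F (Cod A f)) (b, b') \<cdot> FA (box_fun A C (dual_obj A F b) (dual_obj A F b')) f"
    using mon_nat.mon_ten'[OF FA_nat[of f], of b b'] by (simp add: dual_obj_simps box_fun_simps)
next
  have "(ntMap (F0 F) (b \<odot>\<^bsub>B\<^esub> b') \<cdot> Run C (Unit C)) \<cdot> RunInv C (Unit C) =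
      (F2 (FO F (Unit A)) (b, b') \<cdot> (ntMap (F0 F) b \<boxtimes> ntMap (F0 F) b')) \<cdot> RunInv C (Unit C)"
    by (simp only: alpha_delta_value assms)
  then show "F2 (FO F (Unit A)) (b, b') \<cdot> F0 (box_fun A C (dual_obj A F b) (dual_obj A F b')) = F0 (dual_obj A F (b \<odot>\<^bsub>B\<^esub> b'))"
    by (simp add: dual_obj_simps box_fun_simps)
next
  fix x y assume [simp]: "x \<in> Obj A" "y \<in> Obj A"
  show "F2 (FO F (x \<odot>\<^bsub>A\<^esub> y)) (b, b') \<cdot> F2 (box_fun A C (dual_obj A F b) (dual_obj A F b')) (x, y) =
    F2 (dual_obj A F (b \<odot>\<^bsub>B\<^esub> b')) (x, y) \<cdot> (F2 (FO F x) (b, b') \<boxtimes> F2 (FO F y) (b, b'))"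
    by (simp add: dual_obj_simps box_fun_simps gamma_delta_value)
qed (simp_all add: dual_at_functor box_functor dual_obj_simps box_fun_simps)

lemma dual_obj_dual: "a \<in> Obj A \<Longrightarrow> dual_obj B (dual A B C F) a = FO F a"
proof -
  assume a [simp]: "a \<in> Obj A"
  interpret Fa: sm_functor B C "FO F a" by (rule FO_functor) fact
  show ?thesis
  proof (rule smfun.equality)
    show "FO (dual_obj B (dual A B C F) a) = FO (FO F a)"
      by (rule extensionalityI[OF _ Fa.FO_ext]) (simp_all add: dual_obj_def dual_def)
    show "FA (dual_obj B (dual A B C F) a) = FA (FO F a)"
      by (rule extensionalityI[OF _ Fa.FA_ext]) (simp_all add: dual_obj_def dual_def)
    show "F2 (dual_obj B (dual A B C F) a) = F2 (FO F a)"
      by (rule extensionalityI[OF _ Fa.F2_ext]) (auto simp: dual_obj_def dual_def)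
  qed (simp_all add: dual_obj_def dual_def)
qed

text \<open>
  Evaluating the dual at \<open>a\<close> gives back \<open>F a\<close>, so functoriality of the dual is that of the values of \<open>F\<close>.
\<close>

lemma dual_functor: "sm_functor B (hom A C) (dual A B C F)"
proof (rule functor_into_hom)
  interpret H: sm_category "hom A C" by (intro hom_category A.sm_category_axioms C.sm_category_axioms)
  show "functor_data B (hom A C) (dual A B C F)"
    by unfold_locales
      (auto simp: Hom_iff dual_def hom_simps dual_at_functor dual_FA_nat dual_F0_nat dual_F2_nat)
  show "FO (dual A B C F) \<in> extensional (Obj B)" "FA (dual A B C F) \<in> extensional (Arr B)"
    "F2 (dual A B C F) \<in> extensional (Obj B \<times> Obj B)"
    by (simp_all add: dual_def)
qed (simp_all add: dual_obj_dual FO_functor A.sm_category_axioms B.sm_category_axioms C.sm_category_axioms)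

section \<open>The universal property of the tensor\<close>

definition gen_obj where "gen_obj = (\<lambda>(a, b). FO (FO F a) b)"

lemma gen_obj_pair [simp]: "gen_obj (a, b) = FO (FO F a) b"
  by (simp add: gen_obj_def)

sublocale valuation "tensor_sig A B" C gen_obj "En_gen F"
proof
  fix e assume "e \<in> sArr sig"
  then show "En_gen F e \<in> Hom C (eval_word C gen_obj (sDom sig e)) (eval_word C gen_obj (sCod sig e))"
    by (cases e) (simp_all add: tensor_sig_simps)
qed (auto simp: tensor_sig_simps)

text \<open>
  Evaluation takes the formal functors to the partial functors of \<open>F\<close>. So the relations that express functoriality
  and naturality of the formal functors turn into axioms that hold for \<open>F\<close>.
\<close>

lemma left_value: "a \<in> Obj A \<Longrightarrow> eval.is_image B (formal_left a) (FO F a)"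
  by (simp add: eval.is_image_def formal_simps)

lemma right_value: "b \<in> Obj B \<Longrightarrow> eval.is_image A (formal_right b) (dual_obj A F b)"
  by (simp add: eval.is_image_def formal_simps dual_obj_simps)

sublocale model "tensor_sig A B" "tensor_eq A B" C gen_obj "En_gen F"
proof
  fix t u assume "tensor_eq A B t u"
  then show "eval_term C gen_obj (En_gen F) t = eval_term C gen_obj (En_gen F) u"
  proof cases
    case (left_functor a)
    then show ?thesis
      using eval.functor_eq_image[OF left_value formal_left_data] FO_functor[THEN sm_functor.functor_axioms_hold]
      by blast
  next
    case (right_functor b)
    then show ?thesis
      using eval.functor_eq_image[OF right_value formal_right_data] dual_at_functor[THEN sm_functor.functor_axioms_hold]
      by blast
  next
    case (left_mnat f a a')
    then have f: "f \<in> Arr A" "Dom A f = a" "Cod A f = a'" and a: "a \<in> Obj A" "a' \<in> Obj A" by (auto simp: Hom_iff)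
    have "mnat_eq B C (FO F a) (FO F a') (ntMap (FA F f)) (eval_term C gen_obj (En_gen F) t) (eval_term C gen_obj (En_gen F) u)"
      by (rule eval.mnat_eq_image[OF left_value[OF a(1)] formal_left_data[OF a(1)] left_value[OF a(2)] formal_left_data[OF a(2)] _ _ left_mnat(2)])
        (use f in \<open>auto simp: Hom_iff formal_simps tensor_sig_simps\<close>)
    then show ?thesis using mon_nat.mnat_axioms_hold[OF FA_nat[OF f(1)]] f by simp
  next
    case (right_mnat g b b')
    then have g: "g \<in> Arr B" "Dom B g = b" "Cod B g = b'" and b: "b \<in> Obj B" "b' \<in> Obj B" by (auto simp: Hom_iff)
    have "mnat_eq A C (dual_obj A F b) (dual_obj A F b') (\<lambda>a\<in>Obj A. FA (FO F a) g) (eval_term C gen_obj (En_gen F) t) (eval_term C gen_obj (En_gen F) u)"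
      by (rule eval.mnat_eq_image[OF right_value[OF b(1)] formal_right_data[OF b(1)] right_value[OF b(2)] formal_right_data[OF b(2)] _ _ right_mnat(2)])
        (use g in \<open>auto simp: Hom_iff formal_simps tensor_sig_simps\<close>)
    then show ?thesis using mon_nat.mnat_axioms_hold[OF dual_FA_nat[OF g(1)]] g by simp
  next
    case (alpha_delta b b')
    then show ?thesis using alpha_delta_value[of b b'] by (simp add: tensor_sig_simps)
  next
    case (beta_gamma a a')
    then show ?thesis using beta_gamma_value[of a a'] by (simp add: tensor_sig_simps)
  next
    case beta_alpha
    then show ?thesis using beta_alpha_value by simp
  next
    case (gamma_delta a a' b b')
    then show ?thesis using gamma_delta_value[of a a' b b'] by (simp add: tensor_sig_simps)
  qed
qed

abbreviation "En_arr p \<equiv> eval_term C gen_obj (En_gen F) (rep p)"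

lemma En_strict_hom: "strict_hom (A \<otimes> B) C (eval_word C gen_obj) (\<lambda>p. En_arr p)"
  unfolding tensor_presented by (rule presented_strict_hom)

lemma En_eq: "En A B C F = strict_fun (A \<otimes> B) C (eval_word C gen_obj) (\<lambda>p. En_arr p)"
  by (simp add: En_def gen_obj_def)

lemma En_functor: "sm_functor (A \<otimes> B) C (En A B C F)"
  unfolding En_eq by (intro strict_hom.strict_fun_functor En_strict_hom AB.sm_category_axioms C.sm_category_axioms)

lemma En_arr_gen: "e \<in> sArr sig \<Longrightarrow> En_arr (tgen_class A B e) = En_gen F e"
  using eval_rep[of "TGen e"] by simp

lemma En_simps:
  "a \<in> Obj A \<Longrightarrow> b \<in> Obj B \<Longrightarrow> FO (En A B C F) (WGen (a, b)) = FO (FO F a) b"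
  "e \<in> sArr sig \<Longrightarrow> FA (En A B C F) (tgen_class A B e) = En_gen F e"
  "F0 (En A B C F) = \<one> (Unit C)"
  "X \<in> Obj (A \<otimes> B) \<Longrightarrow> Y \<in> Obj (A \<otimes> B) \<Longrightarrow>
     F2 (En A B C F) (X, Y) = \<one> (FO (En A B C F) X \<odot> FO (En A B C F) Y)"
  by (simp_all add: En_eq strict_fun_def En_arr_gen Obj_tensor tensor_sig_simps)

end

section \<open>The two composites\<close>

lemma strict_hom_comp:
  assumes "strict_hom N N' k h" "strict_hom N' N'' k' h'"
  shows "strict_hom N N'' (k' \<circ> k) (h' \<circ> h)"
proof -
  interpret f: strict_hom N N' k h by fact
  interpret g: strict_hom N' N'' k' h' by fact
  show ?thesis by unfold_locales auto
qed

lemma comp_strict_fun: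
  assumes "strict_hom N N' k h" "strict_hom N' N'' k' h'" "sm_category N''"
  shows "comp_fun N N'' (strict_fun N' N'' k' h') (strict_fun N N' k h) = strict_fun N N'' (k' \<circ> k) (h' \<circ> h)"
proof -
  interpret f: strict_hom N N' k h by fact
  interpret g: strict_hom N' N'' k' h' by fact
  interpret N'': sm_category N'' by fact
  show ?thesis
    by (rule smfun.equality) (auto simp: comp_fun_def strict_fun_def intro!: restrict_ext)
qed

lemma (in presentation) strict_fun_eqI:
  assumes "strict_hom (presented S E) C k h" "strict_hom (presented S E) C k' h'"
    and "\<And>x. x \<in> sObj S \<Longrightarrow> k (WGen x) = k' (WGen x)"
    and "\<And>e. e \<in> sArr S \<Longrightarrow> h (cl (TGen e)) = h' (cl (TGen e))"
  shows "strict_fun (presented S E) C k h = strict_fun (presented S E) C k' h'"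
proof -
  have "k X = k' X" if "X \<in> Obj (presented S E)" for X
    using strict_hom_unique(1)[OF assms] that by (simp add: presented_simps)
  moreover have "h p = h' p" if "p \<in> Arr (presented S E)" for p
    using strict_hom_unique(2)[OF assms that] .
  ultimately show ?thesis
    by (auto simp: strict_fun_def intro!: restrict_ext)
qed

text \<open>
  Naturality of \<open>En\<close> in the first variable. Both sides are strict, and agree on generators because \<open>\<eta> \<circ> R\<close> consists of
  generators, possibly composed with one another, which \<open>En F\<close> takes to the corresponding values of \<open>F\<close>.
\<close>

lemma (in bifunctor) En_tensor_left:
  assumes "sm_functor X A R"
  shows "comp_fun (X \<otimes> B) C (En A B C F) (tensor_left X A B R) = En X B C (comp_fun X (hom B C) F R)"
proof -
  interpret R: sm_functor X A R by fact
  interpret G: bifunctor X B "A \<otimes> B" "comp_fun X (hom B (A \<otimes> B)) (eta A B) R"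
    by (intro bifunctor.intro smc_pair.intro R.M.sm_category_axioms B.sm_category_axioms AB.sm_category_axioms
        comp_functor[OF R.sm_functor_axioms eta_functor])
  interpret H: bifunctor X B C "comp_fun X (hom B C) F R"
    by (intro bifunctor.intro smc_pair.intro R.M.sm_category_axioms B.sm_category_axioms C.sm_category_axioms
        comp_functor[OF R.sm_functor_axioms F.sm_functor_axioms])
  interpret E: sm_functor A "hom B (A \<otimes> B)" "eta A B" by (rule eta_functor)
  interpret En: strict_hom "A \<otimes> B" C "eval_word C gen_obj" "\<lambda>p. En_arr p" by (rule En_strict_hom)
  let ?k = "eval_word C gen_obj \<circ> eval_word (A \<otimes> B) G.gen_obj" and ?h = "(\<lambda>p. En_arr p) \<circ> (\<lambda>p. G.En_arr p)"
  have "strict_fun (X \<otimes> B) C ?k ?h = strict_fun (X \<otimes> B) C (eval_word C H.gen_obj) (\<lambda>p. H.En_arr p)"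
    unfolding G.tensor_presented
  proof (rule G.strict_fun_eqI)
    show "strict_hom (presented G.sig (tensor_eq X B)) C ?k ?h"
      using strict_hom_comp[OF G.En_strict_hom En_strict_hom] by (simp only: G.tensor_presented)
    show "strict_hom (presented G.sig (tensor_eq X B)) C (eval_word C H.gen_obj) (\<lambda>p. H.En_arr p)"
      using H.En_strict_hom by (simp only: G.tensor_presented)
    fix x assume "x \<in> sObj G.sig"
    then show "?k (WGen x) = eval_word C H.gen_obj (WGen x)"
      by (auto simp: tensor_sig_simps comp_fun_simps eta_simps eta_obj_simps)
  next
    fix e assume e: "e \<in> sArr G.sig"
    have "En_arr (En_gen (comp_fun X (hom B (A \<otimes> B)) (eta A B) R) e) = En_gen (comp_fun X (hom B C) F R) e"
      using e by (cases e)
        (simp_all add: tensor_sig_simps comp_fun_simps eta_simps eta_obj_simps En_arr_gen ntMap_comp)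
    with e show "?h (fclass G.sig (tensor_eq X B) (TGen e)) = H.En_arr (fclass G.sig (tensor_eq X B) (TGen e))"
      by (simp add: G.En_arr_gen H.En_arr_gen)
  qed
  then show ?thesis
    unfolding tensor_left_def En_eq G.En_eq H.En_eq
    by (simp add: comp_strict_fun[OF G.En_strict_hom En_strict_hom C.sm_category_axioms])
qed

text \<open>
  The universal property of \<open>\<eta>\<close> with the second variable fixed: \<open>En F\<close> takes the generators that make up \<open>- \<otimes> b\<close> to
  the structure of \<open>F - b\<close>.
\<close>

lemma (in bifunctor) En_after_eta:
  assumes b: "b \<in> Obj B"
  shows "comp_fun A C (En A B C F) (dual_obj A (eta A B) b) = dual_obj A F b"
proof (rule smfun.equality)
  interpret D: sm_functor A "A \<otimes> B" "dual_obj A (eta A B) b" by (rule eta_right_functor) fact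
  note simps = comp_fun_def dual_obj_def eta_simps eta_obj_simps En_simps tensor_sig_simps b
  show "FO (comp_fun A C (En A B C F) (dual_obj A (eta A B) b)) = FO (dual_obj A F b)"
    by (auto simp: simps intro!: restrict_ext)
  show "FA (comp_fun A C (En A B C F) (dual_obj A (eta A B) b)) = FA (dual_obj A F b)"
    by (auto simp: simps intro!: restrict_ext)
  show "F0 (comp_fun A C (En A B C F) (dual_obj A (eta A B) b)) = F0 (dual_obj A F b)"
    by (simp add: simps)
  have W: "WGen (a, b) \<in> Obj (A \<otimes> B)" if "a \<in> Obj A" for a
    using that b by (simp add: Obj_tensor tensor_sig_simps)
  show "F2 (comp_fun A C (En A B C F) (dual_obj A (eta A B) b)) = F2 (dual_obj A F b)"
    using b by (auto simp: simps W intro!: restrict_ext)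
qed simp

context smc_pair
begin

lemma into_hom_eta:
  assumes "sm_category C"
  shows "into_hom A B (A \<otimes> B) C (eta A B)"
  by (intro into_hom.intro A.sm_category_axioms B.sm_category_axioms AB.sm_category_axioms assms eta_functor)

lemma Rn_eq:
  assumes "sm_category C"
  shows "Rn A B C = strict_fun (hom (A \<otimes> B) C) (hom A (hom B C)) (into_hom.after A B (A \<otimes> B) C (eta A B))
    (into_hom.after_nt A B (A \<otimes> B) C (eta A B))"
proof -
  interpret into_hom A B "A \<otimes> B" C "eta A B" by (rule into_hom_eta) fact
  show ?thesis unfolding Rn_def by (simp add: after_def[abs_def] after_nt_def[abs_def])
qed

lemma Rn_functor:
  assumes "sm_category C"
  shows "sm_functor (hom (A \<otimes> B) C) (hom A (hom B C)) (Rn A B C)"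
proof -
  interpret into_hom A B "A \<otimes> B" C "eta A B" by (rule into_hom_eta) fact
  show ?thesis unfolding Rn_eq[OF assms]
    by (intro strict_hom.strict_fun_functor after_strict_hom hom_category
        A.sm_category_axioms B.sm_category_axioms AB.sm_category_axioms assms)
qed

text \<open>
  At \<open>a\<close>, the functor \<open>[B, F] \<circ> \<eta>\<close> is \<open>F \<circ> \<eta> a\<close>.
\<close>

lemma eval_Rn:
  assumes C: "sm_category C" and a: "a \<in> Obj A"
  shows "comp_fun (hom (A \<otimes> B) C) (hom B C) (eval_at A (hom B C) a) (Rn A B C) = precomp B (A \<otimes> B) C (eta_obj A B a)"
proof -
  interpret C: sm_category C by fact
  interpret into_hom A B "A \<otimes> B" C "eta A B" by (rule into_hom_eta) fact
  have BC: "sm_category (hom B C)" by (intro hom_category B.sm_category_axioms C)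
  have "strict_fun (hom (A \<otimes> B) C) (hom B C) ((\<lambda>F. FO F a) \<circ> after) ((\<lambda>\<sigma>. ntMap \<sigma> a) \<circ> after_nt) =
    strict_fun (hom (A \<otimes> B) C) (hom B C) (\<lambda>F. comp_fun B C F (eta_obj A B a)) (\<lambda>\<sigma>. whisker_right B C \<sigma> (eta_obj A B a))"
  proof -
    have "FO (after F) a = comp_fun B C F (eta_obj A B a)" for F
      using a by (simp add: FO_after eta_simps)
    moreover have "ntMap (after_nt \<sigma>) a = whisker_right B C \<sigma> (eta_obj A B a)" for \<sigma>
      using a eta_obj_functor[OF a] by (simp add: after_nt_def whisker_right_def[of A] postcomp_nt_def eta_simps hom_simps)
    ultimately show ?thesis by (simp add: o_def)
  qed
  then show ?thesis
    unfolding Rn_eq[OF C] eval_at_def precomp_def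
    by (simp add: comp_strict_fun[OF after_strict_hom hom_evaluation[OF A.sm_category_axioms BC a] BC])
qed

end

interpretation I: presentation free_sig "\<lambda>_ _. False"
  by unfold_locales auto

lemma free_smc_eq: "\<I> = presented free_sig (\<lambda>_ _. False)"
  by (simp add: free_smc_def free_sig_def UNIV_unit)

lemma free_smc_category: "sm_category \<I>"
  unfolding free_smc_eq by (rule I.presented_category)

lemma star_Obj: "\<star> \<in> Obj \<I>"
  by (simp add: free_smc_eq I.presented_simps)

theorem lemma19p14:
  fixes A :: "('oa, 'ma) smcat" and C :: "('oc, 'mc) smcat"
  assumes "sm_category A" and "sm_category C"
  shows "sm_functor (A \<otimes> C) (A \<otimes> (\<I> \<otimes> C))
           (comp_fun (A \<otimes> C) (A \<otimes> (\<I> \<otimes> C)) (A' A \<I> C) (tensor_left A (A \<otimes> \<I>) C (R' A)))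
       \<and> sm_functor (A \<otimes> C) (A \<otimes> (\<I> \<otimes> C)) (tensor_right A C (\<I> \<otimes> C) (L' C))
       \<and> comp_fun (A \<otimes> C) (A \<otimes> (\<I> \<otimes> C)) (A' A \<I> C) (tensor_left A (A \<otimes> \<I>) C (R' A))
           = tensor_right A C (\<I> \<otimes> C) (L' C)"
proof -
  note I = free_smc_category
  interpret AI: smc_pair A \<I> by (intro smc_pair.intro assms I)
  interpret IC: smc_pair \<I> C by (intro smc_pair.intro assms I)
  interpret AIC: smc_pair A "\<I> \<otimes> C" by (intro smc_pair.intro assms IC.tensor_category)
  define T where "T = A \<otimes> (\<I> \<otimes> C)"
  have T: "sm_category T" unfolding T_def by (rule AIC.tensor_category)
  have CT: "sm_category (hom C T)" by (intro hom_category assms T)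
  define K where "K = comp_fun A (hom \<I> (hom C T)) (Rn \<I> C T) (eta A (\<I> \<otimes> C))"
  have eta: "sm_functor A (hom (\<I> \<otimes> C) T) (eta A (\<I> \<otimes> C))"
    unfolding T_def by (rule AIC.eta_functor)
  have K: "sm_functor A (hom \<I> (hom C T)) K"
    unfolding K_def by (rule comp_functor[OF eta IC.Rn_functor[OF T]])
  interpret K: bifunctor A \<I> "hom C T" K
    by (intro bifunctor.intro AI.smc_pair_axioms CT K)
  interpret EnK: bifunctor "A \<otimes> \<I>" C T "En A \<I> (hom C T) K"
    by (intro bifunctor.intro smc_pair.intro AI.tensor_category assms T K.En_functor)
  have R': "R' A = dual_obj A (eta A \<I>) \<star>"
    unfolding R'_def by (rule comp_eval_at[OF AI.eta_functor I AI.tensor_category star_Obj])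
  have R'_fun: "sm_functor A (A \<otimes> \<I>) (R' A)"
    unfolding R' by (rule AI.eta_right_functor[OF star_Obj])
  interpret etaIC: bifunctor \<I> C "\<I> \<otimes> C" "eta \<I> C"
    by (intro bifunctor.intro IC.smc_pair_axioms IC.tensor_category IC.eta_functor)
  have L': "L' C = eta_obj \<I> C \<star>"
    unfolding L'_def
    by (simp add: comp_eval_at[OF etaIC.dual_functor I IC.tensor_category star_Obj] etaIC.dual_obj_dual star_Obj IC.eta_simps)
  have left: "comp_fun (A \<otimes> C) T (A' A \<I> C) (tensor_left A (A \<otimes> \<I>) C (R' A)) = En A C T (dual_obj A K \<star>)"
  proof -
    have "A' A \<I> C = En (A \<otimes> \<I>) C T (En A \<I> (hom C T) K)"
      by (simp add: A'_def Let_def K_def T_def)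
    then have "comp_fun (A \<otimes> C) T (A' A \<I> C) (tensor_left A (A \<otimes> \<I>) C (R' A)) =
      En A C T (comp_fun A (hom C T) (En A \<I> (hom C T) K) (R' A))"
      by (simp add: EnK.En_tensor_left[OF R'_fun])
    then show ?thesis unfolding R' by (simp add: K.En_after_eta[OF star_Obj])
  qed
  have right: "tensor_right A C (\<I> \<otimes> C) (L' C) = En A C T (dual_obj A K \<star>)"
  proof -
    have "dual_obj A K \<star> = comp_fun A (hom C T) (eval_at \<I> (hom C T) \<star>) K"
      by (rule comp_eval_at[OF K I CT star_Obj, symmetric])
    also have "\<dots> = comp_fun A (hom C T) (comp_fun (hom (\<I> \<otimes> C) T) (hom C T) (eval_at \<I> (hom C T) \<star>) (Rn \<I> C T)) (eta A (\<I> \<otimes> C))"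
      unfolding K_def by (rule comp_fun_assoc[OF eta IC.Rn_functor[OF T] eval_at_functor[OF I CT star_Obj]])
    also have "\<dots> = comp_fun A (hom C T) (precomp C (\<I> \<otimes> C) T (L' C)) (eta A (\<I> \<otimes> C))"
      by (simp add: IC.eval_Rn[OF T star_Obj] L')
    finally show ?thesis by (simp add: tensor_right_def T_def)
  qed
  interpret KS: bifunctor A C T "dual_obj A K \<star>"
    by (intro bifunctor.intro smc_pair.intro assms T dual_obj_functor[OF K I CT star_Obj])
  show ?thesis
    using KS.En_functor left right by (simp add: T_def)
qed

end
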